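(* Let $r\in \mathbb{N}$ with $r\ge 4$ and let $\mu>0$. Then there exists $\alpha>0$ such that the following holds for all sufficiently large $n$ divisible by $r$. Let $G$ be an $n$-vertex graph such that $\delta(G)\geq \left(\frac{1}{2}+\mu\right)n$ and $\alpha_{r-2}(G)\leq \alpha n$. Then $G$ contains a $K_{r}$-factor.
   Context: For a graph $G$ and an integer $\ell\ge 2$, $\alpha_{\ell}(G)$ (the $K_\ell$-independence number) is the maximum size of a set $S\subseteq V(G)$ such that $G[S]$ contains no copy of $K_\ell$. A $K_r$-tiling in $G$ is a collection of vertex-disjoint subgraphs of $G$ each isomorphic to $K_r$; a $K_r$-factor is a $K_r$-tiling covering all vertices of $G$. $\delta(G)$ denotes the minimum degree. *)

theory Defs
  imports Complex_Main
begin

type_synonym 'a graph = "'a set \<times> 'a set set"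

abbreviation verts :: "'a graph \<Rightarrow> 'a set" where
  "verts G \<equiv> fst G"

abbreviation edges :: "'a graph \<Rightarrow> 'a set set" where
  "edges G \<equiv> snd G"

definition simple_graph :: "'a graph \<Rightarrow> bool" where
  "simple_graph G \<longleftrightarrow> finite (verts G) \<and> edges G \<subseteq> {e. e \<subseteq> verts G \<and> card e = 2}"

definition neighbours :: "'a graph \<Rightarrow> 'a \<Rightarrow> 'a set" where
  "neighbours G v = {w. {v, w} \<in> edges G}"

text \<open>Unspecified for the graph without vertices.\<close>

definition min_degree :: "'a graph \<Rightarrow> nat" where
  "min_degree G = Min ((\<lambda>v. card (neighbours G v)) ` verts G)"

definition subgraph :: "'a graph \<Rightarrow> 'a graph \<Rightarrow> bool" where
  "subgraph H G \<longleftrightarrow> simple_graph H \<and> verts H \<subseteq> verts G \<and> edges H \<subseteq> edges G"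

definition induced_subgraph :: "'a graph \<Rightarrow> 'a set \<Rightarrow> 'a graph" where
  "induced_subgraph G S = (S, {e \<in> edges G. e \<subseteq> S})"

definition isomorphic :: "'a graph \<Rightarrow> 'b graph \<Rightarrow> bool" where
  "isomorphic G H \<longleftrightarrow> (\<exists>f. bij_betw f (verts G) (verts H) \<and>
     (\<forall>u\<in>verts G. \<forall>v\<in>verts G. {u, v} \<in> edges G \<longleftrightarrow> {f u, f v} \<in> edges H))"

definition complete_graph :: "nat \<Rightarrow> nat graph" where
  "complete_graph l = ({..<l}, {e. e \<subseteq> {..<l} \<and> card e = 2})"

definition contains_copy :: "'a graph \<Rightarrow> 'b graph \<Rightarrow> bool" where
  "contains_copy G F \<longleftrightarrow> (\<exists>H. subgraph H G \<and> isomorphic H F)"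

text \<open>For a finite graph and \<open>l \<ge> 1\<close> the maximum is over a finite set that contains \<open>0\<close>
  (take \<open>S = {}\<close>).\<close>

definition K_indep_number :: "nat \<Rightarrow> 'a graph \<Rightarrow> nat" where
  "K_indep_number l G =
     Max {card S | S. S \<subseteq> verts G \<and> \<not> contains_copy (induced_subgraph G S) (complete_graph l)}"

definition K_tiling :: "nat \<Rightarrow> 'a graph \<Rightarrow> 'a graph set \<Rightarrow> bool" where
  "K_tiling r G T \<longleftrightarrow> (\<forall>H\<in>T. subgraph H G \<and> isomorphic H (complete_graph r)) \<and>
     pairwise (\<lambda>H H'. disjnt (verts H) (verts H')) T"

definition K_factor :: "nat \<Rightarrow> 'a graph \<Rightarrow> 'a graph set \<Rightarrow> bool" where
  "K_factor r G T \<longleftrightarrow> K_tiling r G T \<and> (\<Union>H\<in>T. verts H) = verts G"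

end

(*
  A leftover that a maximum tiling of K_r's cannot cover is small: each tile sends, on average, at most
  half of the possible edges to the leftover U, since two disjoint pairs in a tile K with linearly many
  common neighbours in U would each extend by a K_{r-2} of U and give two tiles in place of K.

  Exact tilings come from absorption. Two vertices x, y are reachable if, robustly, some bounded set S
  makes both S + x and S + y tileable. Among boundedly many vertices two have many common triangles and
  hence are reachable. If the largest set of pairwise unreachable vertices has k > 1 elements, it splits
  almost all of V into k classes; if no two robust K_r's had class vectors differing by e_b - e_b', then
  every class would send more than half of its edges to itself, and counting the edges that leave a class
  of size at most n/2 with weight 1/deg gives a contradiction. Such a pair of K_r's makes two of the k
  vertices reachable for weaker constants, so after finitely many steps all pairs are reachable.
  Absorbers are then wired along a sparse bipartite graph that has a perfect matching however a
  prescribed number of vertices is deleted from a random reservoir X; the leftover is covered by cliques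
  using X, and the absorbers absorb what remains of X.
*)
theory Submission
  imports Defs "HOL-Library.FuncSet"
begin

section \<open>Cliques, tilings and graphs with small clique-independence number\<close>

text \<open>Every set of more than \<open>\<tau>\<close> vertices contains a K_{r-2}, so an edge
  whose ends share more than \<open>\<tau>\<close> neighbours lies in a K_r. Since any two vertices
  share at least \<open>2 * \<mu> * n\<close> neighbours, single K_r's are easy to find; the
  difficulty is to steer them. For small \<open>\<mu>\<close> the degrees force no common neighbour
  of three vertices, so only two vertices of a K_r can be prescribed, and the other r - 2 come out
  of one set that is known to be large. This is why the leftover argument looks at pairs inside a
  tile, why reachability starts from shared triangles, and why the clique types prescribe two
  classes and take all remaining vertices from a third. The bound of half the edges between a tile
  and the leftover is where \<open>4 \<le> r\<close> enters: a tile sends about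
  \<open>2 * card U\<close> edges, which is at most \<open>r * card U / 2\<close> only from r = 4
  on. "Robustly" means: in spite of any forbidden set of bounded size. Each use can then avoid all
  vertices used before, and nothing has to be counted.\<close>

definition clique :: "('a \<Rightarrow> 'a \<Rightarrow> bool) \<Rightarrow> 'a set \<Rightarrow> bool" where
  "clique E S \<longleftrightarrow> (\<forall>x\<in>S. \<forall>y\<in>S. x \<noteq> y \<longrightarrow> E x y)"

definition Kr :: "('a \<Rightarrow> 'a \<Rightarrow> bool) \<Rightarrow> nat \<Rightarrow> 'a set \<Rightarrow> bool" where
  "Kr E r S \<longleftrightarrow> finite S \<and> card S = r \<and> clique E S"

definition tileable :: "('a \<Rightarrow> 'a \<Rightarrow> bool) \<Rightarrow> nat \<Rightarrow> 'a set \<Rightarrow> bool" where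
  "tileable E r S \<longleftrightarrow> (\<exists>P. (\<forall>K\<in>P. Kr E r K) \<and> pairwise disjnt P \<and> \<Union>P = S)"

definition nb :: "('a \<Rightarrow> 'a \<Rightarrow> bool) \<Rightarrow> 'a set \<Rightarrow> 'a \<Rightarrow> 'a set" where
  "nb E V x = {y\<in>V. E x y}"

lemma tileable_empty: "tileable E r {}"
  unfolding tileable_def by (rule exI[of _ "{}"]) auto

lemma tileable_Kr: "Kr E r K \<Longrightarrow> tileable E r K"
  unfolding tileable_def by (rule exI[of _ "{K}"]) auto

lemma tileable_Un:
  assumes "tileable E r S" "tileable E r T" "S \<inter> T = {}"
  shows "tileable E r (S \<union> T)"
proof -
  obtain P where P: "\<forall>K\<in>P. Kr E r K" "pairwise disjnt P" "\<Union>P = S"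
    using assms(1) unfolding tileable_def by blast
  obtain Q where Q: "\<forall>K\<in>Q. Kr E r K" "pairwise disjnt Q" "\<Union>Q = T"
    using assms(2) unfolding tileable_def by blast
  have "pairwise disjnt (P \<union> Q)"
  proof (rule pairwiseI)
    fix K L assume KL: "K \<in> P \<union> Q" "L \<in> P \<union> Q" "K \<noteq> L"
    show "disjnt K L"
    proof (cases "K \<in> P \<longleftrightarrow> L \<in> P")
      case True then show ?thesis using KL P(2) Q(2) unfolding pairwise_def by blast
    next
      case False then show ?thesis using KL P(3) Q(3) assms(3) unfolding disjnt_def by blast
    qed
  qed
  then show ?thesis unfolding tileable_def
    using P Q by (intro exI[of _ "P \<union> Q"]) auto
qed

lemma tileable_UN:
  assumes "finite I" "\<And>i. i \<in> I \<Longrightarrow> tileable E r (A i)"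
    "\<And>i j. i \<in> I \<Longrightarrow> j \<in> I \<Longrightarrow> i \<noteq> j \<Longrightarrow> A i \<inter> A j = {}"
  shows "tileable E r (\<Union>i\<in>I. A i)"
  using assms
proof (induction I rule: finite_induct)
  case empty then show ?case by (simp add: tileable_empty)
next
  case (insert x F)
  have "tileable E r (A x \<union> (\<Union>i\<in>F. A i))"
  proof (rule tileable_Un)
    show "tileable E r (A x)" using insert.prems(1) by blast
    show "tileable E r (\<Union>i\<in>F. A i)" using insert by blast
    show "A x \<inter> (\<Union>i\<in>F. A i) = {}" using insert.prems(2)[of x] insert.hyps(2) by blast
  qed
  then show ?case by simp
qed

lemma card_tiling:
  assumes "finite P" "\<forall>K\<in>P. Kr E r K" "pairwise disjnt P"
  shows "card (\<Union>P) = card P * r"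
proof -
  have "card (\<Union>P) = sum card P"
    by (rule card_Union_disjoint) (use assms in \<open>auto simp: Kr_def\<close>)
  also have "\<dots> = sum (\<lambda>_. r) P" using assms(2) by (intro sum.cong) (auto simp: Kr_def)
  finally show ?thesis by simp
qed

lemma tileable_dvd:
  assumes "tileable E r S" "finite S" shows "r dvd card S"
proof -
  obtain P where P: "\<forall>K\<in>P. Kr E r K" "pairwise disjnt P" "\<Union>P = S"
    using assms(1) unfolding tileable_def by blast
  have "finite P" using P(3) assms(2) by (metis finite_UnionD)
  then show ?thesis using card_tiling[OF _ P(1,2)] P(3) by simp
qed

text \<open>The sets are chosen one at a time, with \<open>W\<close> collecting \<open>W0\<close>
  and everything chosen so far, never more than \<open>card W0 + card I * s\<close> vertices.
  Families of disjoint cliques, connectors and absorbers are obtained this way from the ability to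
  find a single one outside a set of bounded size.\<close>

lemma greedy_disjoint:
  fixes P :: "'i \<Rightarrow> 'a set \<Rightarrow> bool"
  assumes "finite I" "finite W0"
    and step: "\<And>i W. i \<in> I \<Longrightarrow> finite W \<Longrightarrow> W0 \<subseteq> W \<Longrightarrow> card W \<le> card W0 + card I * s
        \<Longrightarrow> \<exists>A. P i A \<and> finite A \<and> card A \<le> s \<and> A \<inter> W = {}"
  shows "\<exists>A. (\<forall>i\<in>I. P i (A i) \<and> finite (A i) \<and> card (A i) \<le> s \<and> A i \<inter> W0 = {}) \<and>
    (\<forall>i\<in>I. \<forall>j\<in>I. i \<noteq> j \<longrightarrow> A i \<inter> A j = {})"
proof -
  have "\<exists>A. (\<forall>i\<in>J. P i (A i) \<and> finite (A i) \<and> card (A i) \<le> s \<and> A i \<inter> W0 = {}) \<and>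
    (\<forall>i\<in>J. \<forall>j\<in>J. i \<noteq> j \<longrightarrow> A i \<inter> A j = {})" if "J \<subseteq> I" for J
    using finite_subset[OF that assms(1)] that
  proof (induction J rule: finite_induct)
    case empty show ?case by auto
  next
    case (insert x F)
    then obtain A where A: "\<forall>i\<in>F. P i (A i) \<and> finite (A i) \<and> card (A i) \<le> s \<and> A i \<inter> W0 = {}"
      "\<forall>i\<in>F. \<forall>j\<in>F. i \<noteq> j \<longrightarrow> A i \<inter> A j = {}" by auto
    define W where "W = W0 \<union> (\<Union>i\<in>F. A i)"
    have "card W \<le> card W0 + card (\<Union>i\<in>F. A i)" unfolding W_def by (rule card_Un_le)
    also have "card (\<Union>i\<in>F. A i) \<le> (\<Sum>i\<in>F. card (A i))" using insert.hyps by (intro card_UN_le) auto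
    also have "\<dots> \<le> card F * s" using A sum_bounded_above[of F "\<lambda>i. card (A i)" s] by simp
    also have "\<dots> \<le> card I * s" using insert.prems assms(1) by (simp add: card_mono)
    finally have c: "card W \<le> card W0 + card I * s" by simp
    have "finite W" unfolding W_def using assms(2) insert.hyps A by auto
    then obtain B where B: "P x B" "finite B" "card B \<le> s" "B \<inter> W = {}"
      using step[of x W] c insert.prems W_def by auto
    have BF: "B \<inter> A i = {}" if "i \<in> F" for i using B(4) that unfolding W_def by blast
    show ?case
    proof (rule exI[of _ "A(x := B)"], intro conjI ballI impI)
      fix i assume i: "i \<in> insert x F"
      show "P i ((A(x := B)) i)" "finite ((A(x := B)) i)" "card ((A(x := B)) i) \<le> s"
        "(A(x := B)) i \<inter> W0 = {}"
        using A(1) B i unfolding W_def by auto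
      fix j assume j: "j \<in> insert x F" "i \<noteq> j"
      show "(A(x := B)) i \<inter> (A(x := B)) j = {}"
        using A(2) BF i j by (cases "i = x"; cases "j = x") (auto simp: Int_commute)
    qed
  qed
  then show ?thesis by blast
qed

section \<open>Cardinality estimates and double counting\<close>

lemma inter_card_ge:
  fixes X :: "'a set"
  assumes "finite X" "A \<subseteq> X" "B \<subseteq> X"
  shows "real (card A) + real (card B) - real (card X) \<le> real (card (A \<inter> B))"
proof -
  have f: "finite A" "finite B" using assms by (meson finite_subset)+
  have "card (A \<union> B) \<le> card X" using assms by (intro card_mono) auto
  moreover have "card A + card B = card (A \<union> B) + card (A \<inter> B)" using card_Un_Int[OF f] .
  ultimately show ?thesis by linarith
qed

lemma card_Diff_ge:
  assumes "finite W" shows "real (card A) - real (card W) \<le> real (card (A - W))"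
  using diff_card_le_card_Diff[OF assms, of A] by linarith

lemma card_Int_Diff_ge:
  assumes "finite W" shows "real (card (X \<inter> A)) - real (card W) \<le> real (card (X \<inter> (A - W)))"
  using card_Diff_ge[OF assms, of "X \<inter> A"] by (simp add: Int_Diff)

lemma subset_of_card:
  assumes "k \<le> card A" obtains B where "B \<subseteq> A" "card B = k" "finite B"
  using assms obtain_subset_with_card_n by metis

lemma double_count:
  assumes "finite A" "finite B"
  shows "(\<Sum>u\<in>A. card {x\<in>B. R u x}) = (\<Sum>x\<in>B. card {u\<in>A. R u x})"
proof -
  have a: "card {x\<in>B. R u x} = (\<Sum>x\<in>B. if R u x then 1 else 0)" for u
    using assms(2) by (simp add: sum.If_cases Int_def)
  have b: "card {u\<in>A. R u x} = (\<Sum>u\<in>A. if R u x then 1 else 0)" for x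
    using assms(1) by (simp add: sum.If_cases Int_def)
  show ?thesis unfolding a b by (rule sum.swap)
qed

text \<open>A Bonferroni inequality: adding \<open>D a\<close> overcounts by at most
  \<open>card F * h\<close>. Read backwards, it says that many large sets in a small universe cannot
  all be nearly disjoint. The square in place of the number of pairs only loses a constant.\<close>

lemma sum_card_le_Union:
  fixes D :: "'b \<Rightarrow> 'a set" and h :: real
  assumes "finite S" "\<And>x. x \<in> S \<Longrightarrow> finite (D x)" "0 \<le> h"
    "\<And>x y. x \<in> S \<Longrightarrow> y \<in> S \<Longrightarrow> x \<noteq> y \<Longrightarrow> card (D x \<inter> D y) \<le> h"
  shows "(\<Sum>x\<in>S. real (card (D x))) \<le> card (\<Union>x\<in>S. D x) + (real (card S))\<^sup>2 * h"
  using assms(1,2,4)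
proof (induction S rule: finite_induct)
  case empty then show ?case by simp
next
  case (insert a F)
  let ?U = "\<Union>x\<in>F. D x"
  have IH: "(\<Sum>x\<in>F. real (card (D x))) \<le> card ?U + (real (card F))\<^sup>2 * h"
    using insert by auto
  have fU: "finite ?U" "finite (D a)" using insert.hyps insert.prems by auto
  have "D a \<inter> ?U = (\<Union>x\<in>F. D a \<inter> D x)" by blast
  then have "card (D a \<inter> ?U) \<le> (\<Sum>x\<in>F. card (D a \<inter> D x))"
    using insert.hyps(1) by (metis card_UN_le)
  then have "real (card (D a \<inter> ?U)) \<le> (\<Sum>x\<in>F. real (card (D a \<inter> D x)))"
    by (metis of_nat_mono of_nat_sum)
  also have "\<dots> \<le> card F * h"
    using insert.prems(2) insert.hyps by (intro sum_bounded_above) auto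
  finally have i: "real (card (D a \<inter> ?U)) \<le> card F * h" .
  have "card (D a) + card ?U = card (D a \<union> ?U) + card (D a \<inter> ?U)"
    using card_Un_Int fU by blast
  then have "real (card (D a)) + real (card ?U) \<le> real (card (D a \<union> ?U)) + card F * h"
    using i by linarith
  moreover have "(real (card F))\<^sup>2 * h + card F * h \<le> (real (card (insert a F)))\<^sup>2 * h"
    using insert.hyps assms(3) by (simp add: power2_eq_square algebra_simps)
  ultimately show ?case using IH insert.hyps by simp
qed

text \<open>\<open>\<tau>\<close> is an absolute number and not a multiple of \<open>card V\<close>,
  so that \<open>clq\<close> passes unchanged to induced subgraphs; deleting few vertices then costs
  only half of \<open>\<mu>\<close>.\<close>

locale dense_graph =
  fixes V :: "'a set" and E :: "'a \<Rightarrow> 'a \<Rightarrow> bool" and r :: nat and \<mu> \<tau> :: real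
  assumes fin: "finite V" and sym: "E x y \<Longrightarrow> E y x" and irr: "\<not> E x x"
    and r4: "4 \<le> r" and mu: "0 < \<mu>" and tau: "0 \<le> \<tau>"
    and deg: "x \<in> V \<Longrightarrow> (1/2 + \<mu>) * card V \<le> card (nb E V x)"
    and clq: "A \<subseteq> V \<Longrightarrow> \<tau> < card A \<Longrightarrow> \<exists>Q\<subseteq>A. card Q = r - 2 \<and> clique E Q"
begin

abbreviation N where "N \<equiv> nb E V"
abbreviation n where "n \<equiv> real (card V)"

lemma N_sub: "N x \<subseteq> V" and in_N: "y \<in> N x \<longleftrightarrow> y \<in> V \<and> E x y" and finN: "finite (N x)"
  using fin unfolding nb_def by auto

lemma E_comm: "E x y \<longleftrightarrow> E y x"
  using sym by blast

lemma dense_graph_Diff: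
  assumes X: "finite X" "card X \<le> \<mu> / 2 * n"
  shows "dense_graph (V - X) E r (\<mu> / 2) \<tau>"
proof
  show "(1 / 2 + \<mu> / 2) * card (V - X) \<le> card (nb E (V - X) x)" if "x \<in> V - X" for x
  proof -
    have "nb E (V - X) x = N x - X" unfolding nb_def by blast
    then have "real (card (N x)) - card X \<le> card (nb E (V - X) x)" using card_Diff_ge[OF X(1)] by simp
    moreover have "(1 / 2 + \<mu>) * n - \<mu> / 2 * n = (1 / 2 + \<mu> / 2) * n" by (simp add: algebra_simps)
    moreover have "(1 / 2 + \<mu> / 2) * card (V - X) \<le> (1 / 2 + \<mu> / 2) * n"
      using fin mu by (intro mult_left_mono) (auto intro: card_mono)
    ultimately show ?thesis using deg[of x] that X(2) by auto
  qed
  show "\<exists>Q\<subseteq>A. card Q = r - 2 \<and> clique E Q" if "A \<subseteq> V - X" "\<tau> < card A" for A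
    using clq[of A] that by blast
qed (use fin sym irr r4 mu tau in auto)

lemma get_clique:
  assumes "A \<subseteq> V" "\<tau> < card A"
  obtains Q where "Q \<subseteq> A" "card Q = r - 2" "clique E Q" "finite Q"
proof -
  obtain Q where Q: "Q \<subseteq> A" "card Q = r - 2" "clique E Q" using clq[OF assms] by blast
  then have "finite Q" using assms(1) fin by (meson finite_subset)
  then show thesis using that Q by blast
qed

lemma get_edge:
  assumes "A \<subseteq> V" "\<tau> < card A"
  obtains x y where "x \<in> A" "y \<in> A" "E x y" "x \<noteq> y"
proof -
  obtain Q where Q: "Q \<subseteq> A" "card Q = r - 2" "clique E Q" using get_clique[OF assms] .
  then have "2 \<le> card Q" using r4 by simp
  then obtain B where "B \<subseteq> Q" "card B = 2" using subset_of_card by metis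
  then obtain x y where "x \<in> Q" "y \<in> Q" "x \<noteq> y" by (auto simp: card_2_iff)
  then show thesis using that Q unfolding clique_def by blast
qed

lemma independent_small:
  assumes "A \<subseteq> V" "\<And>x y. x \<in> A \<Longrightarrow> y \<in> A \<Longrightarrow> E x y \<Longrightarrow> False"
  shows "card A \<le> \<tau>"
  using get_edge[OF assms(1)] assms(2) by (metis not_less)

lemma codeg:
  assumes "x \<in> V" "y \<in> V" shows "2 * \<mu> * card V \<le> card (N x \<inter> N y)"
  using inter_card_ge[OF fin N_sub N_sub, of x y] deg[OF assms(1)] deg[OF assms(2)]
  by (simp add: algebra_simps)

lemma mu_le: "V \<noteq> {} \<Longrightarrow> \<mu> \<le> 1/2"
proof -
  assume "V \<noteq> {}"
  then obtain x where x: "x \<in> V" by blast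
  have "card (N x) \<le> card V" using fin N_sub by (intro card_mono)
  then have "(1/2 + \<mu>) * card V \<le> 1 * card V" using deg[OF x] by linarith
  moreover have "card V > 0" using fin x by (auto simp: card_gt_0_iff)
  ultimately show ?thesis by (simp add: mult_le_cancel_right)
qed

lemma Kr_extend:
  assumes "Q \<subseteq> N u \<inter> N v" "card Q = r - 2" "clique E Q" "E u v" "u \<noteq> v"
  shows "Kr E r (insert u (insert v Q))" "u \<notin> Q" "v \<notin> Q" "finite Q"
proof -
  show Q: "finite Q" using assms(1) finN by (meson finite_subset finite_Int)
  show u: "u \<notin> Q" and v: "v \<notin> Q" using assms(1) irr in_N by blast+
  show "Kr E r (insert u (insert v Q))"
    unfolding Kr_def clique_def
  proof (intro conjI)
    show "card (insert u (insert v Q)) = r" using u v Q assms(2,5) r4 by simp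
    show "\<forall>x\<in>insert u (insert v Q). \<forall>y\<in>insert u (insert v Q). x \<noteq> y \<longrightarrow> E x y"
      using assms in_N E_comm unfolding clique_def by blast
  qed (use Q in simp)
qed

text \<open>The standard source of K_r's. The set \<open>A\<close> keeps the r - 2 new vertices away
  from vertices already in use, or inside a prescribed class.\<close>

lemma edge_extend:
  assumes "E u v" "\<tau> < card (N u \<inter> N v \<inter> A)"
  obtains Q where "Q \<subseteq> N u \<inter> N v \<inter> A" "card Q = r - 2" "finite Q"
    "Kr E r (insert u (insert v Q))"
proof -
  have "N u \<inter> N v \<inter> A \<subseteq> V" using N_sub by blast
  then obtain Q where Q: "Q \<subseteq> N u \<inter> N v \<inter> A" "card Q = r - 2" "clique E Q" "finite Q"
    by (rule get_clique[OF _ assms(2)])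
  have "u \<noteq> v" using assms(1) irr by blast
  moreover have "Q \<subseteq> N u \<inter> N v" using Q(1) by blast
  ultimately have "Kr E r (insert u (insert v Q))"
    using Kr_extend(1) Q(2,3) assms(1) by metis
  then show thesis by (rule that[OF Q(1,2,4)])
qed

end

section \<open>Almost perfect tilings\<close>

locale max_tiling = dense_graph +
  fixes P :: "'a set set"
  assumes P_Kr: "K \<in> P \<Longrightarrow> Kr E r K \<and> K \<subseteq> V"
    and P_disj: "pairwise disjnt P"
    and P_max: "\<And>P'. \<forall>K\<in>P'. Kr E r K \<and> K \<subseteq> V \<Longrightarrow> pairwise disjnt P' \<Longrightarrow> card P' \<le> card P"
begin

definition U where "U = V - \<Union>P"
text \<open>Chosen so that a common neighbourhood of size \<open>h\<close> has room for
  \<open>\<tau> + 1\<close> disjoint cliques on r - 2 vertices and still more than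
  \<open>\<tau>\<close> further vertices:
  \<open>\<tau> + (\<tau> + 1) * (r - 2) < (\<tau> + 1) * r\<close>.\<close>

definition h where "h = (\<tau> + 1) * r"
definition dU where "dU x = card (N x \<inter> U)"
definition heavy where "heavy x y \<longleftrightarrow> h \<le> card (N x \<inter> N y \<inter> U)"

lemma finP: "finite P"
  using P_Kr fin by (intro finite_subset[of P "Pow V"]) auto

lemma U_sub: "U \<subseteq> V" and finU: "finite U"
  unfolding U_def using fin by auto

lemma heavy_sym: "heavy x y \<longleftrightarrow> heavy y x"
  unfolding heavy_def by (simp add: Int_commute)

lemma h_pos: "0 < h"
  unfolding h_def using tau r4 by simp

lemma P_inter: "K \<in> P \<Longrightarrow> L \<in> P \<Longrightarrow> K \<noteq> L \<Longrightarrow> K \<inter> L = {}"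
  using P_disj unfolding pairwise_def disjnt_def by blast

text \<open>The form in which maximality is used: removing the tiles \<open>P'\<close> frees their
  vertices, and disjoint K_r's on these and on \<open>U\<close> can be put in instead. The free
  index type allows pairs, a single clique, or a family with one extra member.\<close>

lemma swap:
  fixes A :: "'i \<Rightarrow> 'a set"
  assumes "finite I" "P' \<subseteq> P" and A: "\<And>i. i \<in> I \<Longrightarrow> Kr E r (A i)"
    and sub: "\<And>i. i \<in> I \<Longrightarrow> A i \<subseteq> \<Union>P' \<union> U"
    and dis: "\<And>i j. i \<in> I \<Longrightarrow> j \<in> I \<Longrightarrow> i \<noteq> j \<Longrightarrow> A i \<inter> A j = {}"
  shows "card I \<le> card P'"
proof -
  have ne: "A i \<noteq> {}" if "i \<in> I" for i using A[OF that] r4 unfolding Kr_def by auto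
  have inj: "inj_on A I"
    by (rule inj_onI) (metis dis ne inf.idem)
  let ?Q = "(P - P') \<union> A ` I"
  have d0: "K \<inter> A i = {}" if "K \<in> P - P'" "i \<in> I" for K i
  proof -
    have "K \<inter> \<Union>P' = {}" using P_inter that(1) assms(2) by blast
    moreover have "K \<inter> U = {}" using that(1) unfolding U_def by blast
    ultimately show ?thesis using sub[OF that(2)] by blast
  qed
  have "A i \<notin> P - P'" if "i \<in> I" for i using d0[OF _ that, of "A i"] ne[OF that] by blast
  then have disj: "(P - P') \<inter> A ` I = {}" by blast
  have "pairwise disjnt ?Q"
  proof (rule pairwiseI)
    fix K L assume KL: "K \<in> ?Q" "L \<in> ?Q" "K \<noteq> L"
    consider "K \<in> P - P'" "L \<in> P - P'" | i where "i \<in> I" "K = A i" "L \<in> P - P'"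
      | i where "i \<in> I" "L = A i" "K \<in> P - P'" | i j where "i \<in> I" "j \<in> I" "K = A i" "L = A j"
      using KL by blast
    then show "disjnt K L"
    proof cases
      case 1 then show ?thesis using P_inter KL(3) unfolding disjnt_def by blast
    next
      case 2 then show ?thesis using d0 unfolding disjnt_def by blast
    next
      case 3 then show ?thesis using d0 unfolding disjnt_def by blast
    next
      case 4 then show ?thesis using dis[of i j] KL(3) unfolding disjnt_def by blast
    qed
  qed
  moreover have "\<forall>K\<in>?Q. Kr E r K \<and> K \<subseteq> V"
  proof
    fix K assume "K \<in> ?Q"
    then show "Kr E r K \<and> K \<subseteq> V"
    proof
      assume "K \<in> P - P'" then show ?thesis using P_Kr by blast
    next
      assume "K \<in> A ` I"
      then obtain i where i: "i \<in> I" "K = A i" by blast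
      have "\<Union>P' \<union> U \<subseteq> V" using assms(2) P_Kr U_sub by blast
      then show ?thesis using A[OF i(1)] sub[OF i(1)] i(2) by blast
    qed
  qed
  ultimately have "card ?Q \<le> card P" using P_max by blast
  moreover have "card ?Q = card (P - P') + card (A ` I)"
    using finP assms(1) disj by (intro card_Un_disjoint) auto
  moreover have "card (A ` I) = card I" using inj by (rule card_image)
  moreover have "card (P - P') = card P - card P'" "card P' \<le> card P"
    using assms(2) finP by (auto simp: card_Diff_subset finite_subset card_mono)
  ultimately show ?thesis by linarith
qed

lemma tile_edge: "K \<in> P \<Longrightarrow> x \<in> K \<Longrightarrow> y \<in> K \<Longrightarrow> x \<noteq> y \<Longrightarrow> E x y"
  using P_Kr unfolding Kr_def clique_def by blast

lemma not_two_heavy: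
  assumes "K \<in> P" "{x, y, z, w} \<subseteq> K" "x \<noteq> y" "z \<noteq> w" "{x, y} \<inter> {z, w} = {}"
    "heavy x y" "heavy z w"
  shows False
proof -
  \<comment> \<open>The margin r over \<open>\<tau>\<close> pays for the r - 2 vertices of
    \<open>U\<close> that the first new clique occupies.\<close>
  have hr: "\<tau> + r \<le> h" using tau r4 mult_right_mono[of 1 "real r" \<tau>] unfolding h_def
    by (simp add: algebra_simps)
  have KU: "K \<inter> U = {}" using assms(1) unfolding U_def by blast
  have "E x y" "E z w" using tile_edge assms by auto
  have "\<tau> < card (N x \<inter> N y \<inter> U)" using assms(6) hr r4 unfolding heavy_def by linarith
  then obtain Q1 where Q1: "Q1 \<subseteq> N x \<inter> N y \<inter> U" "card Q1 = r - 2" "finite Q1"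
      "Kr E r (insert x (insert y Q1))" by (rule edge_extend[OF \<open>E x y\<close>])
  have "real (card (N z \<inter> N w \<inter> U)) - real (card Q1) \<le> card (N z \<inter> N w \<inter> (U - Q1))"
    by (rule card_Int_Diff_ge[OF Q1(3)])
  then have "\<tau> < card (N z \<inter> N w \<inter> (U - Q1))"
    using assms(7) hr r4 Q1(2) unfolding heavy_def by linarith
  then obtain Q2 where Q2: "Q2 \<subseteq> N z \<inter> N w \<inter> (U - Q1)" "card Q2 = r - 2" "finite Q2"
      "Kr E r (insert z (insert w Q2))" by (rule edge_extend[OF \<open>E z w\<close>])
  let ?A = "\<lambda>b. if b then insert x (insert y Q1) else insert z (insert w Q2)"
  have "card (UNIV :: bool set) \<le> card {K}"
  proof (rule swap[where A = ?A])
    show "?A i \<subseteq> \<Union>{K} \<union> U" for i using Q1(1) Q2(1) assms(2) by auto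
    show "?A i \<inter> ?A j = {}" if "i \<noteq> j" for i j
    proof -
      have "insert x (insert y Q1) \<inter> insert z (insert w Q2) = {}"
        using Q1(1) Q2(1) assms(2,5) KU by blast
      then show ?thesis using that by (cases i; cases j) (auto simp: Int_commute)
    qed
  qed (use assms(1) Q1(4) Q2(4) in auto)
  then show False by simp
qed

text \<open>Converting many such tiles frees many vertices \<open>z\<close>; an edge between two of them has linearly
  many common neighbours in \<open>U\<close>, which yields one extra tile.\<close>

definition Bad where
  "Bad = {K \<in> P. \<exists>x y z. {x, y, z} \<subseteq> K \<and> x \<noteq> y \<and> z \<noteq> x \<and> z \<noteq> y \<and> heavy x y \<and> card U / 2 + h \<le> dU z}"

lemma Bad_small: "card Bad \<le> \<tau>"
proof (rule ccontr)
  assume "\<not> card Bad \<le> \<tau>"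
  then have big: "\<tau> < card Bad" by simp
  \<comment> \<open>The least integer above \<open>\<tau>\<close>: enough freed vertices to force an
    edge among them, yet few enough that the cliques used up in \<open>U\<close> stay within the
    margin of \<open>h\<close>.\<close>
  define M where "M = nat \<lfloor>\<tau>\<rfloor> + 1"
  have M: "\<tau> < M" "M \<le> \<tau> + 1" using tau unfolding M_def by linarith+
  have "M \<le> card Bad" using big tau unfolding M_def by linarith
  then obtain F where F: "F \<subseteq> Bad" "card F = M" "finite F" by (rule subset_of_card)
  have FP: "F \<subseteq> P" using F(1) unfolding Bad_def by blast
  have "\<forall>K\<in>F. \<exists>x y z. {x, y, z} \<subseteq> K \<and> x \<noteq> y \<and> z \<noteq> x \<and> z \<noteq> y \<and> heavy x y \<and> card U / 2 + h \<le> dU z"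
    using F(1) unfolding Bad_def by blast
  then obtain x y z where xyz: "\<And>K. K \<in> F \<Longrightarrow> {x K, y K, z K} \<subseteq> K \<and> x K \<noteq> y K \<and> z K \<noteq> x K \<and> z K \<noteq> y K
      \<and> heavy (x K) (y K) \<and> card U / 2 + h \<le> dU (z K)"
    by metis
  have rr: "real (r - 2) = real r - 2" using r4 by simp
  have Mr: "real M * (r - 2) \<le> (\<tau> + 1) * (r - 2)" using M(2) r4 by (intro mult_right_mono) auto
  have hM: "\<tau> + real M * (r - 2) < h"
    using Mr tau r4 unfolding h_def rr by (simp add: algebra_simps)
  have "\<exists>Q. (\<forall>K\<in>F. (Q K \<subseteq> N (x K) \<inter> N (y K) \<inter> U \<and> Kr E r (insert (x K) (insert (y K) (Q K))))
       \<and> finite (Q K) \<and> card (Q K) \<le> r - 2 \<and> Q K \<inter> {} = {})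
       \<and> (\<forall>K\<in>F. \<forall>L\<in>F. K \<noteq> L \<longrightarrow> Q K \<inter> Q L = {})"
  proof (rule greedy_disjoint)
    fix K and W :: "'a set"
    assume K: "K \<in> F" and W: "finite W" "card W \<le> card ({} :: 'a set) + card F * (r - 2)"
    have "real (card W) \<le> real M * (r - 2)" using W(2) F(2) by (simp flip: of_nat_mult)
    then have "\<tau> < card (N (x K) \<inter> N (y K) \<inter> (U - W))"
      using card_Int_Diff_ge[OF W(1), of "N (x K) \<inter> N (y K)" U] hM xyz[OF K] unfolding heavy_def by linarith
    moreover have "E (x K) (y K)" using tile_edge xyz[OF K] K FP by auto
    ultimately obtain Q where "Q \<subseteq> N (x K) \<inter> N (y K) \<inter> (U - W)" "card Q = r - 2" "finite Q"
      "Kr E r (insert (x K) (insert (y K) Q))" by (metis edge_extend)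
    then show "\<exists>A. (A \<subseteq> N (x K) \<inter> N (y K) \<inter> U \<and> Kr E r (insert (x K) (insert (y K) A)))
        \<and> finite A \<and> card A \<le> r - 2 \<and> A \<inter> W = {}" by (intro exI[of _ Q] conjI) auto
  qed (use F in auto)
  then obtain Q where Q0: "\<forall>K\<in>F. (Q K \<subseteq> N (x K) \<inter> N (y K) \<inter> U \<and> Kr E r (insert (x K) (insert (y K) (Q K))))
       \<and> finite (Q K) \<and> card (Q K) \<le> r - 2 \<and> Q K \<inter> {} = {}"
     "\<forall>K\<in>F. \<forall>L\<in>F. K \<noteq> L \<longrightarrow> Q K \<inter> Q L = {}" by (elim exE conjE) (rule that)
  then have Q: "\<And>K. K \<in> F \<Longrightarrow> Q K \<subseteq> N (x K) \<inter> N (y K) \<inter> U"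
      "\<And>K. K \<in> F \<Longrightarrow> Kr E r (insert (x K) (insert (y K) (Q K)))"
      "\<And>K. K \<in> F \<Longrightarrow> finite (Q K)" "\<And>K. K \<in> F \<Longrightarrow> card (Q K) \<le> r - 2"
      "\<And>K L. K \<in> F \<Longrightarrow> L \<in> F \<Longrightarrow> K \<noteq> L \<Longrightarrow> Q K \<inter> Q L = {}" by auto
  have inj: "inj_on z F"
  proof (rule inj_onI)
    fix K L assume KL: "K \<in> F" "L \<in> F" "z K = z L"
    then have "z K \<in> K \<inter> L" using xyz[of K] xyz[of L] by auto
    then show "K = L" using P_inter[of K L] KL FP by blast
  qed
  have "z ` F \<subseteq> V" using xyz FP P_Kr by blast
  moreover have "\<tau> < card (z ` F)" using card_image[OF inj] F(2) M by simp
  ultimately obtain a b where ab: "a \<in> z ` F" "b \<in> z ` F" "E a b" "a \<noteq> b" by (rule get_edge)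
  then obtain K1 K2 where K12: "K1 \<in> F" "K2 \<in> F" "a = z K1" "b = z K2" by blast
  define W where "W = (\<Union>K\<in>F. Q K)"
  have finW: "finite W" unfolding W_def using F(3) Q(3) by blast
  have "card W \<le> (\<Sum>K\<in>F. card (Q K))" unfolding W_def using F(3) by (rule card_UN_le)
  also have "\<dots> \<le> card F * (r - 2)" using Q(4) sum_bounded_above[of F "\<lambda>K. card (Q K)" "r - 2"] by simp
  finally have "real (card W) \<le> real M * (r - 2)" using F(2) by (simp flip: of_nat_mult)
  \<comment> \<open>Each of \<open>a\<close> and \<open>b\<close> sees half of \<open>U\<close> plus
    \<open>h\<close>, so the halves must overlap in \<open>2 * h\<close> vertices, more than
    \<open>W\<close> can block.\<close>
  moreover have "2 * h \<le> card (N a \<inter> N b \<inter> U)"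
    using inter_card_ge[OF finU, of "N a \<inter> U" "N b \<inter> U"] xyz[OF K12(1)] xyz[OF K12(2)] K12(3,4)
    unfolding dU_def by (simp add: Int_ac)
  ultimately have "\<tau> < card (N a \<inter> N b \<inter> (U - W))"
    using card_Int_Diff_ge[OF finW, of "N a \<inter> N b" U] hM h_pos by linarith
  then obtain Q0 where Q0: "Q0 \<subseteq> N a \<inter> N b \<inter> (U - W)" "card Q0 = r - 2" "finite Q0"
      "Kr E r (insert a (insert b Q0))" by (rule edge_extend[OF ab(3)])
  \<comment> \<open>The index \<open>None\<close> carries the extra clique through the freed edge
    \<open>a\<close>, \<open>b\<close>; it is what makes the new tiles one more than the tiles of
    \<open>F\<close>.\<close>
  define A where "A i = (case i of None \<Rightarrow> insert a (insert b Q0)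
      | Some K \<Rightarrow> insert (x K) (insert (y K) (Q K)))" for i
  have FU: "K \<inter> U = {}" if "K \<in> F" for K using that FP unfolding U_def by blast
  have FF: "K \<inter> L = {}" if "K \<in> F" "L \<in> F" "K \<noteq> L" for K L using P_inter that FP by blast
  have xin: "x K \<in> K" "y K \<in> K" "z K \<in> K" "z K \<noteq> x K" "z K \<noteq> y K" if "K \<in> F" for K
    using xyz[OF that] by auto
  have d1: "A None \<inter> A (Some K) = {}" if K: "K \<in> F" for K
  proof -
    have z: "z L \<notin> insert (x K) (insert (y K) (Q K))" if L: "L \<in> F" for L
    proof -
      have "z L \<notin> Q K" using xin(3)[OF L] FU[OF L] Q(1)[OF K] by blast
      moreover have "z L \<noteq> x K" "z L \<noteq> y K"
        using xin[OF L] xin[OF K] FF[OF L K] by (metis disjoint_iff)+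
      ultimately show ?thesis by simp
    qed
    have "Q0 \<inter> Q K = {}" using Q0(1) K unfolding W_def by blast
    moreover have "x K \<notin> Q0" "y K \<notin> Q0" using Q0(1) xin[OF K] FU[OF K] by blast+
    ultimately show ?thesis using z[OF K12(1)] z[OF K12(2)] K12(3,4) unfolding A_def by auto
  qed
  have d2: "A (Some K) \<inter> A (Some L) = {}" if K: "K \<in> F" and L: "L \<in> F" and KL: "K \<noteq> L" for K L
  proof -
    have "Q K \<subseteq> U" "Q L \<subseteq> U" using Q(1) K L by blast+
    then have "Q K \<inter> L = {}" "Q L \<inter> K = {}" using FU[OF K] FU[OF L] by blast+
    moreover have "{x K, y K} \<subseteq> K" "{x L, y L} \<subseteq> L" using xin[OF K] xin[OF L] by auto
    ultimately have "({x K, y K} \<union> Q K) \<inter> ({x L, y L} \<union> Q L) = {}"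
      using FF[OF K L KL] Q(5)[OF K L KL] by blast
    then show ?thesis unfolding A_def by auto
  qed
  have "card (insert None (Some ` F)) \<le> card F"
  proof (rule swap[where A = A])
    fix i assume i: "i \<in> insert None (Some ` F)"
    show "Kr E r (A i)" using i Q(2) Q0(4) unfolding A_def by auto
    have "z L \<in> \<Union>F" if "L \<in> F" for L using xin(3)[OF that] that by blast
    then have "A None \<subseteq> \<Union>F \<union> U" using Q0(1) K12 unfolding A_def by auto
    moreover have "A (Some K) \<subseteq> \<Union>F \<union> U" if "K \<in> F" for K
      using xin[OF that] Q(1)[OF that] that unfolding A_def by auto
    ultimately show "A i \<subseteq> \<Union>F \<union> U" using i by blast
    fix j assume j: "j \<in> insert None (Some ` F)" "i \<noteq> j"
    have d1': "A (Some K) \<inter> A None = {}" if "K \<in> F" for K using d1[OF that] by blast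
    consider K where "i = None" "K \<in> F" "j = Some K" | K where "j = None" "K \<in> F" "i = Some K"
      | K L where "i = Some K" "j = Some L" "K \<in> F" "L \<in> F" "K \<noteq> L"
      using i j by blast
    then show "A i \<inter> A j = {}"
    proof cases
      case 1 then show ?thesis using d1 by metis
    next
      case 2 then show ?thesis using d1' by metis
    next
      case 3 then show ?thesis using d2 by metis
    qed
  qed (use F FP in auto)
  moreover have "card (insert None (Some ` F)) = card F + 1"
    using F(3) by (subst card_insert_disjoint) (auto simp: card_image)
  ultimately show False by simp
qed

lemma dU_le: "dU x \<le> card U"
  unfolding dU_def using finU by (intro card_mono) auto

lemma sum_dU_nonheavy:
  assumes "S \<subseteq> K" "K \<in> P" "\<And>x y. x \<in> S \<Longrightarrow> y \<in> S \<Longrightarrow> x \<noteq> y \<Longrightarrow> \<not> heavy x y"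
  shows "(\<Sum>x\<in>S. real (dU x)) \<le> card U + (real (card S))\<^sup>2 * h"
proof -
  have "finite S" using assms(1,2) P_Kr unfolding Kr_def by (meson finite_subset)
  then have "(\<Sum>x\<in>S. real (card (N x \<inter> U))) \<le> card (\<Union>x\<in>S. N x \<inter> U) + (real (card S))\<^sup>2 * h"
  proof (rule sum_card_le_Union)
    fix x y assume "x \<in> S" "y \<in> S" "x \<noteq> y"
    then have "\<not> heavy x y" using assms(3) by blast
    moreover have "(N x \<inter> U) \<inter> (N y \<inter> U) = N x \<inter> N y \<inter> U" by blast
    ultimately show "card ((N x \<inter> U) \<inter> (N y \<inter> U)) \<le> h" unfolding heavy_def by simp
  qed (use finU h_pos in auto)
  moreover have "card (\<Union>x\<in>S. N x \<inter> U) \<le> card U" using finU by (intro card_mono) auto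
  ultimately show ?thesis unfolding dU_def by linarith
qed

text \<open>By \<open>not_two_heavy\<close> the heavy pairs of a tile are pairwise intersecting, so
  they form a star (possibly empty) or a triangle. Without the centre of a star no heavy pair is
  left: the rest contributes about \<open>card U\<close>, the centre at most \<open>card U\<close>.
  In a triangle each vertex is opposite to a heavy pair, so a tile outside \<open>Bad\<close> gives
  it at most about half of \<open>U\<close>; two triangle vertices contribute about
  \<open>card U\<close> together and the remaining vertices are pairwise light.\<close>

lemma sum_dU_tile:
  assumes K: "K \<in> P" "K \<notin> Bad"
  shows "(\<Sum>x\<in>K. real (dU x)) \<le> 2 * card U + (real r)\<^sup>2 * h"
proof -
  have fK: "finite K" "card K = r" using P_Kr K(1) unfolding Kr_def by auto
  show ?thesis
  proof (cases "\<exists>x\<in>K. \<forall>p\<in>K - {x}. \<forall>q\<in>K - {x}. p \<noteq> q \<longrightarrow> \<not> heavy p q")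
    case True
    then obtain x where x: "x \<in> K" "\<forall>p\<in>K - {x}. \<forall>q\<in>K - {x}. p \<noteq> q \<longrightarrow> \<not> heavy p q" by blast
    have "(\<Sum>y\<in>K - {x}. real (dU y)) \<le> card U + (real (card (K - {x})))\<^sup>2 * h"
      using x(2) K(1) by (intro sum_dU_nonheavy[of _ K]) auto
    moreover have "(real (card (K - {x})))\<^sup>2 * h \<le> (real r)\<^sup>2 * h"
      using fK h_pos x(1) by (intro mult_right_mono power_mono) auto
    moreover have "(\<Sum>y\<in>K. real (dU y)) = dU x + (\<Sum>y\<in>K - {x}. real (dU y))"
      using fK x(1) by (simp add: sum.remove)
    ultimately show ?thesis using dU_le[of x] by linarith
  next
    case False
    have noth: False if "{p, q, s, t} \<subseteq> K" "p \<noteq> q" "s \<noteq> t" "{p, q} \<inter> {s, t} = {}" "heavy p q" "heavy s t" for p q s t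
      using not_two_heavy[OF K(1)] that by blast
    have ex: "\<exists>p\<in>K - {x}. \<exists>q\<in>K - {x}. p \<noteq> q \<and> heavy p q" if "x \<in> K" for x using False that by blast
    have "K \<noteq> {}" using fK r4 by auto
    then obtain x y where xy: "x \<in> K" "y \<in> K" "x \<noteq> y" "heavy x y" using ex by blast
    obtain z where z: "z \<in> K" "z \<noteq> x" "z \<noteq> y" "heavy y z"
    proof -
      obtain p q where pq: "p \<in> K - {x}" "q \<in> K - {x}" "p \<noteq> q" "heavy p q" using ex[OF xy(1)] by blast
      then have "y = p \<or> y = q" using noth[of x y p q] xy by auto
      then show thesis using that pq heavy_sym by blast
    qed
    obtain z' where z': "z' \<in> K" "z' \<noteq> x" "z' \<noteq> y" "heavy x z'"
    proof -
      obtain p q where pq: "p \<in> K - {y}" "q \<in> K - {y}" "p \<noteq> q" "heavy p q" using ex[OF xy(2)] by blast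
      then have "x = p \<or> x = q" using noth[of x y p q] xy by auto
      then show thesis using that pq heavy_sym by blast
    qed
    have "z' = z" using noth[of x z' y z] xy z z' by auto
    then have xz: "heavy x z" using z' by simp
    have light: "dU c < card U / 2 + h" if "{a, b, c} \<subseteq> K" "a \<noteq> b" "c \<noteq> a" "c \<noteq> b" "heavy a b" for a b c
      using K that unfolding Bad_def by (auto simp: not_le[symmetric])
    have "dU y < card U / 2 + h" using light[of x z y] xy z xz by auto
    moreover have "dU z < card U / 2 + h" using light[of x y z] xy z by auto
    \<comment> \<open>The third triangle vertex \<open>x\<close> stays in this sum: a heavy pair
      avoiding \<open>y\<close> and \<open>z\<close> would be disjoint from the heavy pair
      \<open>y\<close>, \<open>z\<close>.\<close>
    moreover have "(\<Sum>w\<in>K - {y, z}. real (dU w)) \<le> card U + (real (card (K - {y, z})))\<^sup>2 * h"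
    proof (rule sum_dU_nonheavy[of _ K])
      fix p q assume "p \<in> K - {y, z}" "q \<in> K - {y, z}" "p \<noteq> q"
      then show "\<not> heavy p q" using noth[of p q y z] xy z by auto
    qed (use K in auto)
    moreover have "(\<Sum>w\<in>K. real (dU w)) = dU y + dU z + (\<Sum>w\<in>K - {y, z}. real (dU w))"
      using fK(1) xy(2) z sum.subset_diff[of "{y, z}" K "\<lambda>w. real (dU w)"] by simp
    moreover have "(real (card (K - {y, z})))\<^sup>2 * h + 2 * h \<le> (real r)\<^sup>2 * h"
    proof -
      have "card (K - {y, z}) = r - 2" using fK xy(2) z by (simp add: card_Diff_subset)
      then have "(real (card (K - {y, z})))\<^sup>2 + 2 \<le> (real r)\<^sup>2"
        using r4 by (simp add: power2_eq_square algebra_simps of_nat_diff)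
      then show ?thesis using mult_right_mono[of _ _ h] h_pos by (fastforce simp: algebra_simps)
    qed
    ultimately show ?thesis by linarith
  qed
qed

text \<open>An edge between two vertices that see more than half of \<open>U\<close> would extend to
  a K_r inside \<open>U\<close>, that is, to an additional tile at no cost. Such vertices are
  therefore independent and number at most \<open>\<tau>\<close>.\<close>

lemma sum_dU_U: "(\<Sum>u\<in>U. real (dU u)) \<le> card U * (card U / 2 + h) + \<tau> * card U"
proof -
  define J where "J = {u\<in>U. card U / 2 + h < dU u}"
  have J: "J \<subseteq> U" "finite J" unfolding J_def using finU by auto
  have "card J \<le> \<tau>"
  proof (rule independent_small)
    show "J \<subseteq> V" using J U_sub by blast
    fix a b assume ab: "a \<in> J" "b \<in> J" "E a b"
    have "2 * h < card (N a \<inter> N b \<inter> U)"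
      using inter_card_ge[OF finU, of "N a \<inter> U" "N b \<inter> U"] ab unfolding J_def dU_def by (simp add: Int_ac)
    moreover have "(\<tau> + 1) * 1 \<le> h" unfolding h_def using tau r4 by (intro mult_left_mono) auto
    ultimately have "\<tau> < card (N a \<inter> N b \<inter> U)" using h_pos tau by (simp only: mult_1_right)
    then obtain Q where Q: "Q \<subseteq> N a \<inter> N b \<inter> U" "card Q = r - 2" "finite Q"
      "Kr E r (insert a (insert b Q))" by (rule edge_extend[OF ab(3)])
    have "card {()} \<le> card ({} :: 'a set set)"
      by (rule swap[where A = "\<lambda>_. insert a (insert b Q)"]) (use Q J ab in auto)
    then show False by simp
  qed
  have "(\<Sum>u\<in>U. real (dU u)) = (\<Sum>u\<in>U - J. real (dU u)) + (\<Sum>u\<in>J. real (dU u))"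
    using J finU by (simp add: sum.subset_diff)
  also have "(\<Sum>u\<in>J. real (dU u)) \<le> real (card J) * card U"
    using dU_le by (intro sum_bounded_above) auto
  also have "\<dots> \<le> \<tau> * card U" using \<open>card J \<le> \<tau>\<close> by (intro mult_right_mono) auto
  also have "(\<Sum>u\<in>U - J. real (dU u)) \<le> card (U - J) * (card U / 2 + h)"
    by (intro sum_bounded_above) (auto simp: J_def)
  also have "\<dots> \<le> card U * (card U / 2 + h)"
    using finU h_pos by (intro mult_right_mono) (auto intro!: card_mono)
  finally show ?thesis by simp
qed

text \<open>The edges at \<open>U\<close> are counted from both sides. The degrees give
  \<open>(1/2 + \<mu>) * n\<close> for each vertex of \<open>U\<close>; the tiles and
  \<open>U\<close> itself account for about \<open>n / 2\<close> each. The surplus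
  \<open>\<mu> * n\<close> must be covered by four error terms, together at most
  \<open>n * h * (r + 3)\<close>, which is the quantity in the hypothesis.\<close>

lemma leftover_small:
  fixes \<epsilon> :: real
  assumes eps: "0 < \<epsilon>" and big: "(\<tau> + 1) * r * (r + 3) \<le> \<mu> * \<epsilon> * card V"
  shows "card U \<le> \<epsilon> * card V"
proof (rule ccontr)
  let ?n = "real (card V)" and ?u = "real (card U)"
  assume a0: "\<not> ?thesis"
  then have lt: "\<epsilon> * ?n < ?u" by simp
  have UP: "V = U \<union> \<Union>P" "U \<inter> \<Union>P = {}" "finite (\<Union>P)"
    using P_Kr fin finP unfolding U_def Kr_def by auto
  have cP: "card (\<Union>P) = card P * r" using card_tiling[OF finP _ P_disj] P_Kr by blast
  then have nP: "?n = ?u + card P * r" using card_Un_disjoint[OF finU UP(3,2)] UP(1) by simp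
  have "(\<Sum>u\<in>U. card (N u)) = (\<Sum>u\<in>U. dU u) + (\<Sum>u\<in>U. card {x\<in>\<Union>P. E u x})"
  proof -
    have "card (N u) = dU u + card {x\<in>\<Union>P. E u x}" for u
    proof -
      let ?B = "{x\<in>\<Union>P. E u x}"
      have eq: "N u \<inter> U \<union> ?B = N u" using UP(1) unfolding nb_def by blast
      have "card (N u \<inter> U \<union> ?B) = card (N u \<inter> U) + card ?B"
      proof (rule card_Un_disjoint)
        show "finite ?B" by (rule finite_subset[OF _ UP(3)]) blast
        show "N u \<inter> U \<inter> ?B = {}" using UP(2) by blast
      qed (use finU in simp)
      then show ?thesis unfolding eq dU_def .
    qed
    then show ?thesis by (simp add: sum.distrib)
  qed
  also have "(\<Sum>u\<in>U. card {x\<in>\<Union>P. E u x}) = (\<Sum>x\<in>\<Union>P. card {u\<in>U. E u x})"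
    by (rule double_count) (use finU UP in auto)
  also have "\<dots> = (\<Sum>x\<in>\<Union>P. dU x)"
  proof (rule sum.cong)
    fix x
    have "{u\<in>U. E u x} = N x \<inter> U" using U_sub E_comm unfolding nb_def by blast
    then show "card {u\<in>U. E u x} = dU x" unfolding dU_def by simp
  qed simp
  also have "\<dots> = (\<Sum>K\<in>P. \<Sum>x\<in>K. dU x)"
  proof (rule sum.Union_disjoint[unfolded comp_def])
    show "\<forall>K\<in>P. finite K" using P_Kr unfolding Kr_def by blast
    show "\<forall>K\<in>P. \<forall>L\<in>P. K \<noteq> L \<longrightarrow> K \<inter> L = {}" using P_inter by blast
  qed
  finally have tot: "(\<Sum>u\<in>U. real (card (N u))) = (\<Sum>u\<in>U. real (dU u)) + (\<Sum>K\<in>P. \<Sum>x\<in>K. real (dU x))"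
    by (simp flip: of_nat_sum of_nat_add)
  have BP: "Bad \<subseteq> P" "finite Bad" using finP unfolding Bad_def by auto
  have "(\<Sum>K\<in>P. \<Sum>x\<in>K. real (dU x)) = (\<Sum>K\<in>P - Bad. \<Sum>x\<in>K. real (dU x)) + (\<Sum>K\<in>Bad. \<Sum>x\<in>K. real (dU x))"
    using BP finP by (simp add: sum.subset_diff)
  also have "(\<Sum>K\<in>Bad. \<Sum>x\<in>K. real (dU x)) \<le> card Bad * (r * ?u)"
  proof (rule sum_bounded_above)
    fix K assume "K \<in> Bad"
    then have "card K = r" using BP P_Kr unfolding Kr_def by blast
    then show "(\<Sum>x\<in>K. real (dU x)) \<le> r * ?u"
      using sum_bounded_above[of K "\<lambda>x. real (dU x)" ?u] dU_le by simp
  qed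
  also have "\<dots> \<le> \<tau> * (r * ?u)" using Bad_small by (intro mult_right_mono) auto
  also have "(\<Sum>K\<in>P - Bad. \<Sum>x\<in>K. real (dU x)) \<le> card (P - Bad) * (2 * ?u + (real r)\<^sup>2 * h)"
    using sum_dU_tile by (intro sum_bounded_above) auto
  also have "\<dots> \<le> card P * (2 * ?u + (real r)\<^sup>2 * h)"
    using finP h_pos by (intro mult_right_mono) (auto intro!: card_mono)
  finally have tP: "(\<Sum>K\<in>P. \<Sum>x\<in>K. real (dU x)) \<le> card P * (2 * ?u + (real r)\<^sup>2 * h) + \<tau> * (r * ?u)" by simp
  have "?u * ((1/2 + \<mu>) * ?n) \<le> (\<Sum>u\<in>U. real (card (N u)))"
    using deg U_sub sum_bounded_below[of U "(1/2 + \<mu>) * ?n" "\<lambda>u. real (card (N u))"] by auto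
  then have main: "?u * ((1/2 + \<mu>) * ?n) \<le> ?u * (?u / 2 + h) + \<tau> * ?u
      + card P * (2 * ?u + (real r)\<^sup>2 * h) + \<tau> * (r * ?u)"
    using tot tP sum_dU_U by linarith
  \<comment> \<open>The place where \<open>4 \<le> r\<close> is decisive: there are at most
    \<open>(n - card U) / 4\<close> tiles, so \<open>2 * card U\<close> edges per tile amount to at
    most half of all pairs between \<open>U\<close> and the tiles.\<close>
  have "real (card P) * 4 \<le> real (card P) * r" using r4 by (intro mult_left_mono) auto
  then have "card P * (2 * ?u) \<le> (?n - ?u) / 2 * ?u"
    using nP mult_right_mono[of "card P * 2" "(?n - ?u) / 2" ?u] by (simp add: algebra_simps)
  moreover have "card P * ((real r)\<^sup>2 * h) \<le> ?n * r * h"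
  proof -
    have "card P * ((real r)\<^sup>2 * h) = (card P * r) * (r * h)" by (simp add: power2_eq_square)
    also have "\<dots> \<le> ?n * (r * h)" using nP h_pos by (intro mult_right_mono) auto
    finally show ?thesis by simp
  qed
  moreover have t1: "(\<tau> + 1) * 1 \<le> h" unfolding h_def using tau r4 by (intro mult_left_mono) auto
  ultimately have "\<mu> * ?n * ?u \<le> ?u * h + \<tau> * ?u + ?n * r * h + \<tau> * r * ?u"
    using main by (simp add: algebra_simps)
  also have "?u * h \<le> ?n * h" using nP h_pos by (intro mult_right_mono) auto
  also have "\<tau> * ?u \<le> h * ?n"
    using nP tau t1 by (intro mult_mono) auto
  also have "\<tau> * r * ?u \<le> h * ?n"
    using nP tau unfolding h_def by (intro mult_mono) auto
  finally have "\<mu> * ?n * ?u \<le> ?n * (h * (r + 3))" by (simp add: algebra_simps)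
  moreover have "0 < ?u"
    using lt eps by (meson le_less_trans mult_nonneg_nonneg of_nat_0_le_iff less_imp_le)
  moreover have "?u \<le> ?n" using nP by simp
  ultimately have "\<mu> * ?u \<le> h * (r + 3)"
    using mult_le_cancel_left_pos[of ?n "\<mu> * ?u" "h * (r + 3)"] by (simp add: algebra_simps)
  also have "\<dots> \<le> \<mu> * \<epsilon> * ?n" using big unfolding h_def by simp
  finally have "\<mu> * ?u \<le> \<mu> * (\<epsilon> * ?n)" by (simp add: mult.assoc)
  then show False using lt mu by simp
qed

end

lemma (in dense_graph) almost_tiling:
  fixes \<epsilon> :: real
  assumes "0 < \<epsilon>" "(\<tau> + 1) * r * (r + 3) \<le> \<mu> * \<epsilon> * card V"
  obtains T where "T \<subseteq> V" "tileable E r T" "card (V - T) \<le> \<epsilon> * card V"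
proof -
  let ?til = "\<lambda>P. (\<forall>K\<in>P. Kr E r K \<and> K \<subseteq> V) \<and> pairwise disjnt P"
  have bd: "card P \<le> card (Pow V)" if "?til P" for P
    using that fin by (intro card_mono) auto
  then have bd: "\<forall>P. ?til P \<longrightarrow> card P < Suc (card (Pow V))" by (metis le_imp_less_Suc)
  have "\<exists>P. ?til P \<and> (\<forall>P'. ?til P' \<longrightarrow> card P' \<le> card P)"
    by (rule ex_has_greatest_nat[of ?til "{}" card "Suc (card (Pow V))", OF _ bd]) simp
  then obtain P where P: "?til P" "\<And>P'. ?til P' \<Longrightarrow> card P' \<le> card P" by blast
  interpret max_tiling V E r \<mu> \<tau> P
    by unfold_locales (use P in auto)
  have "tileable E r (\<Union>P)" unfolding tileable_def using P(1) by blast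
  moreover have "\<Union>P \<subseteq> V" using P(1) by blast
  ultimately show thesis using that leftover_small[OF assms] unfolding U_def by blast
qed

section \<open>A resilient bipartite template\<close>

text \<open>Hall's theorem by the induction of Halmos and Vaughan: if a nonempty proper
  \<open>J\<close> is tight, it is matched on its own and the rest is matched outside its
  neighbourhood \<open>B\<close>; otherwise every nonempty proper subset has a surplus of one, so
  some \<open>i\<close> may take an arbitrary \<open>x\<close>.\<close>

lemma hall:
  assumes "finite I" "\<And>i. i \<in> I \<Longrightarrow> finite (A i)" "\<And>J. J \<subseteq> I \<Longrightarrow> card J \<le> card (\<Union>i\<in>J. A i)"
  shows "\<exists>f. inj_on f I \<and> (\<forall>i\<in>I. f i \<in> A i)"
  using assms
proof (induction I arbitrary: A rule: finite_psubset_induct)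
  case (psubset I)
  have finU: "finite (\<Union>i\<in>J. A i)" if "J \<subseteq> I" for J
    using that psubset.hyps(1) psubset.prems(1) by (meson finite_UN_I finite_subset subsetD)
  show ?case
  proof (cases "\<exists>J. J \<subset> I \<and> J \<noteq> {} \<and> card J = card (\<Union>i\<in>J. A i)")
    case True
    then obtain J where J: "J \<subset> I" "J \<noteq> {}" "card J = card (\<Union>i\<in>J. A i)" by blast
    define B where "B = (\<Union>i\<in>J. A i)"
    have "\<exists>f. inj_on f J \<and> (\<forall>i\<in>J. f i \<in> A i)"
      by (rule psubset.IH[OF J(1)]) (use psubset.prems J(1) in auto)
    then obtain f where f: "inj_on f J" "\<And>i. i \<in> J \<Longrightarrow> f i \<in> A i" by blast
    have "\<exists>g. inj_on g (I - J) \<and> (\<forall>i\<in>I - J. g i \<in> A i - B)"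
    proof (rule psubset.IH)
      show "I - J \<subset> I" using J by blast
      show "finite (A i - B)" if "i \<in> I - J" for i using that psubset.prems(1) by auto
      fix K assume K: "K \<subseteq> I - J"
      have KJ: "K \<union> J \<subseteq> I" "K \<inter> J = {}" using K J(1) by auto
      have fin: "finite K" "finite J" using KJ(1) psubset.hyps(1) by (meson finite_subset le_sup_iff)+
      have "card K + card J = card (K \<union> J)" using card_Un_disjoint[OF fin KJ(2)] by simp
      also have "\<dots> \<le> card (\<Union>i\<in>K \<union> J. A i)" using psubset.prems(2)[OF KJ(1)] .
      also have "(\<Union>i\<in>K \<union> J. A i) = (\<Union>i\<in>K. A i - B) \<union> B" unfolding B_def by blast
      also have "card \<dots> \<le> card (\<Union>i\<in>K. A i - B) + card B" by (rule card_Un_le)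
      finally show "card K \<le> card (\<Union>i\<in>K. A i - B)" using J(3) unfolding B_def by simp
    qed
    then obtain g where g: "inj_on g (I - J)" "\<And>i. i \<in> I - J \<Longrightarrow> g i \<in> A i - B" by blast
    have fB: "f i \<in> B" if "i \<in> J" for i using f(2)[OF that] that unfolding B_def by blast
    let ?h = "\<lambda>i. if i \<in> J then f i else g i"
    have "inj_on ?h I"
    proof (rule inj_onI)
      fix x y assume xy: "x \<in> I" "y \<in> I" "?h x = ?h y"
      show "x = y"
      proof (cases "x \<in> J"; cases "y \<in> J")
        assume "x \<in> J" "y \<in> J" then show ?thesis using xy f(1) by (simp add: inj_on_def)
      next
        assume "x \<in> J" "y \<notin> J" then show ?thesis using xy fB[of x] g(2)[of y] by simp
      next
        assume "x \<notin> J" "y \<in> J" then show ?thesis using xy fB[of y] g(2)[of x] by simp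
      next
        assume "x \<notin> J" "y \<notin> J" then show ?thesis using xy g(1) by (simp add: inj_on_def)
      qed
    qed
    moreover have "\<forall>i\<in>I. ?h i \<in> A i" using f(2) g(2) by simp
    ultimately show ?thesis by (intro exI[of _ ?h]) blast
  next
    case False
    show ?thesis
    proof (cases "I = {}")
      case True then show ?thesis by simp
    next
      case Ine: False
      then obtain i where i: "i \<in> I" by blast
      have "card {i} \<le> card (A i)" using psubset.prems(2)[of "{i}"] i by simp
      then obtain x where x: "x \<in> A i" by fastforce
      have "\<exists>g. inj_on g (I - {i}) \<and> (\<forall>j\<in>I - {i}. g j \<in> A j - {x})"
      proof (rule psubset.IH)
        show "I - {i} \<subset> I" using i by blast
        show "finite (A j - {x})" if "j \<in> I - {i}" for j using that psubset.prems(1) by auto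
        fix K assume K: "K \<subseteq> I - {i}"
        show "card K \<le> card (\<Union>j\<in>K. A j - {x})"
        proof (cases "K = {}")
          case False
          have KI: "K \<subset> I" using K i by blast
          then have "card K \<noteq> card (\<Union>j\<in>K. A j)" using \<open>\<not> (\<exists>J. _ J)\<close> False by blast
          then have "card K < card (\<Union>j\<in>K. A j)" using psubset.prems(2)[of K] KI by fastforce
          moreover have "(\<Union>j\<in>K. A j - {x}) = (\<Union>j\<in>K. A j) - {x}" by blast
          moreover have "card (\<Union>j\<in>K. A j) - 1 \<le> card ((\<Union>j\<in>K. A j) - {x})"
            using diff_card_le_card_Diff[of "{x}" "\<Union>j\<in>K. A j"] by simp
          ultimately show ?thesis by simp
        qed simp
      qed
      then obtain g where g: "inj_on g (I - {i})" "\<And>j. j \<in> I - {i} \<Longrightarrow> g j \<in> A j - {x}" by blast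
      let ?h = "g(i := x)"
      have "inj_on ?h I"
      proof (rule inj_onI)
        fix a b assume ab: "a \<in> I" "b \<in> I" "?h a = ?h b"
        show "a = b"
        proof (cases "a = i"; cases "b = i")
          assume "a = i" "b \<noteq> i" then show ?thesis using ab g(2)[of b] by simp
        next
          assume "a \<noteq> i" "b = i" then show ?thesis using ab g(2)[of a] by simp
        next
          assume "a \<noteq> i" "b \<noteq> i" then show ?thesis using ab g(1) by (simp add: inj_on_def)
        qed simp
      qed
      moreover have "\<forall>j\<in>I. ?h j \<in> A j" using g(2) x by simp
      ultimately show ?thesis by (intro exI[of _ ?h]) blast
    qed
  qed
qed

section \<open>Bipartite expanders from a union bound\<close>

lemma power_self_le_fact: "real s ^ s \<le> 3 ^ s * fact s"
proof -
  \<comment> \<open>The left-hand side is a single term of the exponential series at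
    \<open>s\<close>.\<close>
  have "real s ^ s /\<^sub>R fact s \<le> exp (real s)"
    using sum_le_suminf[OF summable_exp_generic[of "real s"], of "{s}"]
    by (simp add: exp_def)
  then have "real s ^ s / fact s \<le> exp (real s)" by (simp add: divide_inverse mult.commute)
  also have "exp (real s) = exp 1 ^ s" by (simp add: exp_of_nat_mult flip: exp_of_nat_mult)
  also have "\<dots> \<le> 3 ^ s" using exp_le by (intro power_mono) auto
  finally show ?thesis by (simp add: divide_le_eq)
qed

text \<open>The familiar bound of the binomial coefficient by \<open>(3 * N / s) ^ s\<close>,
  cleared of the division so that s = 0 needs no care.\<close>

lemma binomial_mult_power_le: "real (N choose s) * real s ^ s \<le> (3 * real N) ^ s"
proof -
  have "real (N choose s) * real s ^ s \<le> real (N choose s) * (3 ^ s * fact s)"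
    by (intro mult_left_mono power_self_le_fact) auto
  also have "\<dots> = 3 ^ s * real ((N choose s) * fact s)" by simp
  also have "\<dots> \<le> 3 ^ s * real (N ^ s)"
    using binomial_fact_pow[of N s] by (intro mult_left_mono) (simp_all only: of_nat_le_iff, simp)
  finally show ?thesis by (simp add: power_mult_distrib)
qed

text \<open>One term of the union bound, multiplied by \<open>4 ^ s\<close>. Of the 14 factors
  \<open>s / b\<close> per element, two are consumed by the binomial coefficients; the other twelve
  are at most 2/3 each, and \<open>(2/3) ^ 12\<close> is below 1/72, where 72 = 4 * 6 * 3 collects
  the factor 4 and the constants of both binomial bounds.\<close>

lemma bad_term_le:
  assumes "1 \<le> s" "3 * s \<le> 2 * b"
  shows "4 ^ s * real ((2 * b choose s) * ((b choose s) * s ^ (14 * s))) \<le> real b ^ (14 * s)"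
proof -
  have e: "real s ^ (14 * s) = real s ^ s * real s ^ s * (real s ^ 12) ^ s"
  proof -
    have "s + s + 12 * s = 14 * s" by simp
    then show ?thesis by (metis power_add power_mult)
  qed
  have "3 * real s \<le> 2 * real b" using assms(2) by linarith
  then have "(3 * real s) ^ 12 \<le> (2 * real b) ^ 12" by (intro power_mono) auto
  then have "531441 * real s ^ 12 \<le> 4096 * real b ^ 12" by (simp add: power_mult_distrib)
  moreover have "0 \<le> real s ^ 12" by simp
  ultimately have "72 * real s ^ 12 \<le> real b ^ 12" by linarith
  then have s12: "(72 * real b ^ 2) * real s ^ 12 \<le> real b ^ 14"
  proof -
    have "real b ^ 2 * (72 * real s ^ 12) \<le> real b ^ 2 * real b ^ 12"
      using \<open>72 * real s ^ 12 \<le> real b ^ 12\<close> by (intro mult_left_mono) auto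
    then show ?thesis by (simp add: mult.assoc mult.left_commute flip: power_add)
  qed
  have "4 ^ s * real ((2 * b choose s) * ((b choose s) * s ^ (14 * s)))
      = 4 ^ s * ((real (2 * b choose s) * real s ^ s) * (real (b choose s) * real s ^ s) * (real s ^ 12) ^ s)"
    using e by simp
  also have "\<dots> \<le> 4 ^ s * ((3 * real (2 * b)) ^ s * (3 * real b) ^ s * (real s ^ 12) ^ s)"
    by (intro mult_left_mono mult_right_mono mult_mono binomial_mult_power_le) auto
  also have "\<dots> = (4 * ((3 * real (2 * b)) * (3 * real b) * real s ^ 12)) ^ s"
    by (simp only: power_mult_distrib)
  also have "4 * ((3 * real (2 * b)) * (3 * real b) * real s ^ 12) = (72 * real b ^ 2) * real s ^ 12"
    by (simp add: power2_eq_square)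
  also have "((72 * real b ^ 2) * real s ^ 12) ^ s \<le> (real b ^ 14) ^ s" using s12 by (intro power_mono) auto
  finally show ?thesis by (simp add: power_mult)
qed


text \<open>A random bipartite graph in which each of \<open>2 * b\<close> vertices picks 14 of
  \<open>b\<close> vertices, with repetition. \<open>F W B\<close> consists of the choices that send
  all of \<open>W\<close> into \<open>B\<close>; summed over \<open>card W = card B = s\<close>,
  these are at most a fraction \<open>(1/4) ^ s\<close> of all choices, and the geometric series
  stays below 1. Counting functions takes the place of a probability space.\<close>

lemma expanding_map:
  obtains f :: "nat \<times> nat \<Rightarrow> nat" where "\<And>i j. i < 2 * b \<Longrightarrow> j < 14 \<Longrightarrow> f (i, j) < b"
    "\<And>W. W \<subseteq> {..<2 * b} \<Longrightarrow> 3 * card W \<le> 2 * b \<Longrightarrow> card W \<le> card (f ` (W \<times> {..<14}))"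
proof -
  define X where "X = {..<2 * b} \<times> {..<14::nat}"
  define Om where "Om = X \<rightarrow>\<^sub>E {..<b}"
  define Sub where "Sub m s = {W. W \<subseteq> {..<m} \<and> card W = s}" for m s :: nat
  define F where "F W B = (\<Pi>\<^sub>E p\<in>X. if fst p \<in> W then B else {..<b})" for W B :: "nat set"
  have finX: "finite X" "card X = 2 * b * 14" unfolding X_def by (auto simp: card_cartesian_product)
  have cOm: "card Om = b ^ (28 * b)" unfolding Om_def using finX by (simp add: card_PiE)
  have cSub: "card (Sub m s) = (m choose s)" "finite (Sub m s)" for m s
    unfolding Sub_def using n_subsets[of "{..<m}" s] by auto
  have cF: "card (F W B) = s ^ (14 * s) * b ^ (28 * b - 14 * s)"
    if "W \<in> Sub (2 * b) s" "B \<in> Sub b s" for W B s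
  proof -
    have W: "W \<subseteq> {..<2 * b}" "card W = s" "card B = s" using that unfolding Sub_def by auto
    have p1: "W \<times> {..<14} \<subseteq> X" using W unfolding X_def by auto
    have p2: "{p \<in> X. fst p \<in> W} = W \<times> {..<14}" using W unfolding X_def by auto
    have "card (F W B) = (\<Prod>p\<in>X. card (if fst p \<in> W then B else {..<b}))"
      unfolding F_def using finX by (simp add: card_PiE)
    also have "\<dots> = (\<Prod>p\<in>X. if fst p \<in> W then s else b)"
      using W by (intro prod.cong) auto
    also have "\<dots> = s ^ card {p \<in> X. fst p \<in> W} * b ^ card {p \<in> X. fst p \<notin> W}"
      using finX by (simp add: prod.If_cases Int_def)
    also have "card {p \<in> X. fst p \<in> W} = 14 * s" unfolding p2 using W by (simp add: card_cartesian_product)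
    also have "{p \<in> X. fst p \<notin> W} = X - {p \<in> X. fst p \<in> W}" by blast
    also have "card \<dots> = 28 * b - 14 * s"
      unfolding p2 using finX p1 W by (simp add: card_Diff_subset finite_subset card_cartesian_product)
    finally show ?thesis .
  qed
  define S where "S = {s. 1 \<le> s \<and> 3 * s \<le> 2 * b}"
  have finS: "finite S" unfolding S_def by (rule finite_subset[of _ "{..2 * b}"]) auto
  define Bad where "Bad = (\<Union>s\<in>S. \<Union>W\<in>Sub (2 * b) s. \<Union>B\<in>Sub b s. F W B)"
  have "card Bad < card Om"
  proof (cases "S = {}")
    \<comment> \<open>Here b is 0 or 1, so no set is to be tested, and there is at least one choice
      function because \<open>0 ^ 0 = 1\<close>.\<close>
    case True
    then show ?thesis using cOm unfolding Bad_def by (cases b) simp_all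
  next
    case False
    then have b0: "0 < b" unfolding S_def by auto
    have "card Bad \<le> (\<Sum>s\<in>S. \<Sum>W\<in>Sub (2 * b) s. \<Sum>B\<in>Sub b s. card (F W B))"
      unfolding Bad_def
      by (intro order_trans[OF card_UN_le] sum_mono finS cSub(2)) (auto intro: order_trans[OF card_UN_le] sum_mono cSub)
    also have "\<dots> = (\<Sum>s\<in>S. (2 * b choose s) * ((b choose s) * (s ^ (14 * s) * b ^ (28 * b - 14 * s))))"
      by (intro sum.cong refl) (simp add: cF cSub)
    finally have "real (card Bad) \<le> (\<Sum>s\<in>S. real ((2 * b choose s) * ((b choose s) * (s ^ (14 * s) * b ^ (28 * b - 14 * s)))))"
      by (simp only: of_nat_le_iff flip: of_nat_sum)
    also have "\<dots> \<le> (\<Sum>s\<in>S. (1 / 4) ^ s * real b ^ (28 * b))"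
    proof (rule sum_mono)
      fix s assume s: "s \<in> S"
      have "4 ^ s * real ((2 * b choose s) * ((b choose s) * s ^ (14 * s))) * real b ^ (28 * b - 14 * s)
          \<le> real b ^ (14 * s) * real b ^ (28 * b - 14 * s)"
        using s bad_term_le[of s b] unfolding S_def by (intro mult_right_mono) auto
      also have "\<dots> = real b ^ (28 * b)" using s unfolding S_def by (simp flip: power_add)
      finally show "real ((2 * b choose s) * ((b choose s) * (s ^ (14 * s) * b ^ (28 * b - 14 * s))))
          \<le> (1 / 4) ^ s * real b ^ (28 * b)"
        by (simp add: power_divide field_simps)
    qed
    also have "\<dots> = (\<Sum>s\<in>S. (1 / 4) ^ s) * real b ^ (28 * b)" by (simp add: sum_distrib_right)
    also have "\<dots> < 1 * real b ^ (28 * b)"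
    proof (rule mult_strict_right_mono)
      have "(\<Sum>s\<in>S. (1 / 4 :: real) ^ s) \<le> (\<Sum>s\<in>{1..<2 * b + 1}. (1 / 4) ^ s)"
        by (rule sum_mono2) (auto simp: S_def)
      also have "\<dots> = (\<Sum>s<2 * b + 1. (1 / 4) ^ s) - 1"
        by (simp add: sum.atLeast_Suc_lessThan[symmetric] lessThan_atLeast0 sum.atLeast_Suc_lessThan)
      also have "\<dots> < 1" by (subst geometric_sum) (auto simp: field_simps intro!: add_pos_pos)
      finally show "(\<Sum>s\<in>S. (1 / 4 :: real) ^ s) < 1" .
    qed (use b0 in simp)
    finally have "real (card Bad) < real (card Om)" using cOm by simp
    then show ?thesis by simp
  qed
  then have "\<not> Om \<subseteq> Bad"
  proof (rule contrapos_pn)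
    assume "Om \<subseteq> Bad"
    moreover have "finite Bad" unfolding Bad_def F_def using finS cSub(2) finX
      by (intro finite_UN_I finite_PiE) (auto simp: Sub_def intro: finite_subset)
    ultimately show "\<not> card Bad < card Om" by (simp add: card_mono not_less)
  qed
  then obtain f where f: "f \<in> Om" "f \<notin> Bad" by blast
  show thesis
  proof (rule that[of f])
    show "f (i, j) < b" if "i < 2 * b" "j < 14" for i j
      using f(1) that unfolding Om_def X_def by (auto simp: PiE_iff)
    fix W assume W: "W \<subseteq> {..<2 * b}" "3 * card W \<le> 2 * b"
    show "card W \<le> card (f ` (W \<times> {..<14}))"
    proof (rule ccontr)
      let ?I = "f ` (W \<times> {..<14})"
      assume lt: "\<not> card W \<le> card ?I"
      have IB: "?I \<subseteq> {..<b}" using f(1) W(1) unfolding Om_def X_def by (auto simp: PiE_iff)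
      \<comment> \<open>A too small image is padded to exactly \<open>card W\<close> elements,
        because the union bound runs only over sets of equal size.\<close>
      obtain B where B: "?I \<subseteq> B" "B \<subseteq> {..<b}" "card B = card W"
        using exists_subset_between[of ?I "card W" "{..<b}"] lt IB W(2) by auto
      have "f \<in> F W B"
        unfolding F_def
      proof (rule PiE_I)
        fix p assume p: "p \<in> X"
        then obtain i j where ij: "p = (i, j)" "j < 14" unfolding X_def by auto
        show "f p \<in> (if fst p \<in> W then B else {..<b})"
          using f(1) B(1) p ij unfolding Om_def by (auto simp: PiE_iff)
      next
        fix p assume "p \<notin> X"
        then show "f p = undefined" using f(1) unfolding Om_def by (metis PiE_arb)
      qed
      moreover have "card W \<in> S" using lt W(2) unfolding S_def by auto
      ultimately have "f \<in> Bad" unfolding Bad_def Sub_def using W(1) B by blast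
      then show False using f(2) by simp
    qed
  qed
qed


text \<open>A robustly matchable bipartite graph: the first \<open>m + j\<close> left vertices are
  flexible, the last \<open>2 * m\<close> are always present. \<open>B1\<close> gives every right
  vertex 14 neighbours among the fixed ones, which settles Hall's condition for sets of at most
  \<open>m\<close> right vertices. \<open>B2\<close> gives every left vertex 14 right neighbours,
  which settles it for larger sets through their complement. With \<open>j \<le> m\<close> this
  makes at most 14 * 3m + 14 * 4m = 98m edges.\<close>

lemma template:
  assumes "j \<le> m"
  obtains Bt :: "(nat \<times> nat) set" where "Bt \<subseteq> {..<3 * m + j} \<times> {..<3 * m}" "card Bt \<le> 98 * m"
    "\<And>X. X \<subseteq> {..<m + j} \<Longrightarrow> card X = m \<Longrightarrow>
      \<exists>\<phi>. bij_betw \<phi> {..<3 * m} (X \<union> {m + j..<3 * m + j}) \<and> (\<forall>z<3 * m. (\<phi> z, z) \<in> Bt)"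
proof -
  obtain f :: "nat \<times> nat \<Rightarrow> nat" where f: "\<And>z k. z < 2 * (2 * m) \<Longrightarrow> k < 14 \<Longrightarrow> f (z, k) < 2 * m"
    "\<And>W. W \<subseteq> {..<2 * (2 * m)} \<Longrightarrow> 3 * card W \<le> 2 * (2 * m) \<Longrightarrow> card W \<le> card (f ` (W \<times> {..<14}))"
    by (rule expanding_map[of "2 * m"]) (rule that; blast)
  obtain g :: "nat \<times> nat \<Rightarrow> nat" where g: "\<And>p k. p < 2 * (3 * m) \<Longrightarrow> k < 14 \<Longrightarrow> g (p, k) < 3 * m"
    "\<And>W. W \<subseteq> {..<2 * (3 * m)} \<Longrightarrow> 3 * card W \<le> 2 * (3 * m) \<Longrightarrow> card W \<le> card (g ` (W \<times> {..<14}))"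
    by (rule expanding_map[of "3 * m"]) (rule that; blast)
  define B1 where "B1 = (\<lambda>(z, k). (m + j + f (z, k), z)) ` ({..<3 * m} \<times> {..<14::nat})"
  define B2 where "B2 = (\<lambda>(p, k). (p, g (p, k))) ` ({..<3 * m + j} \<times> {..<14::nat})"
  have c1: "card B1 \<le> 42 * m"
    unfolding B1_def by (rule order_trans[OF card_image_le]) (auto simp: card_cartesian_product)
  have c2: "card B2 \<le> 56 * m"
    unfolding B2_def by (rule order_trans[OF card_image_le]) (use assms in \<open>auto simp: card_cartesian_product\<close>)
  have s1: "B1 \<subseteq> {..<3 * m + j} \<times> {..<3 * m}"
  proof -
    have "m + j + f (z, k) < 3 * m + j" if "z < 3 * m" "k < 14" for z k using f(1)[of z k] that by simp
    then show ?thesis unfolding B1_def by auto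
  qed
  have s2: "B2 \<subseteq> {..<3 * m + j} \<times> {..<3 * m}"
  proof -
    have "g (p, k) < 3 * m" if "p < 3 * m + j" "k < 14" for p k using g(1)[of p k] that assms by simp
    then show ?thesis unfolding B2_def by auto
  qed
  show thesis
  proof (rule that[of "B1 \<union> B2"])
    show "B1 \<union> B2 \<subseteq> {..<3 * m + j} \<times> {..<3 * m}" using s1 s2 by blast
    show "card (B1 \<union> B2) \<le> 98 * m" using card_Un_le[of B1 B2] c1 c2 by linarith
    fix X assume X: "X \<subseteq> {..<m + j}" "card X = m"
    define Y where "Y = {m + j..<3 * m + j}"
    have fX: "finite X" using X(1) by (meson finite_lessThan finite_subset)
    have "card (X \<union> Y) = card X + card Y"
      using X(1) fX unfolding Y_def by (intro card_Un_disjoint) auto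
    then have L: "card (X \<union> Y) = 3 * m" "finite (X \<union> Y)" using X(2) fX unfolding Y_def by auto
    define A where "A z = {v \<in> X \<union> Y. (v, z) \<in> B1 \<union> B2}" for z
    have "\<exists>\<phi>. inj_on \<phi> {..<3 * m} \<and> (\<forall>z\<in>{..<3 * m}. \<phi> z \<in> A z)"
    proof (rule hall)
      show "finite (A z)" for z unfolding A_def using L(2) by simp
      fix J :: "nat set" assume J: "J \<subseteq> {..<3 * m}"
      have UA: "(\<Union>z\<in>J. A z) \<subseteq> X \<union> Y" unfolding A_def by blast
      have fUA: "finite (\<Union>z\<in>J. A z)" using UA L(2) by (rule finite_subset)
      show "card J \<le> card (\<Union>z\<in>J. A z)"
      proof (cases "card J \<le> m")
        case True
        have "J \<subseteq> {..<2 * (2 * m)}" using J by auto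
        then have "card J \<le> card (f ` (J \<times> {..<14}))" using f(2)[of J] True by simp
        also have "\<dots> = card ((+) (m + j) ` f ` (J \<times> {..<14}))" by (simp add: card_image)
        also have "\<dots> \<le> card (\<Union>z\<in>J. A z)"
        proof (rule card_mono[OF fUA])
          have "m + j + f (z, k) \<in> A z" if "z \<in> J" "k < 14" for z k
          proof -
            have z: "z < 3 * m" using that(1) J by auto
            then have "f (z, k) < 2 * m" using f(1)[of z k] that(2) by simp
            then have "m + j + f (z, k) \<in> Y" unfolding Y_def by simp
            moreover have "(m + j + f (z, k), z) \<in> B1" unfolding B1_def using z that(2) by force
            ultimately show ?thesis unfolding A_def by blast
          qed
          then show "(+) (m + j) ` f ` (J \<times> {..<14}) \<subseteq> (\<Union>z\<in>J. A z)" by auto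
        qed
        finally show ?thesis .
      next
        case False
        show ?thesis
        proof (rule ccontr)
          assume lt: "\<not> card J \<le> card (\<Union>z\<in>J. A z)"
          have cJ: "card J \<le> 3 * m" using card_mono[OF _ J] by simp
          have "card (X \<union> Y - (\<Union>z\<in>J. A z)) = 3 * m - card (\<Union>z\<in>J. A z)"
            using UA fUA L(1) by (simp add: card_Diff_subset)
          \<comment> \<open>A violating \<open>J\<close> leaves at least this many left vertices
            without a neighbour in \<open>J\<close>. Since \<open>card J > m\<close>, the number is
            at most \<open>2 * m\<close>, within the range where \<open>g\<close> expands; but all
            their \<open>g\<close>-images lie in the complement of \<open>J\<close>, which has one
            element too few.\<close>
          then have "3 * m - card J + 1 \<le> card (X \<union> Y - (\<Union>z\<in>J. A z))" using lt cJ by linarith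
          then obtain W where W: "W \<subseteq> X \<union> Y - (\<Union>z\<in>J. A z)" "card W = 3 * m - card J + 1"
            using obtain_subset_with_card_n by metis
          have "X \<union> Y \<subseteq> {..<3 * m + j}" using X(1) unfolding Y_def by force
          then have W3: "W \<subseteq> {..<3 * m + j}" using W(1) by blast
          then have "W \<subseteq> {..<2 * (3 * m)}" using assms by auto
          moreover have "3 * card W \<le> 2 * (3 * m)" using W(2) False cJ by arith
          ultimately have "card W \<le> card (g ` (W \<times> {..<14}))" by (rule g(2))
          also have "\<dots> \<le> card ({..<3 * m} - J)"
          proof (rule card_mono)
            have "g (p, k) \<in> {..<3 * m} - J" if "p \<in> W" "k < 14" for p k
            proof -
              have p: "p < 3 * m + j" using that(1) W3 by auto
              then have "(p, g (p, k)) \<in> B2" unfolding B2_def using that(2) by force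
              then have "p \<in> A (g (p, k))" unfolding A_def using that(1) W(1) by blast
              then have "g (p, k) \<notin> J" using that(1) W(1) by blast
              moreover have "g (p, k) < 3 * m" using g(1)[of p k] p assms that(2) by simp
              ultimately show ?thesis by simp
            qed
            then show "g ` (W \<times> {..<14}) \<subseteq> {..<3 * m} - J" by auto
          qed simp
          also have "\<dots> = 3 * m - card J" using J by (simp add: card_Diff_subset finite_subset)
          finally show False using W(2) by simp
        qed
      qed
    qed simp
    then obtain \<phi> where phi: "inj_on \<phi> {..<3 * m}" "\<And>z. z < 3 * m \<Longrightarrow> \<phi> z \<in> A z" by auto
    have "\<phi> ` {..<3 * m} = X \<union> Y"
    proof (rule card_subset_eq[OF L(2)])
      show "\<phi> ` {..<3 * m} \<subseteq> X \<union> Y" using phi(2) unfolding A_def by auto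
      show "card (\<phi> ` {..<3 * m}) = card (X \<union> Y)" using card_image[OF phi(1)] L(1) by simp
    qed
    then have "bij_betw \<phi> {..<3 * m} (X \<union> Y)" using phi(1) by (simp add: bij_betw_def)
    moreover have "\<forall>z<3 * m. (\<phi> z, z) \<in> B1 \<union> B2" using phi(2) unfolding A_def by blast
    ultimately show "\<exists>\<phi>. bij_betw \<phi> {..<3 * m} (X \<union> {m + j..<3 * m + j}) \<and> (\<forall>z<3 * m. (\<phi> z, z) \<in> B1 \<union> B2)"
      unfolding Y_def by blast
  qed
qed

section \<open>A reservoir that inherits all degrees\<close>

text \<open>Follows from \<open>exp (- x) \<le> 1 / (1 + x) \<le> 1 - x + x * x\<close>. It controls
  the loss in the exponential moment of the reservoir argument.\<close>

lemma one_minus_exp_ge: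
  fixes x :: real
  assumes "0 \<le> x" shows "x * (1 - x) \<le> 1 - exp (- x)"
proof -
  have "(1 - x + x * x) * (1 + x) = 1 + x * x * x" by (simp add: algebra_simps)
  then have "1 \<le> (1 - x + x * x) * (1 + x)" using assms by simp
  also have "\<dots> \<le> (1 - x + x * x) * exp x"
  proof (rule mult_left_mono[OF exp_ge_add_one_self])
    have "0 \<le> (x - 1) * (x - 1) + x" using assms by simp
    then show "0 \<le> 1 - x + x * x" by (simp add: algebra_simps)
  qed
  finally have "exp (- x) \<le> 1 - x + x * x" by (simp add: exp_minus field_simps)
  then show ?thesis by (simp add: algebra_simps)
qed

text \<open>A random transversal: the vertices are enumerated in blocks of length \<open>K\<close>,
  and one vertex is taken from each full block. This fixes the size of \<open>X\<close> and keeps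
  the choices independent, so the exponential moment factorises over the blocks. A Chernoff bound
  for each \<open>u\<close> and a union bound over all \<open>u\<close> follow, again by counting
  choice functions.\<close>

lemma reservoir:
  fixes V :: "'a set" and D :: "'a \<Rightarrow> 'a set" and \<mu> :: real and K :: nat
  assumes V: "finite V" and mu: "0 < \<mu>" "\<mu> \<le> 1 / 2" and K: "1 \<le> K"
    and D: "\<And>u. u \<in> V \<Longrightarrow> D u \<subseteq> V \<and> (1 / 2 + \<mu>) * card V \<le> card (D u)"
    and large: "40000 * (real K)\<^sup>2 < \<mu> ^ 4 * card V"
  obtains X where "X \<subseteq> V" "card X = card V div K"
    "\<And>u. u \<in> V \<Longrightarrow> (1 / 2 + \<mu> / 2) * card X \<le> card (D u \<inter> X)"
proof -
  define n where "n = card V"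
  define M where "M = n div K"
  have K0: "0 < real K" using K by simp
  have mu4: "\<mu> ^ 4 \<le> \<mu> / 8"
  proof -
    have "\<mu> ^ 3 \<le> (1 / 2) ^ 3" using mu by (intro power_mono) auto
    then have "\<mu> * \<mu> ^ 3 \<le> \<mu> * (1 / 2) ^ 3" using mu by (intro mult_left_mono) auto
    then show ?thesis by (simp add: power4_eq_xxxx power3_eq_cube power_divide mult.assoc)
  qed
  have big: "8 * real K \<le> \<mu> * n"
  proof -
    have "real K * 1 \<le> (real K)\<^sup>2" using K unfolding power2_eq_square by (intro mult_left_mono) auto
    moreover have "\<mu> ^ 4 * n \<le> \<mu> / 8 * n" using mu4 by (intro mult_right_mono) auto
    ultimately show ?thesis using large unfolding n_def by linarith
  qed
  have MK: "M * K \<le> n" "n < M * K + K" unfolding M_def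
    using K by (simp_all add: dividend_less_div_times add.commute)
  have M_ge: "n / (2 * K) \<le> M"
  proof -
    have "\<mu> * n \<le> 1 / 2 * n" using mu by (intro mult_right_mono) auto
    then have "2 * real K \<le> n" using big K0 by linarith
    moreover have "real n \<le> real M * K + K" using MK(2) by (metis less_imp_le of_nat_add of_nat_le_iff of_nat_mult)
    ultimately have "real n \<le> 2 * (real M * K)" by linarith
    then show ?thesis using K0 by (simp add: field_simps)
  qed
  obtain e where e: "bij_betw e {0..<n} V" using ex_bij_betw_nat_finite[OF V] unfolding n_def by blast
  define g where "g j i = e (j * K + i)" for j i
  have idx: "j * K + i < M * K" if "j < M" "i < K" for i j
  proof -
    have "Suc j * K \<le> M * K" using that(1) by (intro mult_le_mono1) simp
    then show ?thesis using that(2) by simp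
  qed
  have g_in: "g j i \<in> V" if "j < M" "i < K" for i j
    using idx[OF that] MK(1) e unfolding g_def bij_betw_def by auto
  have g_inj: "j = j' \<and> i = i'" if "j < M" "i < K" "j' < M" "i' < K" "g j i = g j' i'" for i j i' j'
  proof -
    have "j * K + i = j' * K + i'"
      using that idx[OF that(1,2)] idx[OF that(3,4)] MK(1) e unfolding g_def bij_betw_def inj_on_def by simp
    then have "(j * K + i) div K = (j' * K + i') div K" "(j * K + i) mod K = (j' * K + i') mod K" by simp_all
    then show ?thesis using that by simp
  qed
  define Om where "Om = {..<M} \<rightarrow>\<^sub>E {..<K}"
  define X where "X f = (\<lambda>j. g j (f j)) ` {..<M}" for f
  have f_lt: "f j < K" if "f \<in> Om" "j < M" for f j using that unfolding Om_def by (auto simp: PiE_iff)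
  have g_inj_f: "inj_on (\<lambda>j. g j (f j)) {..<M}" if "f \<in> Om" for f
  proof (rule inj_onI)
    fix x y assume "x \<in> {..<M}" "y \<in> {..<M}" "g x (f x) = g y (f y)"
    then show "x = y" using g_inj[of x "f x" y "f y"] f_lt[OF that] by simp
  qed
  define hit where "hit u f = {j\<in>{..<M}. g j (f j) \<in> D u}" for u f
  have hit: "card (D u \<inter> X f) = card (hit u f)" if "f \<in> Om" for u f
  proof -
    have "D u \<inter> X f = (\<lambda>j. g j (f j)) ` hit u f" unfolding X_def hit_def by auto
    moreover have "inj_on (\<lambda>j. g j (f j)) (hit u f)"
      using g_inj_f[OF that] by (rule inj_on_subset) (auto simp: hit_def)
    ultimately show ?thesis by (simp add: card_image)
  qed
  \<comment> \<open>The Chernoff parameter. The mean of the hits is at least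
    \<open>(1/2 + 3/4 * \<mu>) * M\<close> and the target is \<open>(1/2 + \<mu>/2) * M\<close>, a
    gap of order \<open>\<mu>\<close>, for which an \<open>l\<close> of order \<open>\<mu>\<close>
    is suitable.\<close>
  define l where "l = \<mu> / 8"
  define Bad where "Bad u = {f\<in>Om. card (hit u f) < (1 / 2 + \<mu> / 2) * M}" for u
  have finOm: "finite Om" "card Om = K ^ M" unfolding Om_def by (auto simp: card_PiE intro: finite_PiE)
  have Bad_le: "card (Bad u) \<le> real K ^ M * exp (- (\<mu>\<^sup>2 / 64 * M))" if u: "u \<in> V" for u
  proof -
    define d where "d j = card {i\<in>{..<K}. g j i \<in> D u}" for j
    \<comment> \<open>The incomplete last block can hide up to \<open>K\<close> elements of
      \<open>D u\<close>; \<open>big\<close> makes this at most \<open>\<mu> * n / 8\<close>, which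
      the drop from \<open>\<mu>\<close> to \<open>3/4 * \<mu>\<close> covers.\<close>
    have sum_d: "(1 / 2 + 3 / 4 * \<mu>) * (real M * K) \<le> (\<Sum>j<M. real (d j))"
    proof -
      define Z where "Z = (\<Union>j\<in>{..<M}. g j ` {i\<in>{..<K}. g j i \<in> D u})"
      have cZ: "card Z \<le> (\<Sum>j<M. d j)"
      proof -
        have "card Z \<le> (\<Sum>j<M. card (g j ` {i\<in>{..<K}. g j i \<in> D u}))"
          unfolding Z_def by (rule card_UN_le) simp
        also have "\<dots> \<le> (\<Sum>j<M. d j)" unfolding d_def by (intro sum_mono card_image_le) simp
        finally show ?thesis .
      qed
      have "D u \<subseteq> Z \<union> e ` {M * K..<n}"
      proof
        fix v assume v: "v \<in> D u"
        then have "v \<in> V" using D[OF u] by blast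
        then obtain t where t: "t < n" "v = e t" using e unfolding bij_betw_def by auto
        show "v \<in> Z \<union> e ` {M * K..<n}"
        proof (cases "t < M * K")
          case True
          have "t div K < M" using True by (simp add: less_mult_imp_div_less)
          moreover have "t mod K < K" using K by simp
          moreover have "v = g (t div K) (t mod K)" unfolding g_def t(2) by simp
          ultimately show ?thesis using v unfolding Z_def by blast
        qed (use t in auto)
      qed
      then have "card (D u) \<le> card (Z \<union> e ` {M * K..<n})"
        by (intro card_mono) (auto simp: Z_def)
      also have "\<dots> \<le> card Z + card (e ` {M * K..<n})" by (rule card_Un_le)
      also have "card (e ` {M * K..<n}) \<le> K" using card_image_le[of "{M * K..<n}" e] MK by simp
      finally have "card (D u) \<le> (\<Sum>j<M. d j) + K" using cZ by linarith
      then have "real (card (D u)) \<le> real ((\<Sum>j<M. d j) + K)" by (simp only: of_nat_le_iff)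
      then have "(1 / 2 + \<mu>) * n - K \<le> (\<Sum>j<M. real (d j))" using D[OF u] unfolding n_def by simp
      moreover have "(1 / 2 + 3 / 4 * \<mu>) * (real M * K) \<le> (1 / 2 + 3 / 4 * \<mu>) * n"
        using MK(1) mu by (intro mult_left_mono) (auto simp flip: of_nat_mult)
      ultimately show ?thesis using big K0 by (simp add: algebra_simps)
    qed
    define t where "t = exp (- l)"
    have t: "0 < t" "t \<le> 1" unfolding t_def l_def using mu by auto
    \<comment> \<open>Each choice is weighted with \<open>t\<close> to the number of hits. The sum
      over all choices is a product over blocks, in which block \<open>j\<close> contributes
      \<open>K - (1 - t) * d j\<close>.\<close>
    have "(\<Sum>f\<in>Om. \<Prod>j<M. if g j (f j) \<in> D u then t else 1)
        = (\<Prod>j<M. \<Sum>i<K. if g j i \<in> D u then t else 1)"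
      unfolding Om_def by (subst prod_sum_PiE) auto
    also have "\<dots> \<le> (\<Prod>j<M. real K * exp (- ((1 - t) * d j / K)))"
    proof (intro prod_mono conjI)
      fix j
      show "0 \<le> (\<Sum>i<K. if g j i \<in> D u then t else 1)" using t by (intro sum_nonneg) auto
      have "(\<Sum>i<K. if g j i \<in> D u then t else 1) = (\<Sum>i<K. 1 - (1 - t) * (if g j i \<in> D u then 1 else 0))"
        by (intro sum.cong) auto
      also have "\<dots> = K - (1 - t) * d j"
        unfolding d_def by (simp add: sum_subtractf sum.If_cases Int_def flip: sum_distrib_left)
      also have "\<dots> = K * (1 + - ((1 - t) * d j / K))" using K0 by (simp add: field_simps)
      also have "\<dots> \<le> K * exp (- ((1 - t) * d j / K))"
        by (intro mult_left_mono exp_ge_add_one_self) auto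
      finally show "(\<Sum>i<K. if g j i \<in> D u then t else 1) \<le> K * exp (- ((1 - t) * d j / K))" .
    qed
    also have "\<dots> = real K ^ M * exp (\<Sum>j<M. - ((1 - t) * d j / K))"
      by (simp add: prod.distrib exp_sum)
    also have "(\<Sum>j<M. - ((1 - t) * d j / K)) = - ((1 - t) / K * (\<Sum>j<M. real (d j)))"
      by (simp add: sum_negf sum_distrib_left)
    also have "real K ^ M * exp (- ((1 - t) / K * (\<Sum>j<M. real (d j))))
        \<le> real K ^ M * exp (- ((1 - t) / K * ((1 / 2 + 3 / 4 * \<mu>) * (real M * K))))"
    proof -
      have "(1 - t) / K * ((1 / 2 + 3 / 4 * \<mu>) * (real M * K)) \<le> (1 - t) / K * (\<Sum>j<M. real (d j))"
        using t K0 by (intro mult_left_mono[OF sum_d]) auto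
      then show ?thesis using K0 by (intro mult_left_mono, unfold exp_le_cancel_iff) auto
    qed
    also have "(1 - t) / K * ((1 / 2 + 3 / 4 * \<mu>) * (real M * K)) = (1 - t) * (1 / 2 + 3 / 4 * \<mu>) * M"
      using K0 by (simp add: field_simps)
    finally have up: "(\<Sum>f\<in>Om. \<Prod>j<M. if g j (f j) \<in> D u then t else 1)
        \<le> real K ^ M * exp (- ((1 - t) * (1 / 2 + 3 / 4 * \<mu>) * M))" .
    \<comment> \<open>Markov's inequality in counting form: a bad choice has few hits, hence a large
      weight.\<close>
    have "card (Bad u) * exp (- (l * ((1 / 2 + \<mu> / 2) * M))) \<le> (\<Sum>f\<in>Bad u. \<Prod>j<M. if g j (f j) \<in> D u then t else 1)"
    proof (rule sum_bounded_below)
      fix f assume f: "f \<in> Bad u"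
      have "(\<Prod>j<M. if g j (f j) \<in> D u then t else 1) = t ^ card (hit u f)"
        unfolding hit_def by (simp add: prod.If_cases Int_def)
      also have "\<dots> = exp (- (l * card (hit u f)))" unfolding t_def by (simp add: mult.commute flip: exp_of_nat_mult)
      finally show "exp (- (l * ((1 / 2 + \<mu> / 2) * M))) \<le> (\<Prod>j<M. if g j (f j) \<in> D u then t else 1)"
        using f mu unfolding Bad_def l_def by (auto intro!: mult_left_mono)
    qed
    also have "\<dots> \<le> (\<Sum>f\<in>Om. \<Prod>j<M. if g j (f j) \<in> D u then t else 1)"
      using finOm t by (intro sum_mono2) (auto simp: Bad_def intro!: prod_nonneg)
    finally have "card (Bad u) * exp (- (l * ((1 / 2 + \<mu> / 2) * M)))
        \<le> real K ^ M * exp (- ((1 - t) * (1 / 2 + 3 / 4 * \<mu>) * M))" using up by linarith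
    moreover have "x \<le> y * exp (a - b)" if "x * exp (- a) \<le> y * exp (- b)" for x y a b :: real
      using that by (simp add: exp_diff exp_minus field_simps)
    ultimately have "card (Bad u) \<le> real K ^ M * exp (l * ((1 / 2 + \<mu> / 2) * M) - (1 - t) * (1 / 2 + 3 / 4 * \<mu>) * M)"
      by blast
    also have "\<dots> \<le> real K ^ M * exp (- (\<mu>\<^sup>2 / 64 * M))"
    proof (intro mult_left_mono, unfold exp_le_cancel_iff)
      have "l * (1 - l) * (1 / 2 + 3 / 4 * \<mu>) \<le> (1 - t) * (1 / 2 + 3 / 4 * \<mu>)"
        using one_minus_exp_ge[of l] mu unfolding t_def l_def by (intro mult_right_mono) auto
      \<comment> \<open>With \<open>l = \<mu> / 8\<close> the linear terms cancel and the quadratic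
        ones leave a surplus of \<open>\<mu>\<^sup>2 / 128\<close>, which dominates the cubic term
        as soon as \<open>3 * \<mu> \<le> 2\<close>.\<close>
      moreover have "l * (1 / 2 + \<mu> / 2) + \<mu>\<^sup>2 / 64 \<le> l * (1 - l) * (1 / 2 + 3 / 4 * \<mu>)"
      proof -
        have "\<mu> * \<mu> * (3 * \<mu>) \<le> \<mu> * \<mu> * 2" using mu by (intro mult_left_mono) auto
        then show ?thesis unfolding l_def by (simp add: power2_eq_square algebra_simps) 
      qed
      ultimately have "l * (1 / 2 + \<mu> / 2) + \<mu>\<^sup>2 / 64 \<le> (1 - t) * (1 / 2 + 3 / 4 * \<mu>)" by linarith
      then have "(l * (1 / 2 + \<mu> / 2) + \<mu>\<^sup>2 / 64) * M \<le> (1 - t) * (1 / 2 + 3 / 4 * \<mu>) * M"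
        by (intro mult_right_mono) auto
      then show "l * ((1 / 2 + \<mu> / 2) * M) - (1 - t) * (1 / 2 + 3 / 4 * \<mu>) * M \<le> - (\<mu>\<^sup>2 / 64 * M)"
        by (simp add: algebra_simps)
    qed simp
    finally show ?thesis .
  qed
  have lt: "real n * exp (- (\<mu>\<^sup>2 / 64 * M)) < 1"
  proof -
    define x where "x = \<mu>\<^sup>2 / 64 * M"
    have x0: "0 \<le> x" unfolding x_def by simp
    have "\<mu>\<^sup>2 / 64 * (n / (2 * K)) \<le> x" unfolding x_def using M_ge by (intro mult_left_mono) auto
    then have "(\<mu>\<^sup>2 / 64 * (n / (2 * K)))\<^sup>2 \<le> x\<^sup>2" by (intro power_mono) auto
    \<comment> \<open>The quadratic term alone beats \<open>n\<close>: it needs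
      \<open>2 * 128\<^sup>2 = 32768\<close> in place of the 40000 granted by
      \<open>large\<close>.\<close>
    moreover have "1 + x + x\<^sup>2 / 2 \<le> exp x" using x0 by (rule exp_lower_Taylor_quadratic)
    moreover have "(\<mu>\<^sup>2 / 64 * (n / (2 * K)))\<^sup>2 = \<mu> ^ 4 * (real n)\<^sup>2 / (16384 * (real K)\<^sup>2)"
      using K0 by (simp add: power2_eq_square power4_eq_xxxx field_simps)
    moreover have "2 * real n \<le> \<mu> ^ 4 * (real n)\<^sup>2 / (16384 * (real K)\<^sup>2)"
    proof -
      have "2 * (16384 * (real K)\<^sup>2) \<le> \<mu> ^ 4 * n" using large unfolding n_def by (smt (verit) zero_le_power2)
      then have "2 * (16384 * (real K)\<^sup>2) * n \<le> \<mu> ^ 4 * n * n" by (intro mult_right_mono) auto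
      then show ?thesis using K0 by (simp add: field_simps power2_eq_square)
    qed
    ultimately have "real n < exp x" using x0 by linarith
    then show ?thesis unfolding x_def[symmetric] by (simp add: exp_minus field_simps)
  qed
  have "\<not> Om \<subseteq> (\<Union>u\<in>V. Bad u)"
  proof
    assume s: "Om \<subseteq> (\<Union>u\<in>V. Bad u)"
    have "card Om \<le> card (\<Union>u\<in>V. Bad u)"
      by (rule card_mono[OF _ s]) (use V finOm in \<open>auto simp: Bad_def\<close>)
    also have "\<dots> \<le> (\<Sum>u\<in>V. card (Bad u))" using V by (rule card_UN_le)
    finally have "real (card Om) \<le> (\<Sum>u\<in>V. real (card (Bad u)))" by (simp only: of_nat_le_iff flip: of_nat_sum)
    also have "\<dots> \<le> card V * (real K ^ M * exp (- (\<mu>\<^sup>2 / 64 * M)))"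
      using Bad_le by (intro sum_bounded_above) auto
    also have "\<dots> = real K ^ M * (real n * exp (- (\<mu>\<^sup>2 / 64 * M)))" unfolding n_def by simp
    also have "\<dots> < real K ^ M * 1" using lt K0 by (intro mult_strict_left_mono) auto
    finally show False using finOm(2) by simp
  qed
  then obtain f where f: "f \<in> Om" "\<And>u. u \<in> V \<Longrightarrow> f \<notin> Bad u" by blast
  have cX: "card (X f) = M" unfolding X_def using g_inj_f[OF f(1)] by (simp add: card_image)
  show thesis
  proof (rule that[of "X f"])
    show "X f \<subseteq> V" unfolding X_def using g_in f_lt[OF f(1)] by auto
    show "card (X f) = card V div K" using cX unfolding M_def n_def .
    fix u assume "u \<in> V"
    then have "\<not> card (hit u f) < (1 / 2 + \<mu> / 2) * M" using f unfolding Bad_def by blast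
    then show "(1 / 2 + \<mu> / 2) * card (X f) \<le> card (D u \<inter> X f)" using cX hit[OF f(1)] by simp
  qed
qed

section \<open>Partitions of the vertex set and types of cliques\<close>

locale classed_graph = dense_graph V E r \<mu> \<tau> for V :: "'a set" and E r \<mu> \<tau> +
  fixes cl :: "'a \<Rightarrow> 'b" and I :: "'b set" and \<delta> :: real
  assumes finI: "finite I" and I2: "2 \<le> card I" and cl_in: "v \<in> V \<Longrightarrow> cl v \<in> I"
    and delta: "0 < \<delta>"
    and class_big: "a \<in> I \<Longrightarrow> \<delta> * card V \<le> card {v\<in>V. cl v = a}"
    and tau_small: "\<tau> * (card I * (card I + 1)) < \<mu>\<^sup>2 * \<delta> * card V"
begin

abbreviation k where "k \<equiv> real (card I)"

definition C where "C a = {v\<in>V. cl v = a}"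

text \<open>\<open>T a b c\<close> provides a clique with one vertex in each of the classes \<open>a\<close>, \<open>b\<close> and \<open>r - 2\<close> further
  vertices in the class \<open>c\<close>.\<close>

definition T where
  "T a b c \<longleftrightarrow> (\<exists>u v. u \<in> C a \<and> v \<in> C b \<and> E u v \<and> \<tau> < card (N u \<inter> N v \<inter> C c))"

text \<open>The threshold for a common neighbourhood inside a class to count as dense. It is small
  enough for \<open>k\<close> classes below it to lose at most \<open>\<mu> * n\<close> in total,
  and large enough for \<open>2 * \<mu> * g\<close> to exceed \<open>\<tau> * k\<close>, as
  \<open>exchange_type\<close> demands.\<close>

definition g where "g = \<mu> * \<delta> * n / (2 * (k + 1))"

lemma C_sub: "C a \<subseteq> V" and finC: "finite (C a)"
  unfolding C_def using fin by auto

lemma n_pos: "0 < n"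
proof -
  have "0 \<le> \<tau> * (card I * (card I + 1))" using tau by simp
  then have "0 < \<mu>\<^sup>2 * \<delta> * n" using tau_small by linarith
  then show ?thesis by (cases "card V") auto
qed

lemma mu_half: "\<mu> \<le> 1/2"
  using mu_le n_pos by fastforce

lemma I_ne: "\<exists>a. a \<in> I"
  using I2 by (metis card.empty equals0I not_numeral_le_zero)

lemma delta_le: "\<delta> \<le> 1"
proof -
  obtain a where "a \<in> I" using I_ne by blast
  moreover have "card (C a) \<le> card V" using C_sub fin by (rule card_mono[rotated])
  ultimately have "\<delta> * n \<le> 1 * n" using class_big[of a] unfolding C_def by linarith
  then show ?thesis using n_pos by (simp add: mult_le_cancel_right)
qed

lemma k2: "2 \<le> k"
  using I2 by simp

lemma g_eq: "g * (k + 1) = \<mu> * \<delta> * n / 2"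
  unfolding g_def using k2 by (simp add: field_simps)

lemma g_tau: "\<tau> * k < 2 * \<mu> * g"
proof -
  have "(\<tau> * k) * (k + 1) < \<mu> * (\<mu> * \<delta> * n)"
    using tau_small by (simp add: power2_eq_square algebra_simps)
  also have "\<dots> = (2 * \<mu> * g) * (k + 1)" using g_eq by (simp add: algebra_simps)
  finally show ?thesis using k2 mult_less_cancel_right_pos[of "k + 1"] by simp
qed

lemma g_pos: "0 < g"
  unfolding g_def using mu delta n_pos k2 by simp

lemma tau_g: "\<tau> < g"
proof -
  have "\<tau> * 1 \<le> \<tau> * k" using k2 tau by (intro mult_left_mono) auto
  moreover have "(2 * \<mu>) * g \<le> 1 * g" using mu_half g_pos by (intro mult_right_mono) auto
  ultimately show ?thesis using g_tau by linarith
qed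

lemma kg_le: "k * g \<le> \<mu> * n"
proof -
  have "k * g \<le> \<mu> * \<delta> * n / 2" using g_eq g_pos by (simp add: algebra_simps)
  also have "\<dots> \<le> \<mu> * 1 * n / 2" using delta_le mu n_pos by (intro divide_right_mono mult_right_mono mult_left_mono) auto
  also have "\<dots> \<le> \<mu> * n" using mu n_pos by simp
  finally show ?thesis .
qed

lemma g6: "6 * g \<le> \<mu> * \<delta> * n"
proof -
  have "g * 3 \<le> g * (k + 1)" using g_pos k2 by (intro mult_left_mono) auto
  then show ?thesis using g_eq by linarith
qed

lemma class_ge: "a \<in> I \<Longrightarrow> \<delta> * n \<le> card (C a)"
  using class_big unfolding C_def .

lemma T_sym: "T a b c \<Longrightarrow> T b a c"
  unfolding T_def using E_comm by (metis Int_commute)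

lemma card_split:
  assumes "S \<subseteq> V" shows "card S = (\<Sum>d\<in>I. card (S \<inter> C d))"
proof -
  have "S = (\<Union>d\<in>I. S \<inter> C d)" using assms cl_in unfolding C_def by auto
  then have "card S = card (\<Union>d\<in>I. S \<inter> C d)" by simp
  also have "\<dots> = (\<Sum>d\<in>I. card (S \<inter> C d))"
    by (rule card_UN_disjoint) (use finI finC in \<open>auto simp: C_def\<close>)
  finally show ?thesis .
qed

text \<open>The edges between \<open>X\<close> and the neighbours of \<open>u\<close> are counted by
  the class of their second end; by pigeonhole some class \<open>d\<close> gets a
  \<open>1 / k\<close> share. The same count is averaged twice: over \<open>X\<close> it yields a
  vertex \<open>x\<close> of class \<open>c\<close> with many common neighbours with
  \<open>u\<close> in class \<open>d\<close>, and over the other side it yields a vertex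
  \<open>y\<close> of class \<open>d\<close> with many common neighbours with \<open>u\<close> in
  class \<open>c\<close>.\<close>

lemma exchange_type:
  assumes u: "u \<in> V" and X: "X \<subseteq> N u \<inter> C c" and big: "\<tau> * k < 2 * \<mu> * card X"
  shows "\<exists>d. T (cl u) c d \<and> T (cl u) d c"
proof -
  have XV: "X \<subseteq> V" "finite X" using X N_sub finN by (blast, meson finite_Int finite_subset)
  have uC: "u \<in> C (cl u)" using u unfolding C_def by simp
  define f where "f d = (\<Sum>x\<in>X. real (card (N u \<inter> N x \<inter> C d)))" for d
  have "0 \<le> \<tau> * k" using tau k2 by simp
  then have X0: "0 < real (card X)" using big mu by (cases "card X") auto
  have "card X * (2 * \<mu> * n) \<le> (\<Sum>x\<in>X. real (card (N u \<inter> N x)))"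
    using codeg[OF u] XV(1) by (intro sum_bounded_below) auto
  also have "\<dots> = (\<Sum>x\<in>X. \<Sum>d\<in>I. real (card (N u \<inter> N x \<inter> C d)))"
  proof (rule sum.cong)
    fix x
    have "N u \<inter> N x \<subseteq> V" using N_sub by blast
    then show "real (card (N u \<inter> N x)) = (\<Sum>d\<in>I. real (card (N u \<inter> N x \<inter> C d)))"
      using card_split by (metis of_nat_sum)
  qed simp
  also have "\<dots> = (\<Sum>d\<in>I. f d)" unfolding f_def by (rule sum.swap)
  finally have tot: "card X * (2 * \<mu> * n) \<le> (\<Sum>d\<in>I. f d)" .
  have "\<exists>d\<in>I. card X * (2 * \<mu> * n) \<le> k * f d"
  proof (rule ccontr)
    assume "\<not> ?thesis"
    then have "(\<Sum>d\<in>I. k * f d) < (\<Sum>d\<in>I. card X * (2 * \<mu> * n))"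
      using finI I_ne by (intro sum_strict_mono) auto
    then have "k * (\<Sum>d\<in>I. f d) < k * (card X * (2 * \<mu> * n))" by (simp add: sum_distrib_left)
    then show False using tot k2 by (simp add: mult_less_cancel_left_pos)
  qed
  then obtain d where d: "card X * (2 * \<mu> * n) \<le> k * f d" by blast
  have Xn: "card X \<le> n" using XV fin by (simp add: card_mono)
  have "\<exists>x\<in>X. \<tau> < card (N u \<inter> N x \<inter> C d)"
  proof (rule ccontr)
    assume "\<not> ?thesis"
    then have "f d \<le> card X * \<tau>" unfolding f_def by (intro sum_bounded_above) auto
    then have "k * f d \<le> k * (card X * \<tau>)" using k2 by (intro mult_left_mono) auto
    then have "card X * (2 * \<mu> * n) \<le> card X * (\<tau> * k)" using d by (simp add: algebra_simps)
    then have "2 * \<mu> * n \<le> \<tau> * k" using X0 by (simp only: mult_le_cancel_left_pos)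
    moreover have "2 * \<mu> * card X \<le> 2 * \<mu> * n" using Xn mu by (intro mult_left_mono) auto
    ultimately show False using big by linarith
  qed
  then obtain x where x: "x \<in> X" "\<tau> < card (N u \<inter> N x \<inter> C d)" by blast
  have "\<exists>y\<in>N u \<inter> C d. \<tau> < card {x\<in>X. E x y}"
  proof (rule ccontr)
    assume a: "\<not> ?thesis"
    have "f d = (\<Sum>x\<in>X. real (card {y\<in>N u \<inter> C d. E x y}))"
      unfolding f_def
    proof (rule sum.cong)
      fix x
      have "N u \<inter> N x \<inter> C d = {y\<in>N u \<inter> C d. E x y}" using C_sub[of d] unfolding nb_def by auto
      then show "real (card (N u \<inter> N x \<inter> C d)) = real (card {y\<in>N u \<inter> C d. E x y})" by simp
    qed simp
    also have "\<dots> = real (\<Sum>x\<in>X. card {y\<in>N u \<inter> C d. E x y})" by simp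
    also have "\<dots> = real (\<Sum>y\<in>N u \<inter> C d. card {x\<in>X. E x y})"
      using double_count[of X "N u \<inter> C d" E] XV finN by simp
    also have "\<dots> = (\<Sum>y\<in>N u \<inter> C d. real (card {x\<in>X. E x y}))" by simp
    also have "\<dots> \<le> card (N u \<inter> C d) * \<tau>"
    proof (rule sum_bounded_above)
      fix i assume "i \<in> N u \<inter> C d"
      then have "\<not> \<tau> < real (card {x\<in>X. E x i})" using a by blast
      then show "real (card {x\<in>X. E x i}) \<le> \<tau>" by simp
    qed
    also have "\<dots> \<le> n * \<tau>" 
    proof (rule mult_right_mono)
      have "N u \<inter> C d \<subseteq> V" using C_sub by blast
      then show "real (card (N u \<inter> C d)) \<le> n" using fin by (simp add: card_mono)
    qed (rule tau)
    finally have "k * f d \<le> k * (n * \<tau>)" using k2 by (intro mult_left_mono) auto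
    then have "n * (2 * \<mu> * card X) \<le> n * (\<tau> * k)" using d by (simp add: algebra_simps)
    then have "2 * \<mu> * card X \<le> \<tau> * k" using n_pos by (simp only: mult_le_cancel_left_pos)
    then show False using big by linarith
  qed
  then obtain y where y: "y \<in> N u \<inter> C d" "\<tau> < card {x\<in>X. E x y}" by blast
  have "{x\<in>X. E x y} \<subseteq> N u \<inter> N y \<inter> C c" using X XV(1) E_comm unfolding nb_def by auto
  then have "card {x\<in>X. E x y} \<le> card (N u \<inter> N y \<inter> C c)" using finN by (intro card_mono) auto
  then have ty: "\<tau> < card (N u \<inter> N y \<inter> C c)" using y(2) by linarith
  have "T (cl u) c d" unfolding T_def using uC x X in_N by blast
  moreover have "T (cl u) d c" unfolding T_def using uC y(1) ty in_N by blast
  ultimately show ?thesis by blast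
qed

end

text \<open>The assumption, to be refuted, that no two clique types differ by replacing one vertex
  of a class by one of another class: the types \<open>T a b c\<close> and \<open>T a b' c\<close>
  agree up to their second vertex.\<close>

locale rigid_graph = classed_graph +
  assumes rigid: "T a b c \<Longrightarrow> T a b' c \<Longrightarrow> b = b'"
begin

text \<open>A strengthening of \<open>T a a c\<close>: the threshold \<open>g\<close> instead of
  \<open>\<tau>\<close> leaves a common neighbourhood large enough for
  \<open>exchange_type\<close>.\<close>

definition D where
  "D a c \<longleftrightarrow> (\<exists>u u'. u \<in> C a \<and> u' \<in> C a \<and> E u u' \<and> g \<le> card (N u \<inter> N u' \<inter> C c))"

text \<open>The dense common neighbourhood lies in class \<open>c\<close>, so the exchange yields a
  class \<open>d\<close> with both \<open>T a c d\<close> and \<open>T a d c\<close>. Rigidity,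
  applied to \<open>T a a c\<close> and \<open>T a d c\<close>, identifies \<open>d\<close> with
  \<open>a\<close>.\<close>

lemma D_T:
  assumes "D a c" shows "T a a c" "T a c a"
proof -
  obtain u u' where u: "u \<in> C a" "u' \<in> C a" "E u u'" "g \<le> card (N u \<inter> N u' \<inter> C c)"
    using assms unfolding D_def by blast
  show aac: "T a a c" unfolding T_def using u tau_g by (meson less_le_trans)
  have "2 * \<mu> * g \<le> 2 * \<mu> * card (N u \<inter> N u' \<inter> C c)" using u(4) mu by (intro mult_left_mono) auto
  then have "\<exists>d. T (cl u) c d \<and> T (cl u) d c"
    using exchange_type[of u "N u \<inter> N u' \<inter> C c" c] u(1) C_sub g_tau by auto
  then obtain d where "T a c d" "T a d c" using u(1) unfolding C_def by blast
  then show "T a c a" using rigid[OF aac] by blast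
qed

text \<open>Both relations give types \<open>T a c a\<close> and \<open>T a c' a\<close>, which
  differ only in their second class.\<close>

lemma D_unique: "D a c \<Longrightarrow> D a c' \<Longrightarrow> c = c'"
  using D_T rigid by blast

lemma D_ex:
  assumes "a \<in> I" shows "\<exists>c\<in>I. D a c"
proof -
  have "\<delta> * n \<le> card (C a)" using class_ge assms .
  moreover have "\<mu> * (\<delta> * n) \<le> 1 * (\<delta> * n)" using mu_half delta n_pos by (intro mult_right_mono) auto
  ultimately have "\<tau> < card (C a)" using g6 tau_g g_pos by (simp add: mult.assoc)
  then obtain u u' where u: "u \<in> C a" "u' \<in> C a" "E u u'" by (rule get_edge[OF C_sub])
  have "N u \<inter> N u' \<subseteq> V" using N_sub by blast
  then have s: "real (card (N u \<inter> N u')) = (\<Sum>d\<in>I. real (card (N u \<inter> N u' \<inter> C d)))"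
    using card_split by (metis of_nat_sum)
  have "2 * \<mu> * n \<le> card (N u \<inter> N u')" using codeg u C_sub by blast
  have "\<exists>c\<in>I. g \<le> card (N u \<inter> N u' \<inter> C c)"
  proof (rule ccontr)
    assume "\<not> ?thesis"
    then have "(\<Sum>d\<in>I. real (card (N u \<inter> N u' \<inter> C d))) \<le> k * g"
      by (intro sum_bounded_above) auto
    moreover have "0 < \<mu> * n" using mu n_pos by simp
    ultimately show False using s kg_le \<open>2 * \<mu> * n \<le> card (N u \<inter> N u')\<close> by linarith
  qed
  then show ?thesis unfolding D_def using u by blast
qed

text \<open>By uniqueness of \<open>c\<close>, the two ends share at most \<open>g\<close>
  neighbours in any other class \<open>d\<close>, hence send at most \<open>card (C d) + g\<close>
  edges there. The degree sum exceeds \<open>n\<close> by \<open>2 * \<mu> * n\<close>, and this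
  surplus has to go to class \<open>c\<close>.\<close>

lemma edge_sum:
  assumes "D a c" "c \<in> I" "u \<in> C a" "u' \<in> C a" "E u u'"
  shows "card (C c) + 2 * \<mu> * n - k * g \<le> real (card (N u \<inter> C c)) + real (card (N u' \<inter> C c))"
proof -
  define f where "f d = real (card (N u \<inter> C d)) + real (card (N u' \<inter> C d))" for d
  have uV: "u \<in> V" "u' \<in> V" using assms C_sub by blast+
  have "(1 + 2 * \<mu>) * n \<le> real (card (N u)) + real (card (N u'))"
    using deg[OF uV(1)] deg[OF uV(2)] by (simp add: algebra_simps)
  also have "\<dots> = (\<Sum>d\<in>I. f d)"
    using card_split[OF N_sub, of u] card_split[OF N_sub, of u'] unfolding f_def by (simp add: sum.distrib)
  also have "\<dots> = f c + (\<Sum>d\<in>I - {c}. f d)" using assms(2) finI by (rule sum.remove[rotated])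
  also have "(\<Sum>d\<in>I - {c}. f d) \<le> (\<Sum>d\<in>I - {c}. card (C d) + g)"
  proof (rule sum_mono)
    fix d assume d: "d \<in> I - {c}"
    have "\<not> D a d" using D_unique[OF assms(1)] d by blast
    then have "card (N u \<inter> N u' \<inter> C d) \<le> g" unfolding D_def using assms(3-5) by force
    moreover have "N u \<inter> N u' \<inter> C d = (N u \<inter> C d) \<inter> (N u' \<inter> C d)" by blast
    ultimately show "f d \<le> card (C d) + g"
      using inter_card_ge[OF finC, of "N u \<inter> C d" d "N u' \<inter> C d"] unfolding f_def by simp
  qed
  also have "\<dots> = (\<Sum>d\<in>I - {c}. real (card (C d))) + (k - 1) * g"
    using assms(2) finI I2 by (simp add: sum.distrib of_nat_diff)
  also have "(\<Sum>d\<in>I - {c}. real (card (C d))) = n - card (C c)"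
  proof -
    have "n = (\<Sum>d\<in>I. real (card (C d)))"
      using card_split[of V] C_sub by (simp add: Int_absorb1)
    then show ?thesis using sum.remove[OF finI assms(2), of "\<lambda>d. real (card (C d))"] by simp
  qed
  finally show ?thesis using g_pos unfolding f_def by (simp add: algebra_simps)
qed

definition Good where
  "Good a c = {u\<in>C a. card (C c) + 2 * \<mu> * n - k * g \<le> 2 * card (N u \<inter> C c)}"

text \<open>On an edge inside \<open>C a\<close>, at least one end reaches the average required by
  \<open>edge_sum\<close>, so the vertices that are not good are independent.\<close>

lemma Good_big:
  assumes "D a c" "c \<in> I" shows "card (C a) - \<tau> \<le> card (Good a c)"
proof -
  have "card (C a - Good a c) \<le> \<tau>"
  proof (rule independent_small)
    fix x y assume "x \<in> C a - Good a c" "y \<in> C a - Good a c" "E x y"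
    then show False using edge_sum[OF assms, of x y] unfolding Good_def by auto
  qed (use C_sub in auto)
  moreover have "card (C a - Good a c) = card (C a) - card (Good a c)" "card (Good a c) \<le> card (C a)"
    unfolding Good_def using finC by (auto intro!: card_Diff_subset card_mono)
  ultimately show ?thesis by linarith
qed

text \<open>If \<open>c\<close> differed from \<open>a\<close>, rigidity would also exclude
  \<open>D c a\<close>: it gives \<open>T c c a\<close>, against \<open>T c a a\<close> from the
  first relation. Then almost every vertex of \<open>C a\<close> sends noticeably more than half of
  the possible edges to \<open>C c\<close>, while all but \<open>\<tau>\<close> vertices of
  \<open>C c\<close> send at most about half back. Counting the edges between the two classes from
  both sides is contradictory.\<close>

lemma D_self:
  assumes "D a c" "a \<in> I" "c \<in> I" shows "c = a"
proof (rule ccontr)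
  assume ca: "c \<noteq> a"
  obtain e where e: "e \<in> I" "D c e" using D_ex assms(3) by blast
  have "e \<noteq> a" using T_sym[OF D_T(2)[OF assms(1)]] D_T(1)[OF e(2)] rigid ca by blast
  then have nD: "\<not> D c a" using D_unique e(2) by blast
  define H where "H = {x\<in>C c. card (C a) + g \<le> 2 * card (N x \<inter> C a)}"
  have "card H \<le> \<tau>"
  proof (rule independent_small)
    show "H \<subseteq> V" unfolding H_def using C_sub by blast
    fix x y assume xy: "x \<in> H" "y \<in> H" "E x y"
    have "g \<le> card ((N x \<inter> C a) \<inter> (N y \<inter> C a))"
      using inter_card_ge[OF finC, of "N x \<inter> C a" a "N y \<inter> C a"] xy unfolding H_def by simp
    moreover have "(N x \<inter> C a) \<inter> (N y \<inter> C a) = N x \<inter> N y \<inter> C a" by blast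
    ultimately show False using nD xy unfolding D_def H_def by auto
  qed
  let ?A = "real (card (C a))" and ?C = "real (card (C c))"
  have HC: "H \<subseteq> C c" "finite H" unfolding H_def using finC by auto
  have An: "?A \<le> n" "?C \<le> n" using C_sub fin by (auto intro: card_mono)
  let ?M = "?C + 2 * \<mu> * n - k * g"
  have "0 < \<mu> * n" using mu n_pos by simp
  then have M0: "0 \<le> ?M" using kg_le by linarith
  have GA: "Good a c \<subseteq> C a" unfolding Good_def by blast
  have "(?A - \<tau>) * ?M \<le> card (Good a c) * ?M"
    using Good_big[OF assms(1,3)] M0 by (intro mult_right_mono) auto
  also have "\<dots> \<le> (\<Sum>u\<in>Good a c. 2 * real (card (N u \<inter> C c)))"
    by (intro sum_bounded_below) (auto simp: Good_def)
  also have "\<dots> \<le> (\<Sum>u\<in>C a. 2 * real (card (N u \<inter> C c)))"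
    using GA finC by (intro sum_mono2) auto
  also have "\<dots> = 2 * real (\<Sum>u\<in>C a. card {x\<in>C c. E u x})"
  proof -
    have "N u \<inter> C c = {x\<in>C c. E u x}" for u using C_sub unfolding nb_def by blast
    then show ?thesis by (simp add: sum_distrib_left)
  qed
  also have "\<dots> = 2 * real (\<Sum>x\<in>C c. card {u\<in>C a. E u x})"
    using double_count[OF finC finC, where R = E] by simp
  also have "\<dots> = (\<Sum>x\<in>C c. 2 * real (card (N x \<inter> C a)))"
  proof -
    have "{u\<in>C a. E u x} = N x \<inter> C a" for x using C_sub E_comm unfolding nb_def by blast
    then show ?thesis by (simp add: sum_distrib_left)
  qed
  also have "\<dots> = (\<Sum>x\<in>C c - H. 2 * real (card (N x \<inter> C a))) + (\<Sum>x\<in>H. 2 * real (card (N x \<inter> C a)))"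
    using HC finC by (simp add: sum.subset_diff)
  also have "(\<Sum>x\<in>H. 2 * real (card (N x \<inter> C a))) \<le> real (card H) * (2 * ?A)"
    using finC by (intro sum_bounded_above) (auto intro!: card_mono)
  also have "\<dots> \<le> \<tau> * (2 * ?A)" using \<open>card H \<le> \<tau>\<close> by (intro mult_right_mono) auto
  also have "(\<Sum>x\<in>C c - H. 2 * real (card (N x \<inter> C a))) \<le> real (card (C c - H)) * (?A + g)"
    by (intro sum_bounded_above) (auto simp: H_def)
  also have "\<dots> \<le> ?C * (?A + g)"
    using finC g_pos by (intro mult_right_mono) (auto intro!: card_mono)
  finally have "(?A - \<tau>) * ?M \<le> ?C * (?A + g) + \<tau> * (2 * ?A)" by simp
  then have "2 * \<mu> * n * ?A \<le> ?A * (k * g) + \<tau> * ?C + \<tau> * (2 * \<mu>) * n - \<tau> * k * g + ?C * g + 2 * \<tau> * ?A"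
    by (simp add: algebra_simps)
  also have "?A * (k * g) \<le> n * (k * g)" using An g_pos k2 by (intro mult_right_mono) auto
  also have "\<tau> * ?C \<le> \<tau> * n" using An tau by (intro mult_left_mono) auto
  also have "\<tau> * (2 * \<mu>) * n \<le> \<tau> * 1 * n" using mu_half tau by (intro mult_right_mono mult_left_mono) auto
  also have "?C * g \<le> n * g" using An g_pos by (intro mult_right_mono) auto
  also have "2 * \<tau> * ?A \<le> 2 * \<tau> * n" using An tau by (intro mult_left_mono) auto
  finally have "2 * \<mu> * n * ?A \<le> n * (g * (k + 1) + 4 * \<tau>) - \<tau> * k * g" by (simp add: algebra_simps)
  moreover have "0 \<le> \<tau> * k * g" using tau g_pos by simp
  ultimately have "n * (2 * \<mu> * ?A) \<le> n * (g * (k + 1) + 4 * \<tau>)" by (simp add: algebra_simps)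
  then have "2 * \<mu> * ?A \<le> g * (k + 1) + 4 * \<tau>" using n_pos by (simp only: mult_le_cancel_left_pos)
  moreover have "2 * \<mu> * (\<delta> * n) \<le> 2 * \<mu> * ?A" using class_ge[OF assms(2)] mu by (intro mult_left_mono) auto
  ultimately have "2 * (\<mu> * \<delta> * n) \<le> \<mu> * \<delta> * n / 2 + 4 * \<tau>" using g_eq by (simp add: algebra_simps)
  then show False using tau_g g6 g_pos by linarith
qed

text \<open>Now \<open>D a a\<close> holds for every class, so a crossing edge cannot have more than
  \<open>\<tau>\<close> common neighbours in \<open>A\<close>: that would give
  \<open>T a (cl v) a\<close> next to \<open>T a a a\<close>. Hence the degrees into
  \<open>A\<close> of its two ends add up to at most about \<open>card A\<close>, and a vertex with
  more than half of its possible edges inside \<open>A\<close> has outer neighbours of small degree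
  into \<open>A\<close>, whose weights are large.\<close>

lemma rigid_False: False
proof -
  have DD: "D a a" if "a \<in> I" for a using D_ex[OF that] D_self that by blast
  have "\<exists>a\<in>I. 2 * card (C a) \<le> n"
  proof (rule ccontr)
    assume a: "\<not> ?thesis"
    obtain B where B: "B \<subseteq> I" "card B = 2" using I2 subset_of_card by metis
    then obtain a b where ab: "a \<in> I" "b \<in> I" "a \<noteq> b" by (auto simp: card_2_iff)
    have "card (C a \<union> C b) \<le> card V" using C_sub fin by (intro card_mono) auto
    moreover have "card (C a \<union> C b) = card (C a) + card (C b)"
      using finC ab(3) by (intro card_Un_disjoint) (auto simp: C_def)
    moreover have "n < 2 * real (card (C a))" "n < 2 * real (card (C b))" using a ab(1,2) by auto
    ultimately show False by linarith
  qed
  then obtain a where a: "a \<in> I" "2 * card (C a) \<le> n" by blast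
  define A where "A = C a"
  define p where "p u = real (card (N u \<inter> A))" for u
  let ?A = "real (card A)"
  define B where "B = n - ?A"
  have fA: "finite A" "A \<subseteq> V" unfolding A_def using finC C_sub by auto
  have A_ge: "\<delta> * n \<le> ?A" unfolding A_def using class_ge a(1) .
  have "card (V - A) = card V - card A" "card A \<le> card V"
    using fA fin by (auto simp: card_Diff_subset card_mono)
  then have B: "real (card (V - A)) = B" unfolding B_def by simp
  define G0 where "G0 = Good a a"
  have G0: "G0 \<subseteq> A" "finite G0" "?A - \<tau> \<le> card G0"
    using Good_big[OF DD a(1)] a(1) finC unfolding G0_def Good_def A_def by auto
  have p_half: "?A \<le> 2 * p u" if "u \<in> G0" for u
  proof -
    have "0 < \<mu> * n" using mu n_pos by simp
    moreover have "?A + 2 * \<mu> * n - k * g \<le> 2 * p u"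
      using that unfolding G0_def Good_def p_def A_def by simp
    ultimately show ?thesis using kg_le by linarith
  qed
  have cross: "p u + p v \<le> ?A + \<tau>" if "u \<in> A" "v \<in> V - A" "E u v" for u v
  proof -
    have "card (N u \<inter> N v \<inter> A) \<le> \<tau>"
    proof (rule ccontr)
      assume "\<not> card (N u \<inter> N v \<inter> A) \<le> \<tau>"
      then have "T a (cl v) a" unfolding T_def A_def using that unfolding A_def C_def by force
      then have "cl v = a" using rigid[OF _ D_T(1)[OF DD[OF a(1)]]] by blast
      then show False using that unfolding A_def C_def by blast
    qed
    moreover have "(N u \<inter> A) \<inter> (N v \<inter> A) = N u \<inter> N v \<inter> A" by blast
    ultimately show ?thesis
      using inter_card_ge[OF fA(1), of "N u \<inter> A" "N v \<inter> A"] unfolding p_def by simp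
  qed
  define M where "M = B + 2 * \<mu> * n"
  define L where "L = ?A + 2 * \<tau>"
  have mun: "\<tau> \<le> \<mu> * n" "0 < \<mu> * n" 
  proof -
    have "\<mu> * \<delta> * n \<le> \<mu> * 1 * n" using delta_le mu n_pos by (intro mult_right_mono mult_left_mono) auto
    then show "\<tau> \<le> \<mu> * n" using tau_g g6 g_pos by simp
    show "0 < \<mu> * n" using mu n_pos by simp
  qed
  have "0 < \<delta> * n" using delta n_pos by simp
  then have L0: "0 < L" unfolding L_def using A_ge tau by linarith
  have LM: "L \<le> M" unfolding M_def L_def B_def using a(2) mun unfolding A_def by simp
  \<comment> \<open>A vertex outside \<open>A\<close> spreads total weight at most 1 over its neighbours in \<open>A\<close>, so the vertices of
    \<open>A\<close> receive at most \<open>B\<close>; yet almost every one of them receives \<open>M / L\<close>, because a neighbour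
    \<open>v\<close> of \<open>u\<close> has \<open>p v \<le> card A + \<tau> - p u\<close>.\<close>
  have out_sum: "M / L \<le> (\<Sum>v\<in>{v \<in> V - A. E u v}. 1 / p v)" if u: "u \<in> G0" for u
  proof -
    let ?O = "{v \<in> V - A. E u v}"
    have uA: "u \<in> A" "u \<in> V" using u G0 fA by auto
    have "N u = (N u \<inter> A) \<union> ?O" using fA unfolding nb_def by blast
    moreover have "card ((N u \<inter> A) \<union> ?O) = card (N u \<inter> A) + card ?O"
      using fin fA(1) by (intro card_Un_disjoint) auto
    ultimately have O: "n / 2 + \<mu> * n - p u \<le> card ?O"
      using deg[OF uA(2)] unfolding p_def by (simp add: algebra_simps)
    have "card (N u \<inter> A) \<le> card A" using fA by (intro card_mono) auto
    then have pA: "p u \<le> ?A" unfolding p_def by simp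
    have "0 < real (card ?O)" using O pA a(2) mun unfolding A_def by linarith
    then have "?O \<noteq> {}" by (metis card.empty less_irrefl of_nat_0)
    have pv: "1 \<le> p v \<and> p v \<le> ?A + \<tau> - p u" if v: "v \<in> ?O" for v
    proof
      have "u \<in> N v \<inter> A" using v uA E_comm unfolding nb_def by blast
      then have "card (N v \<inter> A) \<noteq> 0" using fA(1) by auto
      then show "1 \<le> p v" unfolding p_def by linarith
      show "p v \<le> ?A + \<tau> - p u" using cross[OF uA(1)] v by force
    qed
    define R where "R = ?A + \<tau> - p u"
    have R1: "1 \<le> R" using pv \<open>?O \<noteq> {}\<close> unfolding R_def by fastforce
    have s0: "0 \<le> 2 * p u - ?A" using p_half[OF u] by simp
    \<comment> \<open>The inequality \<open>M * R \<le> L * (n / 2 + \<mu> * n - p u)\<close> is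
      this one in disguise: doubled, its sides are \<open>M * L - (2 * p u - ?A) * M\<close> and
      \<open>M * L - (2 * p u - ?A) * L\<close>. Here \<open>L \<le> M\<close> needs that
      \<open>A\<close> has at most half of the vertices.\<close>
    have "(2 * p u - ?A) * L \<le> (2 * p u - ?A) * M" using LM s0 by (intro mult_left_mono)
    then have "M * R \<le> L * (n / 2 + \<mu> * n - p u)"
      unfolding R_def M_def L_def B_def by (simp add: algebra_simps)
    also have "\<dots> \<le> L * card ?O" using O L0 by (intro mult_left_mono) auto
    finally have "M / L \<le> card ?O * (1 / R)" using L0 R1 by (simp add: field_simps)
    also have "\<dots> \<le> (\<Sum>v\<in>?O. 1 / p v)"
    proof (rule sum_bounded_below)
      fix v assume "v \<in> ?O"
      then show "1 / R \<le> 1 / p v" using pv[of v] unfolding R_def by (intro divide_left_mono) auto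
    qed
    finally show ?thesis .
  qed
  have M0: "0 \<le> M" using LM L0 by linarith
  have "(?A - \<tau>) * (M / L) \<le> card G0 * (M / L)"
    using G0(3) M0 L0 by (intro mult_right_mono) auto
  also have "\<dots> \<le> (\<Sum>u\<in>G0. \<Sum>v\<in>{v \<in> V - A. E u v}. 1 / p v)"
    using out_sum by (intro sum_bounded_below)
  also have "\<dots> \<le> (\<Sum>u\<in>A. \<Sum>v\<in>{v \<in> V - A. E u v}. 1 / p v)"
    using G0 fA by (intro sum_mono2) (auto intro!: sum_nonneg simp: p_def)
  also have "\<dots> = (\<Sum>v\<in>V - A. \<Sum>u\<in>{u \<in> A. E u v}. 1 / p v)"
    using fA fin by (intro sum.swap_restrict) auto
  also have "\<dots> \<le> (\<Sum>v\<in>V - A. 1)"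
  proof (rule sum_mono)
    fix v
    have "{u \<in> A. E u v} = N v \<inter> A" using fA E_comm unfolding nb_def by blast
    then have "(\<Sum>u\<in>{u \<in> A. E u v}. 1 / p v) = p v * (1 / p v)" unfolding p_def by simp
    then show "(\<Sum>u\<in>{u \<in> A. E u v}. 1 / p v) \<le> 1" by simp
  qed
  also have "\<dots> = B" using B by simp
  finally have "(?A - \<tau>) * M \<le> B * L" using L0 by (simp add: field_simps)
  then have "2 * \<mu> * n * ?A \<le> \<tau> * (3 * B) + \<tau> * (2 * \<mu>) * n"
    unfolding M_def L_def by (simp add: algebra_simps)
  also have "\<tau> * (3 * B) \<le> \<tau> * (3 * n)" using tau unfolding B_def by (intro mult_left_mono) auto
  also have "\<tau> * (2 * \<mu>) * n \<le> \<tau> * 1 * n" using mu_half tau by (intro mult_right_mono mult_left_mono) auto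
  finally have "n * (2 * \<mu> * ?A) \<le> n * (4 * \<tau>)" by (simp add: algebra_simps)
  then have "2 * \<mu> * ?A \<le> 4 * \<tau>" using n_pos by (simp only: mult_le_cancel_left_pos)
  moreover have "2 * \<mu> * (\<delta> * n) \<le> 2 * \<mu> * ?A" using A_ge mu by (intro mult_left_mono) auto
  ultimately have "2 * (\<mu> * \<delta> * n) \<le> 4 * \<tau>" by (simp add: algebra_simps)
  then show False using tau_g g6 g_pos by linarith
qed

end

lemma (in classed_graph) two_types:
  obtains a b b' c where "T a b c" "T a b' c" "b \<noteq> b'"
proof (rule ccontr)
  assume a: "\<not> thesis"
  interpret rigid_graph V E r \<mu> \<tau> cl I \<delta>
    by unfold_locales (use a that in blast)
  show False by (rule rigid_False)
qed

section \<open>Reachable pairs of vertices\<close>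

definition conn :: "('a \<Rightarrow> 'a \<Rightarrow> bool) \<Rightarrow> nat \<Rightarrow> 'a set \<Rightarrow> nat \<Rightarrow> 'a set \<Rightarrow> 'a \<Rightarrow> 'a \<Rightarrow> bool" where
  "conn E r V c W x y \<longleftrightarrow> (\<exists>S. S \<subseteq> V \<and> finite S \<and> card S \<le> c \<and> S \<inter> W = {} \<and> x \<notin> S \<and> y \<notin> S \<and>
     tileable E r (insert x S) \<and> tileable E r (insert y S))"

text \<open>Robustness is avoidance of every forbidden set of size \<open>w\<close>, not a count of
  the sets \<open>S\<close>; this is what a greedy choice of disjoint connectors asks for.\<close>

definition reach :: "('a \<Rightarrow> 'a \<Rightarrow> bool) \<Rightarrow> nat \<Rightarrow> 'a set \<Rightarrow> nat \<Rightarrow> real \<Rightarrow> 'a \<Rightarrow> 'a \<Rightarrow> bool" where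
  "reach E r V c w x y \<longleftrightarrow> (\<forall>W. finite W \<longrightarrow> real (card W) \<le> w \<longrightarrow> conn E r V c W x y)"

lemma conn_sym: "conn E r V c W x y \<Longrightarrow> conn E r V c W y x"
  unfolding conn_def by (elim exE conjE) (intro exI conjI; assumption)

lemma reach_sym: "reach E r V c w x y \<Longrightarrow> reach E r V c w y x"
  unfolding reach_def using conn_sym by metis

lemma reach_mono:
  assumes "reach E r V c w x y" "c \<le> c'" "w' \<le> w"
  shows "reach E r V c' w' x y"
  unfolding reach_def
proof (intro allI impI)
  fix W :: "'a set" assume "finite W" "real (card W) \<le> w'"
  then have "conn E r V c W x y" using assms unfolding reach_def by auto
  then show "conn E r V c' W x y" unfolding conn_def using assms(2) by (meson le_trans)
qed

lemma reach_obtain: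
  assumes "reach E r V c w x y" "finite W" "real (card W) \<le> w"
  obtains S where "S \<subseteq> V" "finite S" "card S \<le> c" "S \<inter> W = {}" "x \<notin> S" "y \<notin> S"
    "tileable E r (insert x S)" "tileable E r (insert y S)"
proof -
  have "conn E r V c W x y" using assms unfolding reach_def by simp
  then show thesis unfolding conn_def by (elim exE conjE) (rule that)
qed

text \<open>Connectors \<open>S1\<close> from \<open>x\<close> to \<open>z\<close> and
  \<open>S2\<close> from \<open>z\<close> to \<open>y\<close> combine to
  \<open>insert z (S1 \<union> S2)\<close>: with \<open>x\<close> added, \<open>z\<close> goes to
  \<open>S2\<close>; with \<open>y\<close> added, \<open>z\<close> goes to \<open>S1\<close>. Many
  midpoints are needed because \<open>W\<close> may contain any particular one.\<close>

lemma reach_trans_many: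
  fixes w w' :: real
  assumes Z: "finite Z" "Z \<subseteq> V" "w' + 2 < card Z"
    and R: "\<And>z. z \<in> Z \<Longrightarrow> reach E r V c w x z \<and> reach E r V c w z y"
    and w: "w' + 2 + c \<le> w"
  shows "reach E r V (2 * c + 1) w' x y"
  unfolding reach_def
proof (intro allI impI)
  fix W :: "'a set" assume W: "finite W" "real (card W) \<le> w'"
  have fW: "finite (insert x (insert y W))" using W(1) by simp
  have cW: "card (insert x (insert y W)) \<le> card W + 2"
    by (simp add: card_insert_if W(1))
  then have "card (insert x (insert y W)) < card Z" using Z(3) W(2) by linarith
  then have "\<not> Z \<subseteq> insert x (insert y W)" using card_mono[OF fW, of Z] by linarith
  then obtain z where z: "z \<in> Z" "z \<notin> insert x (insert y W)" by blast
  have "real (card (insert x (insert y W))) \<le> w" using cW W(2) w by linarith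
  then obtain S1 where S1: "S1 \<subseteq> V" "finite S1" "card S1 \<le> c" "S1 \<inter> insert x (insert y W) = {}" "x \<notin> S1" "z \<notin> S1"
    "tileable E r (insert x S1)" "tileable E r (insert z S1)"
    by (rule reach_obtain[OF conjunct1[OF R[OF z(1)]] fW])
  have "card (insert x (insert y W) \<union> S1) \<le> card W + 2 + c"
    using card_Un_le[of "insert x (insert y W)" S1] cW S1(3) by linarith
  then have "real (card (insert x (insert y W) \<union> S1)) \<le> w" using W(2) w by linarith
  then obtain S2 where S2: "S2 \<subseteq> V" "finite S2" "card S2 \<le> c" "S2 \<inter> (insert x (insert y W) \<union> S1) = {}" "z \<notin> S2" "y \<notin> S2"
    "tileable E r (insert z S2)" "tileable E r (insert y S2)"
    by (rule reach_obtain[OF conjunct2[OF R[OF z(1)]] finite_UnI[OF fW S1(2)]])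
  let ?S = "insert z (S1 \<union> S2)"
  have "tileable E r (insert x S1 \<union> insert z S2)"
  proof (rule tileable_Un[OF S1(7) S2(7)])
    show "insert x S1 \<inter> insert z S2 = {}" using S1(6) S2(4) z(2) by blast
  qed
  then have t1: "tileable E r (insert x ?S)" by (simp add: insert_commute Un_ac)
  have "tileable E r (insert z S1 \<union> insert y S2)"
  proof (rule tileable_Un[OF S1(8) S2(8)])
    show "insert z S1 \<inter> insert y S2 = {}" using S1(4) S2(4,5) z(2) by blast
  qed
  then have t2: "tileable E r (insert y ?S)" by (simp add: insert_commute Un_ac)
  have "card ?S \<le> 2 * c + 1"
    using card_Un_le[of S1 S2] S1(2,3) S2(2,3) by (simp add: card_insert_if)
  then show "conn E r V (2 * c + 1) W x y"
    unfolding conn_def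
  proof (intro exI[of _ ?S] conjI)
    show "?S \<subseteq> V" using S1(1) S2(1) z(1) Z(2) by blast
    show "finite ?S" using S1(2) S2(2) by simp
    show "?S \<inter> W = {}" using S1(4) S2(4) z(2) by blast
    show "x \<notin> ?S" using S1(5) S2(4) z(2) by blast
    show "y \<notin> ?S" using S1(4) S2(6) z(2) by blast
  qed (use \<open>card ?S \<le> 2 * c + 1\<close> t1 t2 in simp_all)
qed

text \<open>Reachability for whole sets: \<open>G\<close> is a union of disjoint connectors, one for
  each pair, and completes either all the \<open>p i\<close> or all the \<open>q i\<close>.\<close>

lemma reach_family:
  fixes p q :: "'i \<Rightarrow> 'a" and w :: real
  assumes I: "finite I" "inj_on p I" "inj_on q I"
    and R: "\<And>i. i \<in> I \<Longrightarrow> reach E r V c w (p i) (q i)"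
    and W: "finite W" "real (card W) + 2 * card I + card I * c \<le> w"
  obtains G where "G \<subseteq> V" "finite G" "card G \<le> card I * c" "G \<inter> (W \<union> p ` I \<union> q ` I) = {}"
    "tileable E r (G \<union> p ` I)" "tileable E r (G \<union> q ` I)"
proof -
  let ?P = "\<lambda>i S. S \<subseteq> V \<and> tileable E r (insert (p i) S) \<and> tileable E r (insert (q i) S)"
  let ?W = "W \<union> p ` I \<union> q ` I"
  have fW: "finite ?W" using W I by auto
  have "card ?W \<le> card W + card (p ` I) + card (q ` I)"
    using card_Un_le[of "W \<union> p ` I" "q ` I"] card_Un_le[of W "p ` I"] by linarith
  moreover have "card (p ` I) = card I" "card (q ` I) = card I" using I by (auto simp: card_image)
  ultimately have cW: "card ?W \<le> card W + 2 * card I" by linarith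
  have "\<exists>S. (\<forall>i\<in>I. ?P i (S i) \<and> finite (S i) \<and> card (S i) \<le> c \<and> S i \<inter> ?W = {}) \<and>
    (\<forall>i\<in>I. \<forall>j\<in>I. i \<noteq> j \<longrightarrow> S i \<inter> S j = {})"
  proof (rule greedy_disjoint[OF I(1) fW])
    fix i W' assume i: "i \<in> I" "finite W'" "?W \<subseteq> W'" "card W' \<le> card ?W + card I * c"
    have "card W' \<le> card W + 2 * card I + card I * c" using i(4) cW by linarith
    then have "real (card W') \<le> real (card W + 2 * card I + card I * c)" by linarith
    then have "real (card W') \<le> w" using W(2) by simp
    then obtain S where "S \<subseteq> V" "finite S" "card S \<le> c" "S \<inter> W' = {}" "p i \<notin> S" "q i \<notin> S"
      "tileable E r (insert (p i) S)" "tileable E r (insert (q i) S)"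
      by (rule reach_obtain[OF R[OF i(1)] i(2)])
    then show "\<exists>S. ?P i S \<and> finite S \<and> card S \<le> c \<and> S \<inter> W' = {}" by (intro exI[of _ S]) simp
  qed
  then obtain S where S: "\<forall>i\<in>I. ?P i (S i) \<and> finite (S i) \<and> card (S i) \<le> c \<and> S i \<inter> ?W = {}"
    "\<forall>i\<in>I. \<forall>j\<in>I. i \<noteq> j \<longrightarrow> S i \<inter> S j = {}" by (elim exE conjE) (rule that)
  define G where "G = (\<Union>i\<in>I. S i)"
  have til: "tileable E r (G \<union> f ` I)"
    if f: "inj_on f I" "\<forall>i\<in>I. tileable E r (insert (f i) (S i)) \<and> f i \<in> ?W" for f
  proof -
    have "tileable E r (\<Union>i\<in>I. insert (f i) (S i))"
    proof (rule tileable_UN[OF I(1)])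
      fix i j assume ij: "i \<in> I" "j \<in> I" "i \<noteq> j"
      have "f i \<noteq> f j" using f(1) ij by (meson inj_onD)
      moreover have "f i \<notin> S j" "f j \<notin> S i" using f(2) S(1) ij by blast+
      ultimately show "insert (f i) (S i) \<inter> insert (f j) (S j) = {}" using S(2) ij by auto
    qed (use f in blast)
    moreover have "(\<Union>i\<in>I. insert (f i) (S i)) = G \<union> f ` I" unfolding G_def by blast
    ultimately show ?thesis by simp
  qed
  show thesis
  proof (rule that[of G])
    show "G \<subseteq> V" "finite G" "G \<inter> ?W = {}" unfolding G_def using S(1) I(1) by auto
    have "card G \<le> (\<Sum>i\<in>I. card (S i))" unfolding G_def using I(1) by (rule card_UN_le)
    also have "\<dots> \<le> card I * c" using S(1) sum_bounded_above[of I "\<lambda>i. card (S i)" c] by simp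
    finally show "card G \<le> card I * c" .
    show "tileable E r (G \<union> p ` I)" "tileable E r (G \<union> q ` I)" using til I S(1) by auto
  qed
qed

context dense_graph
begin

abbreviation R where "R \<equiv> reach E r V"

text \<open>The triangles at \<open>x\<close>, recorded as ordered edges of the link of
  \<open>x\<close>.\<close>

definition Ed where "Ed x = (SIGMA v:N x. N x \<inter> N v)"

lemma finEd: "finite (Ed x)"
  unfolding Ed_def using finN by auto

lemma Ed_Int: "Ed x \<inter> Ed y = (SIGMA v:N x \<inter> N y. N x \<inter> N y \<inter> N v)"
  unfolding Ed_def by auto

lemma card_Ed:
  assumes "x \<in> V" shows "\<mu> * n\<^sup>2 \<le> card (Ed x)"
proof -
  have "0 \<le> \<mu> * n" using mu by simp
  then have "n / 2 \<le> card (N x)" using deg[OF assms] by (simp add: algebra_simps)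
  then have "n / 2 * (2 * \<mu> * n) \<le> card (N x) * (2 * \<mu> * n)"
    using mu by (intro mult_right_mono) auto
  also have "\<dots> \<le> (\<Sum>v\<in>N x. real (card (N x \<inter> N v)))"
  proof (rule sum_bounded_below)
    fix v assume "v \<in> N x"
    then have "v \<in> V" by (simp add: in_N)
    then show "2 * \<mu> * n \<le> real (card (N x \<inter> N v))" by (rule codeg[OF assms])
  qed
  also have "\<dots> = card (Ed x)" unfolding Ed_def by (simp add: finN)
  finally show ?thesis by (simp add: power2_eq_square algebra_simps)
qed

text \<open>Many shared triangles provide a vertex \<open>v\<close> outside \<open>W\<close> whose
  common neighbourhood with both \<open>x\<close> and \<open>y\<close> is large even outside
  \<open>W\<close>. A K_{r-2} in it together with \<open>v\<close> is a K_{r-1} that completes to a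
  K_r with either vertex, so the connector has r - 1 vertices.\<close>

lemma reach_of_codense:
  fixes \<eta> w :: real
  assumes "\<eta> * n\<^sup>2 \<le> card (Ed x \<inter> Ed y)" "\<tau> + 2 * w < \<eta> * n" "0 < n"
  shows "R (r - 1) w x y"
  unfolding reach_def
proof (intro allI impI)
  fix W :: "'a set" assume W: "finite W" "real (card W) \<le> w"
  have "\<exists>v\<in>N x \<inter> N y - W. \<tau> < card (N x \<inter> N y \<inter> N v - W)"
  proof (rule ccontr)
    assume a: "\<not> ?thesis"
    have fNN: "finite (N x \<inter> N y)" using finN by auto
    have cn: "real (card (N x \<inter> N y \<inter> N v)) \<le> n" for v
    proof -
      have "N x \<inter> N y \<inter> N v \<subseteq> V" using N_sub by blast
      then show ?thesis using fin by (simp add: card_mono)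
    qed
    have "real (card (Ed x \<inter> Ed y)) = (\<Sum>v\<in>N x \<inter> N y. real (card (N x \<inter> N y \<inter> N v)))"
      unfolding Ed_Int using finN by simp
    also have "\<dots> = (\<Sum>v\<in>N x \<inter> N y - W. real (card (N x \<inter> N y \<inter> N v)))
        + (\<Sum>v\<in>N x \<inter> N y \<inter> W. real (card (N x \<inter> N y \<inter> N v)))"
      using sum.Int_Diff[OF fNN, of _ W] by (simp add: add.commute)
    also have "(\<Sum>v\<in>N x \<inter> N y \<inter> W. real (card (N x \<inter> N y \<inter> N v))) \<le> real (card (N x \<inter> N y \<inter> W)) * n"
      using cn by (intro sum_bounded_above)
    also have "\<dots> \<le> w * n"
    proof (rule mult_right_mono)
      have "card (N x \<inter> N y \<inter> W) \<le> card W" using W(1) by (intro card_mono) auto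
      then show "real (card (N x \<inter> N y \<inter> W)) \<le> w" using W(2) by linarith
    qed simp
    also have "(\<Sum>v\<in>N x \<inter> N y - W. real (card (N x \<inter> N y \<inter> N v))) \<le> real (card (N x \<inter> N y - W)) * (\<tau> + w)"
    proof (rule sum_bounded_above)
      fix v assume "v \<in> N x \<inter> N y - W"
      then have "\<not> \<tau> < card (N x \<inter> N y \<inter> N v - W)" using a by blast
      then show "real (card (N x \<inter> N y \<inter> N v)) \<le> \<tau> + w"
        using card_Diff_ge[OF W(1), of "N x \<inter> N y \<inter> N v"] W(2) by linarith
    qed
    also have "\<dots> \<le> n * (\<tau> + w)"
    proof (rule mult_right_mono)
      have "N x \<inter> N y - W \<subseteq> V" using N_sub by blast
      then show "real (card (N x \<inter> N y - W)) \<le> n" using fin by (simp add: card_mono)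
      have "0 \<le> real (card W)" by simp
      then show "0 \<le> \<tau> + w" using tau W(2) by linarith
    qed
    finally have "\<eta> * n\<^sup>2 \<le> n * (\<tau> + 2 * w)" using assms(1) by (simp add: algebra_simps)
    then have "n * (\<eta> * n) \<le> n * (\<tau> + 2 * w)" by (simp add: power2_eq_square algebra_simps)
    then have "\<eta> * n \<le> \<tau> + 2 * w" using assms(3) by (simp only: mult_le_cancel_left_pos)
    then show False using assms(2) by simp
  qed
  then obtain v where v: "v \<in> N x \<inter> N y - W" "\<tau> < card (N x \<inter> N y \<inter> N v - W)" by blast
  have sV: "N x \<inter> N y \<inter> N v - W \<subseteq> V" using N_sub by blast
  obtain Q where Q: "Q \<subseteq> N x \<inter> N y \<inter> N v - W" "card Q = r - 2" "clique E Q" "finite Q"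
    by (rule get_clique[OF sV v(2)])
  have vx: "E x v" "E y v" "v \<in> V" using v(1) in_N by auto
  have ne: "x \<noteq> v" "y \<noteq> v" using vx irr by blast+
  have Kx: "Kr E r (insert x (insert v Q))" "v \<notin> Q" "x \<notin> Q"
    using Kr_extend[of Q x v] Q vx ne by auto
  have Ky: "Kr E r (insert y (insert v Q))" "y \<notin> Q"
    using Kr_extend[of Q y v] Q vx ne by auto
  have "card (insert v Q) = r - 1" using Q Kx r4 by simp
  then show "conn E r V (r - 1) W x y"
    unfolding conn_def
  proof (intro exI[of _ "insert v Q"] conjI)
    show "insert v Q \<subseteq> V" using Q(1) sV vx by blast
    show "insert v Q \<inter> W = {}" using Q(1) v(1) by blast
    show "x \<notin> insert v Q" "y \<notin> insert v Q" using Kx(3) Ky(2) ne by auto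
  qed (use Q(4) Kx(1) Ky(1) in \<open>simp_all add: tileable_Kr\<close>)
qed

text \<open>The links have at least \<open>\<mu> * n\<^sup>2\<close> ordered edges each and at most
  \<open>n\<^sup>2\<close> together. If all pairs overlapped in less than \<open>?h\<close>, the
  Bonferroni bound would allow a total of \<open>3/2 * n\<^sup>2\<close>, while
  \<open>card J * \<mu> \<ge> 2\<close> forces \<open>2 * n\<^sup>2\<close>.\<close>

lemma exists_codense_pair:
  assumes "J \<subseteq> V" "2 \<le> card J * \<mu>" "0 < n"
  shows "\<exists>x\<in>J. \<exists>y\<in>J. x \<noteq> y \<and> 1 / (2 * (real (card J))\<^sup>2) * n\<^sup>2 \<le> card (Ed x \<inter> Ed y)"
proof (rule ccontr)
  assume a: "\<not> ?thesis"
  let ?C = "real (card J)"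
  let ?h = "1 / (2 * ?C\<^sup>2) * n\<^sup>2"
  have C0: "0 < ?C" using assms(2) by (cases "card J") auto
  have fJ: "finite J" using assms(1) fin by (rule finite_subset)
  have "(\<Sum>x\<in>J. real (card (Ed x))) \<le> card (\<Union>x\<in>J. Ed x) + ?C\<^sup>2 * ?h"
  proof (rule sum_card_le_Union[OF fJ finEd])
    fix x y assume "x \<in> J" "y \<in> J" "x \<noteq> y"
    then have "\<not> ?h \<le> real (card (Ed x \<inter> Ed y))" using a by blast
    then show "real (card (Ed x \<inter> Ed y)) \<le> ?h" by linarith
  qed simp
  also have "?C\<^sup>2 * ?h = n\<^sup>2 / 2" using C0 by simp
  also have "card (\<Union>x\<in>J. Ed x) \<le> card (V \<times> V)"
    using fin N_sub unfolding Ed_def by (intro card_mono) auto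
  also have "card (V \<times> V) = card V * card V" by (simp add: card_cartesian_product)
  finally have "(\<Sum>x\<in>J. real (card (Ed x))) \<le> 3 / 2 * n\<^sup>2" by (simp add: power2_eq_square)
  moreover have "?C * (\<mu> * n\<^sup>2) \<le> (\<Sum>x\<in>J. real (card (Ed x)))"
    using card_Ed assms(1) by (intro sum_bounded_below) auto
  moreover have "2 * n\<^sup>2 \<le> (?C * \<mu>) * n\<^sup>2" using assms(2) by (intro mult_right_mono) auto
  moreover have "0 < n\<^sup>2" using assms(3) by simp
  ultimately show False by (simp add: algebra_simps)
qed

text \<open>Each ordered edge of the link of \<open>x\<close> has at least
  \<open>2 * \<mu> * n\<close> common neighbours \<open>y\<close>, so the overlaps sum to
  \<open>2 * \<mu>\<^sup>2 * n ^ 3\<close>. Half of this may come from vertices with small overlap;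
  the rest requires many others, as each contributes at most \<open>n\<^sup>2\<close>.\<close>

lemma many_codense:
  assumes "x \<in> V" "0 < n"
  shows "\<mu>\<^sup>2 * n \<le> card {y\<in>V. \<mu>\<^sup>2 * n\<^sup>2 \<le> card (Ed x \<inter> Ed y)}"
proof -
  define Y where "Y = {y\<in>V. \<mu>\<^sup>2 * n\<^sup>2 \<le> card (Ed x \<inter> Ed y)}"
  have Y: "Y \<subseteq> V" "finite Y" using fin unfolding Y_def by auto
  have "\<mu> * n\<^sup>2 * (2 * \<mu> * n) \<le> card (Ed x) * (2 * \<mu> * n)"
    using card_Ed[OF assms(1)] mu by (intro mult_right_mono) auto
  also have "\<dots> \<le> (\<Sum>e\<in>Ed x. real (card {y\<in>V. e \<in> Ed y}))"
  proof (rule sum_bounded_below)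
    fix e assume "e \<in> Ed x"
    then obtain v z where e: "e = (v, z)" "v \<in> N x" "z \<in> N x \<inter> N v" unfolding Ed_def by blast
    have "N v \<inter> N z \<subseteq> {y\<in>V. e \<in> Ed y}"
      using e N_sub[of x] E_comm unfolding Ed_def nb_def by auto
    then have "card (N v \<inter> N z) \<le> card {y\<in>V. e \<in> Ed y}" using fin by (intro card_mono) auto
    moreover have "2 * \<mu> * n \<le> card (N v \<inter> N z)" using codeg[of v z] e N_sub by blast
    ultimately show "2 * \<mu> * n \<le> real (card {y\<in>V. e \<in> Ed y})" by linarith
  qed
  also have "\<dots> = real (\<Sum>e\<in>Ed x. card {y\<in>V. e \<in> Ed y})" by simp
  also have "\<dots> = real (\<Sum>y\<in>V. card {e\<in>Ed x. e \<in> Ed y})"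
    using double_count[OF finEd fin, where R = "\<lambda>e y. e \<in> Ed y"] by simp
  also have "\<dots> = (\<Sum>y\<in>V. real (card (Ed x \<inter> Ed y)))" by (simp add: Int_def)
  also have "\<dots> = (\<Sum>y\<in>V - Y. real (card (Ed x \<inter> Ed y))) + (\<Sum>y\<in>Y. real (card (Ed x \<inter> Ed y)))"
    using Y fin by (simp add: sum.subset_diff)
  also have "(\<Sum>y\<in>Y. real (card (Ed x \<inter> Ed y))) \<le> real (card Y) * n\<^sup>2"
  proof (rule sum_bounded_above)
    fix y
    have "card (Ed x \<inter> Ed y) \<le> card (V \<times> V)"
      using fin N_sub unfolding Ed_def by (intro card_mono) auto
    also have "\<dots> = card V * card V" by (simp add: card_cartesian_product)
    finally have "card (Ed x \<inter> Ed y) \<le> card V * card V" .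
    then have "real (card (Ed x \<inter> Ed y)) \<le> real (card V * card V)" by linarith
    then show "real (card (Ed x \<inter> Ed y)) \<le> n\<^sup>2" by (simp add: power2_eq_square)
  qed
  also have "(\<Sum>y\<in>V - Y. real (card (Ed x \<inter> Ed y))) \<le> real (card (V - Y)) * (\<mu>\<^sup>2 * n\<^sup>2)"
    by (rule sum_bounded_above) (auto simp: Y_def)
  also have "\<dots> \<le> n * (\<mu>\<^sup>2 * n\<^sup>2)"
    using fin by (intro mult_right_mono) (auto intro!: card_mono)
  finally have "n\<^sup>2 * (\<mu>\<^sup>2 * n) \<le> n\<^sup>2 * card Y" by (simp add: power2_eq_square algebra_simps)
  then show ?thesis using assms(2) unfolding Y_def by simp
qed

end

section \<open>Merging reachability classes\<close>

context dense_graph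
begin

definition typed_Kr where
  "typed_Kr cl V' a b d u v Q \<longleftrightarrow> u \<in> V' \<and> v \<in> V' \<and> Q \<subseteq> V' \<and> cl u = a \<and> cl v = b \<and> (\<forall>q\<in>Q. cl q = d) \<and>
     card Q = r - 2 \<and> finite Q \<and> u \<noteq> v \<and> u \<notin> Q \<and> v \<notin> Q \<and> Kr E r (insert u (insert v Q))"

definition robust_type where
  "robust_type cl V' w a b d \<longleftrightarrow> (\<forall>W. finite W \<longrightarrow> real (card W) \<le> w \<longrightarrow>
     (\<exists>u v Q. typed_Kr cl V' a b d u v Q \<and> insert u (insert v Q) \<inter> W = {}))"

text \<open>The labels are themselves vertices: \<open>cl y\<close> is a representative from which
  \<open>y\<close> is reachable. Take disjoint cliques \<open>K1\<close> of type a, b, d and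
  \<open>K2\<close> of type a, b', d, with \<open>v\<close> and \<open>v'\<close> the vertices in
  which the types differ. \<open>S1\<close> links \<open>b\<close> to \<open>v\<close>,
  \<open>S2\<close> links \<open>b'\<close> to \<open>v'\<close>, and \<open>G\<close> links the
  remaining vertices \<open>P\<close> of \<open>K1\<close> to those of \<open>K2\<close>, class by
  class. With \<open>b\<close> added, the pieces are b + S1, v' + S2, K1, G + P'; with
  \<open>b'\<close> added, they are b' + S2, v + S1, K2, G + P. The size is at most 2c + 2r + (r -
  1)c.\<close>

lemma exchange_reach:
  fixes w w' w2 :: real
  assumes V': "V' \<subseteq> V"
    and same: "\<And>y z. y \<in> V' \<Longrightarrow> z \<in> V' \<Longrightarrow> y \<noteq> z \<Longrightarrow> cl y = cl z \<Longrightarrow> R c w y z"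
    and root: "\<And>y. y \<in> V' \<Longrightarrow> R c w (cl y) y"
    and rob: "robust_type cl V' w2 a b d" "robust_type cl V' w2 a b' d"
    and w: "w' + 2 + r \<le> w2" "w' + 4 * r + (r + 1) * c \<le> w"
  shows "R ((r + 1) * c + 2 * r) w' b b'"
  unfolding reach_def
proof (intro allI impI)
  fix W :: "'a set" assume W: "finite W" "real (card W) \<le> w'"
  define W1 where "W1 = insert b (insert b' W)"
  have W1: "finite W1" "card W1 \<le> card W + 2" unfolding W1_def using W(1) by (auto simp: card_insert_if)
  have "real (card W1) \<le> w2" using W1(2) W(2) w(1) by linarith
  then obtain u v Q where K: "typed_Kr cl V' a b d u v Q" "insert u (insert v Q) \<inter> W1 = {}"
    using rob(1) W1(1) unfolding robust_type_def by blast
  define K1 where "K1 = insert u (insert v Q)"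
  have Kd: "u \<in> V'" "v \<in> V'" "Q \<subseteq> V'" "cl u = a" "cl v = b" "\<forall>q\<in>Q. cl q = d"
     "card Q = r - 2" "finite Q" "u \<noteq> v" "u \<notin> Q" "v \<notin> Q" "Kr E r K1"
    using K(1) unfolding typed_Kr_def K1_def by auto
  have K1: "finite K1" "card K1 = r" using Kd(12) unfolding Kr_def by auto
  have c2: "card (W1 \<union> K1) \<le> card W + 2 + r" using card_Un_le[of W1 K1] W1(2) K1(2) by linarith
  have f2: "finite (W1 \<union> K1)" using W1(1) K1(1) by simp
  have "real (card (W1 \<union> K1)) \<le> w2" using c2 W(2) w(1) by linarith
  then obtain u' v' Q' where K': "typed_Kr cl V' a b' d u' v' Q'" "insert u' (insert v' Q') \<inter> (W1 \<union> K1) = {}"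
    using rob(2) f2 unfolding robust_type_def by blast
  define K2 where "K2 = insert u' (insert v' Q')"
  have Kd': "u' \<in> V'" "v' \<in> V'" "Q' \<subseteq> V'" "cl u' = a" "cl v' = b'" "\<forall>q\<in>Q'. cl q = d"
     "card Q' = r - 2" "finite Q'" "u' \<noteq> v'" "u' \<notin> Q'" "v' \<notin> Q'" "Kr E r K2"
    using K'(1) unfolding typed_Kr_def K2_def by auto
  have K2: "finite K2" "card K2 = r" using Kd'(12) unfolding Kr_def by auto
  have d12: "K1 \<inter> W1 = {}" "K2 \<inter> W1 = {}" "K2 \<inter> K1 = {}" using K(2) K'(2) unfolding K1_def K2_def by auto
  define W2 where "W2 = W1 \<union> K1 \<union> K2"
  have W2: "finite W2" "card W2 \<le> card W + 2 + 2 * r"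
    unfolding W2_def using f2 K2 c2 card_Un_le[of "W1 \<union> K1" K2] by auto
  have rc: "real ((r + 1) * c) = (real r + 1) * c" by (simp add: algebra_simps)
  have rc0: "2 * real c \<le> (real r + 1) * c" using r4 by (intro mult_right_mono) auto
  have wb: "w' + 4 * real r + 2 * real c \<le> w" using w(2) rc0 by (simp add: algebra_simps)
  have r4': "4 \<le> real r" using r4 by simp
  have "real (card W2) \<le> w" using W2(2) W(2) wb r4' by linarith
  then obtain S1 where S1: "S1 \<subseteq> V" "finite S1" "card S1 \<le> c" "S1 \<inter> W2 = {}" "b \<notin> S1" "v \<notin> S1"
    "tileable E r (insert b S1)" "tileable E r (insert v S1)"
    by (rule reach_obtain[OF root[OF Kd(2), unfolded Kd(5)] W2(1)])
  have W3: "finite (W2 \<union> S1)" "card (W2 \<union> S1) \<le> card W + 2 + 2 * r + c"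
    using W2 S1(2,3) card_Un_le[of W2 S1] by auto
  have "real (card (W2 \<union> S1)) \<le> w" using W3(2) W(2) wb r4' by linarith
  then obtain S2 where S2: "S2 \<subseteq> V" "finite S2" "card S2 \<le> c" "S2 \<inter> (W2 \<union> S1) = {}" "b' \<notin> S2" "v' \<notin> S2"
    "tileable E r (insert b' S2)" "tileable E r (insert v' S2)"
    by (rule reach_obtain[OF root[OF Kd'(2), unfolded Kd'(5)] W3(1)])
  have W4: "finite (W2 \<union> S1 \<union> S2)" "card (W2 \<union> S1 \<union> S2) \<le> card W + 2 + 2 * r + 2 * c"
    using W3 S2(2,3) card_Un_le[of "W2 \<union> S1" S2] by auto
  obtain f where f: "bij_betw f Q Q'"
    using finite_same_card_bij[OF Kd(8) Kd'(8)] Kd(7) Kd'(7) by auto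
  define P where "P = insert u Q"
  define P' where "P' = insert u' Q'"
  define q where "q x = (if x = u then u' else f x)" for x
  have fQ: "f x \<in> Q'" if "x \<in> Q" for x using f that by (meson bij_betwE)
  have cP: "finite P" "card P = r - 1" "card P' = r - 1" unfolding P_def P'_def using Kd Kd' r4 by auto
  have qi: "inj_on q P" "q ` P = P'"
  proof -
    have "bij_betw q Q Q'" using f by (rule bij_betw_cong[THEN iffD1, rotated]) (use Kd(10) in \<open>auto simp: q_def\<close>)
    moreover have "q u = u'" unfolding q_def by simp
    ultimately have "bij_betw q P P'" unfolding P_def P'_def
      using notIn_Un_bij_betw[of u Q q Q'] Kd(10) Kd'(10) by simp
    then show "inj_on q P" "q ` P = P'" by (auto simp: bij_betw_def)
  qed
  have Rq: "R c w (id x) (q x)" if x: "x \<in> P" for x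
  proof -
    have h: "cl x = cl (q x) \<and> x \<in> V' \<and> q x \<in> V' \<and> x \<in> K1 \<and> q x \<in> K2"
    proof (cases "x = u")
      case True
      then have "q x = u'" unfolding q_def by simp
      then show ?thesis using True Kd(1,4) Kd'(1,4) unfolding K1_def K2_def by simp
    next
      case False
      then have "x \<in> Q" "q x = f x" using x unfolding P_def q_def by auto
      moreover have "f x \<in> Q'" using fQ[OF \<open>x \<in> Q\<close>] .
      ultimately show ?thesis using Kd(3,6) Kd'(3,6) unfolding K1_def K2_def by auto
    qed
    have ne: "x \<noteq> q x" using h d12(3) by (metis disjoint_iff)
    then show ?thesis using same[of x "q x"] h by simp
  qed
  have num: "real (card (W2 \<union> S1 \<union> S2)) + 2 * card P + card P * c \<le> w"
  proof -
    have e: "real (card P) = real r - 1" using cP r4 by simp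
    have "real (card P) * c = real r * c - c" unfolding e by (simp add: algebra_simps)
    then show ?thesis using W4(2) W(2) w(2) cP(2) r4 rc by (simp add: algebra_simps)
  qed
  obtain G where G: "G \<subseteq> V" "finite G" "card G \<le> card P * c"
    "G \<inter> (W2 \<union> S1 \<union> S2 \<union> id ` P \<union> q ` P) = {}"
    "tileable E r (G \<union> id ` P)" "tileable E r (G \<union> q ` P)"
    by (rule reach_family[OF cP(1) inj_on_id qi(1) Rq W4(1) num])
  have G5: "tileable E r (G \<union> P)" "tileable E r (G \<union> P')" using G(5,6) qi(2) by auto
  have K1P: "K1 = insert v P" "K2 = insert v' P'" unfolding K1_def K2_def P_def P'_def by auto
  have nP: "v \<notin> P" "v' \<notin> P'" unfolding P_def P'_def using Kd Kd' by auto
  have bW: "b \<in> W1" "b' \<in> W1" "W \<subseteq> W1" unfolding W1_def by auto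
  have bK: "b \<notin> K1" "b \<notin> K2" "b' \<notin> K1" "b' \<notin> K2" using d12 bW by blast+
  have W2s: "W1 \<subseteq> W2" "K1 \<subseteq> W2" "K2 \<subseteq> W2" unfolding W2_def by auto
  have e: "S1 \<inter> S2 = {}" "S1 \<inter> K1 = {}" "S1 \<inter> K2 = {}" "S2 \<inter> K1 = {}" "S2 \<inter> K2 = {}" "K1 \<inter> K2 = {}"
    "G \<inter> S1 = {}" "G \<inter> S2 = {}" "G \<inter> K1 = {}" "G \<inter> K2 = {}"
    "S1 \<inter> W1 = {}" "S2 \<inter> W1 = {}" "G \<inter> W1 = {}"
    using S1(4) S2(4) G(4) d12(3) W2s by blast+
  have PK: "P \<subseteq> K1" "P' \<subseteq> K2" "v \<in> K1" "v' \<in> K2" unfolding K1P by auto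
  have nb: "b \<notin> S1" "b \<notin> S2" "b \<notin> G" "b' \<notin> S1" "b' \<notin> S2" "b' \<notin> G" using e(11-13) bW by blast+
  have "v' \<notin> S1" using e(3) PK(4) by blast
  moreover have "v \<notin> S2" using e(4) PK(3) by blast
  moreover have "v \<notin> K2" using e(6) PK(3) by blast
  moreover have "v' \<notin> K1" using e(6) PK(4) by blast
  moreover have "v \<notin> G" using e(9) PK(3) by blast
  moreover have "v' \<notin> G" using e(10) PK(4) by blast
  ultimately have nv: "v' \<notin> S1" "v \<notin> S2" "v \<notin> K2" "v' \<notin> K1" "v \<notin> G" "v' \<notin> G" .
  have bv: "b \<noteq> v" "b \<noteq> v'" "b' \<noteq> v" "b' \<noteq> v'" using bK PK by blast+
  have "S1 \<inter> P = {}" using e(2) PK(1) by blast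
  moreover have "S1 \<inter> P' = {}" using e(3) PK(2) by blast
  moreover have "S2 \<inter> P = {}" using e(4) PK(1) by blast
  moreover have "S2 \<inter> P' = {}" using e(5) PK(2) by blast
  moreover have "K1 \<inter> P' = {}" using e(6) PK(2) by blast
  moreover have "K2 \<inter> P = {}" using e(6) PK(1) by blast
  ultimately have eP: "S1 \<inter> P = {}" "S1 \<inter> P' = {}" "S2 \<inter> P = {}" "S2 \<inter> P' = {}" "K1 \<inter> P' = {}" "K2 \<inter> P = {}" .
  have bP: "b \<notin> P" "b \<notin> P'" "b' \<notin> P" "b' \<notin> P'" using bK PK(1,2) by blast+
  define S where "S = S1 \<union> S2 \<union> K1 \<union> K2 \<union> G"
  note disj = Int_Un_distrib Int_Un_distrib2
  have t1: "tileable E r (insert b S1 \<union> insert v' S2 \<union> K1 \<union> (G \<union> P'))"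
  proof (rule tileable_Un[OF tileable_Un[OF tileable_Un[OF S1(7) S2(8)] tileable_Kr[OF Kd(12)]] G5(2)])
    show "insert b S1 \<inter> insert v' S2 = {}" using e(1) nb(2) nv(1) bv(2) by simp
    show "(insert b S1 \<union> insert v' S2) \<inter> K1 = {}" using e(2,4) bK(1) nv(4) by (simp add: disj)
    show "(insert b S1 \<union> insert v' S2 \<union> K1) \<inter> (G \<union> P') = {}"
      using e(7,8,9) eP(2,4,5) nb(3) nv(6) nP(2) bP(2) by (simp add: disj Int_commute)
  qed
  have t2: "tileable E r (insert b' S2 \<union> insert v S1 \<union> K2 \<union> (G \<union> P))"
  proof (rule tileable_Un[OF tileable_Un[OF tileable_Un[OF S2(7) S1(8)] tileable_Kr[OF Kd'(12)]] G5(1)])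
    show "insert b' S2 \<inter> insert v S1 = {}" using e(1) nb(4) nv(2) bv(3) by (simp add: Int_commute)
    show "(insert b' S2 \<union> insert v S1) \<inter> K2 = {}" using e(3,5) bK(4) nv(3) by (simp add: disj)
    show "(insert b' S2 \<union> insert v S1 \<union> K2) \<inter> (G \<union> P) = {}"
      using e(7,8,10) eP(1,3,6) nb(6) nv(5) nP(1) bP(3) by (simp add: disj Int_commute)
  qed
  have "insert b S1 \<union> insert v' S2 \<union> K1 \<union> (G \<union> P') = insert b S" unfolding S_def K1P by blast
  then have t1: "tileable E r (insert b S)" using t1 by simp
  have "insert b' S2 \<union> insert v S1 \<union> K2 \<union> (G \<union> P) = insert b' S" unfolding S_def K1P by blast
  then have t2: "tileable E r (insert b' S)" using t2 by simp
  have "card S \<le> card S1 + card S2 + card K1 + card K2 + card G"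
    unfolding S_def by (intro order_trans[OF card_Un_le] add_mono order_refl)
  also have "\<dots> \<le> c + c + r + r + (r - 1) * c" using S1(3) S2(3) K1 K2 G(3) cP by simp
  also have "\<dots> = (r + 1) * c + 2 * r" using r4 by (cases r) (simp_all add: algebra_simps)
  finally have cS: "card S \<le> (r + 1) * c + 2 * r" .
  show "conn E r V ((r + 1) * c + 2 * r) W b b'"
    unfolding conn_def
  proof (intro exI[of _ S] conjI)
    have "K1 \<subseteq> V" "K2 \<subseteq> V" using Kd Kd' V' unfolding K1_def K2_def by auto
    then show "S \<subseteq> V" unfolding S_def using S1(1) S2(1) G(1) by blast
    show "finite S" unfolding S_def using S1 S2 K1 K2 G by simp
    show "S \<inter> W = {}" unfolding S_def using e(11-13) d12 bW(3) by blast
    show "b \<notin> S" "b' \<notin> S" unfolding S_def using nb bK by auto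
  qed (use cS t1 t2 in auto)
qed

text \<open>Were the \<open>k\<close> vertices of \<open>I\<close> pairwise unreachable for the
  weaker constants, they would be so for the stronger ones, and \<open>H1\<close> would make every
  other vertex reachable from at least one of them. After deletion of the few vertices reachable
  from two, \<open>cl\<close> partitions the graph; \<open>H2\<close> makes the classes large,
  \<open>two_types\<close> applies, and \<open>exchange_reach\<close> joins two vertices of
  \<open>I\<close>.\<close>

lemma reach_step:
  fixes w w' :: real
  assumes k: "2 \<le> k" and H1: "\<And>J. J \<subseteq> V \<Longrightarrow> card J = Suc k \<Longrightarrow> \<exists>x\<in>J. \<exists>y\<in>J. x \<noteq> y \<and> R c w x y"
    and H2: "\<And>x. x \<in> V \<Longrightarrow> \<mu>\<^sup>2 * n \<le> card {y\<in>V. R c w x y}"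
    and w1: "w' + 4 * r + (r + 1) * c \<le> w" "real k + 2 + r \<le> w'"
    and w2: "5 * (real k) ^ 3 * w' \<le> \<mu>\<^sup>2 * n / 2"
    and t: "\<tau> * (k * (k + 1)) < \<mu> ^ 4 * n / 16"
    and n0: "0 < n" and I: "I \<subseteq> V" "card I = k"
  shows "\<exists>x\<in>I. \<exists>y\<in>I. x \<noteq> y \<and> R ((r + 1) * c + 2 * r) w' x y"
proof (rule ccontr)
  assume ind: "\<not> ?thesis"
  have rc0: "c * 2 \<le> (r + 1) * c" using r4 by (simp add: algebra_simps)
  have ww: "w' \<le> w"
  proof -
    have "0 \<le> real (4 * r) + real ((r + 1) * c)" by simp
    then show ?thesis using w1(1) by linarith
  qed
  have cc: "c \<le> (r + 1) * c + 2 * r" "2 * c + 1 \<le> (r + 1) * c + 2 * r" using rc0 r4 by linarith+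
  have nR: "\<not> R c w x y" if "x \<in> I" "y \<in> I" "x \<noteq> y" for x y
  proof
    assume "R c w x y"
    then have "R ((r + 1) * c + 2 * r) w' x y"
      by (rule reach_mono[OF _ cc(1) ww])
    then show False using ind that by blast
  qed
  have fI: "finite I" using I(1) fin by (rule finite_subset)
  \<comment> \<open>More than \<open>w' + 2\<close> vertices reachable from both \<open>x\<close>
    and \<open>y\<close> would serve as midpoints and make these two reachable from each
    other.\<close>
  define Z where "Z x y = {z\<in>V. R c w x z \<and> R c w y z}" for x y
  have cZ: "real (card (Z x y)) \<le> w' + 2" if "x \<in> I" "y \<in> I" "x \<noteq> y" for x y
  proof (rule ccontr)
    assume "\<not> ?thesis"
    then have a3: "w' + 2 < card (Z x y)" by simp
    have a12: "finite (Z x y)" "Z x y \<subseteq> V" using fin unfolding Z_def by auto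
    have a4: "R c w x z \<and> R c w z y" if "z \<in> Z x y" for z
    proof -
      have "R c w x z" "R c w y z" using that unfolding Z_def by auto
      then show ?thesis using reach_sym by metis
    qed
    have a5: "w' + 2 + c \<le> w"
    proof -
      have "real (c * 2) \<le> real ((r + 1) * c)" using rc0 by (simp only: of_nat_le_iff)
      then show ?thesis using w1(1) r4 by simp
    qed
    have "R (2 * c + 1) w' x y" by (rule reach_trans_many[OF a12 a3 a4 a5])
    then have "R ((r + 1) * c + 2 * r) w' x y"
      by (rule reach_mono[OF _ cc(2) order_refl])
    then show False using ind that by blast
  qed
  define PI where "PI = {(x, y). x \<in> I \<and> y \<in> I \<and> x \<noteq> y}"
  have PI: "finite PI" "card PI \<le> k * k"
  proof -
    have s: "PI \<subseteq> I \<times> I" unfolding PI_def by auto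
    then show "finite PI" using fI by (meson finite_SigmaI finite_subset)
    have "card PI \<le> card (I \<times> I)" using s fI by (intro card_mono) auto
    then show "card PI \<le> k * k" using I(2) by (simp add: card_cartesian_product)
  qed
  define Bad where "Bad = I \<union> (\<Union>e\<in>PI. Z (fst e) (snd e))"
  have w'0: "0 \<le> w'" using w1(2) by linarith
  have Bad: "finite Bad" "card Bad \<le> k + real k * k * (w' + 2)"
  proof -
    show "finite Bad" unfolding Bad_def Z_def using fI PI fin by auto
    have "card Bad \<le> card I + card (\<Union>e\<in>PI. Z (fst e) (snd e))" unfolding Bad_def by (rule card_Un_le)
    also have "card (\<Union>e\<in>PI. Z (fst e) (snd e)) \<le> (\<Sum>e\<in>PI. card (Z (fst e) (snd e)))"
      using PI(1) by (rule card_UN_le)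
    finally have "real (card Bad) \<le> k + (\<Sum>e\<in>PI. real (card (Z (fst e) (snd e))))"
      using I(2) by (simp flip: of_nat_sum)
    also have "(\<Sum>e\<in>PI. real (card (Z (fst e) (snd e)))) \<le> real (card PI) * (w' + 2)"
      using cZ by (intro sum_bounded_above) (auto simp: PI_def)
    also have "\<dots> \<le> real k * k * (w' + 2)"
      using PI(2) w'0 by (intro mult_right_mono) (auto simp flip: of_nat_mult)
    finally show "card Bad \<le> k + real k * k * (w' + 2)" by simp
  qed
  define V1 where "V1 = V - Bad"
  have V1: "V1 \<subseteq> V" "V1 \<inter> I = {}" unfolding V1_def Bad_def by auto
  define cl where "cl y = (SOME x. x \<in> I \<and> R c w x y)" for y
  have clx: "cl y \<in> I \<and> R c w (cl y) y" if y: "y \<in> V1" for y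
  proof -
    have yI: "y \<notin> I" "y \<in> V" using y V1 by auto
    have "insert y I \<subseteq> V" "card (insert y I) = Suc k" using yI I fI by auto
    then obtain a b where ab: "a \<in> insert y I" "b \<in> insert y I" "a \<noteq> b" "R c w a b" using H1 by blast
    have "a \<in> I \<and> b = y \<or> b \<in> I \<and> a = y" using ab nR[of a b] by auto
    then have "\<exists>x. x \<in> I \<and> R c w x y"
    proof
      assume "a \<in> I \<and> b = y" then show ?thesis using ab(4) by auto
    next
      assume b: "b \<in> I \<and> a = y"
      then have "R c w b y" using reach_sym[OF ab(4)] by simp
      then show ?thesis using b by auto
    qed
    then show ?thesis unfolding cl_def by (rule someI_ex)
  qed
  have cl_unique: "cl y = x" if "y \<in> V1" "x \<in> I" "R c w x y" for x y
  proof (rule ccontr)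
    assume "cl y \<noteq> x"
    then have p: "(cl y, x) \<in> PI" unfolding PI_def using clx[OF that(1)] that(2) by simp
    have "y \<in> Z (cl y) x" unfolding Z_def using clx[OF that(1)] that(1,3) V1(1) by auto
    then have "y \<in> (\<Union>e\<in>PI. Z (fst e) (snd e))" using p by (intro UN_I[OF p]) simp
    then have "y \<in> Bad" unfolding Bad_def by simp
    then show False using that unfolding V1_def by simp
  qed
  have same: "R c w y z" if yz: "y \<in> V1" "z \<in> V1" "y \<noteq> z" "cl y = cl z" for y z
  proof -
    \<comment> \<open>The representative is replaced by both \<open>y\<close> and \<open>z\<close>.
      Among these k + 1 vertices the reachable pair cannot use another member of \<open>I\<close>,
      so it is \<open>y\<close>, \<open>z\<close>.\<close>
    let ?J = "insert y (insert z (I - {cl y}))"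
    have yI: "y \<notin> I" "z \<notin> I" using yz V1 by auto
    have "card (I - {cl y}) = k - 1" using fI I(2) clx[OF yz(1)] by simp
    then have "card ?J = Suc k" using fI yI yz k by simp
    moreover have "?J \<subseteq> V" using yz V1 I(1) by auto
    ultimately obtain a b where ab: "a \<in> ?J" "b \<in> ?J" "a \<noteq> b" "R c w a b" using H1 by meson
    have no: "\<not> R c w x y'" if "y' \<in> {y, z}" "x \<in> I - {cl y}" for x y'
      using cl_unique[of y' x] that yz by auto
    consider "a \<in> {y, z}" "b \<in> {y, z}" | "a \<in> I - {cl y}" "b \<in> {y, z}"
      | "a \<in> {y, z}" "b \<in> I - {cl y}" | "a \<in> I" "b \<in> I" using ab(1,2) by auto
    then show ?thesis
    proof cases
      case 1
      then have "a = y \<and> b = z \<or> a = z \<and> b = y" using ab(3) by auto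
      then show ?thesis using ab(4) reach_sym[OF ab(4)] by auto
    next
      case 2 then show ?thesis using no ab(4) by metis
    next
      case 3 then show ?thesis using no reach_sym[OF ab(4)] by metis
    next
      case 4 then show ?thesis using nR ab(3,4) by metis
    qed
  qed
  \<comment> \<open>Twice \<open>w'\<close>, so that the second of two cliques can also avoid the
    first one and the two vertices to be joined.\<close>
  define w2 where "w2 = 2 * w'"
  define NT where "NT = {(a, b, d). a \<in> I \<and> b \<in> I \<and> d \<in> I \<and> \<not> robust_type cl V1 w2 a b d}"
  have NT: "finite NT" "card NT \<le> k * (k * k)"
  proof -
    have s: "NT \<subseteq> I \<times> I \<times> I" unfolding NT_def by auto
    then show "finite NT" using fI by (meson finite_SigmaI finite_subset)
    have "card NT \<le> card (I \<times> I \<times> I)" using s fI by (intro card_mono) auto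
    then show "card NT \<le> k * (k * k)" using I(2) by (simp add: card_cartesian_product)
  qed
  \<comment> \<open>Every non-robust type has a small set meeting all its cliques. Deleting these
    sets for all at most \<open>k ^ 3\<close> such types destroys them, so each type that still
    occurs afterwards is robust in the larger graph.\<close>
  have "\<forall>t. \<exists>W. t \<in> NT \<longrightarrow> finite W \<and> real (card W) \<le> w2 \<and>
      \<not> (\<exists>u v Q. typed_Kr cl V1 (fst t) (fst (snd t)) (snd (snd t)) u v Q \<and> insert u (insert v Q) \<inter> W = {})"
    unfolding NT_def robust_type_def by auto
  then obtain Wt where Wt: "\<And>t. t \<in> NT \<Longrightarrow> finite (Wt t)" "\<And>t. t \<in> NT \<Longrightarrow> real (card (Wt t)) \<le> w2"
    "\<And>t. t \<in> NT \<Longrightarrow> \<not> (\<exists>u v Q. typed_Kr cl V1 (fst t) (fst (snd t)) (snd (snd t)) u v Q \<and> insert u (insert v Q) \<inter> Wt t = {})"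
    by metis
  define Ws where "Ws = (\<Union>t\<in>NT. Wt t)"
  have Ws: "finite Ws" "card Ws \<le> real k ^ 3 * w2"
  proof -
    show "finite Ws" unfolding Ws_def using NT Wt(1) by blast
    have "card Ws \<le> (\<Sum>t\<in>NT. card (Wt t))" unfolding Ws_def using NT(1) by (rule card_UN_le)
    then have "real (card Ws) \<le> (\<Sum>t\<in>NT. real (card (Wt t)))" by (simp flip: of_nat_sum)
    also have "\<dots> \<le> real (card NT) * w2" using Wt(2) by (intro sum_bounded_above) auto
    also have "\<dots> \<le> real (k * (k * k)) * w2" 
    proof (rule mult_right_mono)
      show "real (card NT) \<le> real (k * (k * k))" using NT(2) by (simp only: of_nat_le_iff)
    qed (use w'0 in \<open>simp add: w2_def\<close>)
    finally show "card Ws \<le> real k ^ 3 * w2" by (simp add: power3_eq_cube mult.assoc)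
  qed
  define V2 where "V2 = V1 - Ws"
  define X where "X = Bad \<union> Ws"
  have V2X: "V2 = V - X" unfolding V2_def V1_def X_def by auto
  have fX: "finite X" unfolding X_def using Bad Ws by simp
  have cX: "card X \<le> \<mu>\<^sup>2 * n / 2"
  proof -
    have "real (card X) \<le> k + real k * k * (w' + 2) + real k ^ 3 * w2"
      using card_Un_le[of Bad Ws] Bad(2) Ws(2) unfolding X_def by linarith
    also have "\<dots> \<le> 5 * real k ^ 3 * w'"
    proof -
      have k3: "1 * w' \<le> real k ^ 3 * w'" using k w'0 by (intro mult_right_mono) auto
      have "real k * k * 1 \<le> real k * k * k" using k by (intro mult_left_mono) auto
      then have k32: "real k * k * (2 * w') \<le> real k ^ 3 * (2 * w')"
        using w'0 by (intro mult_right_mono) (auto simp: power3_eq_cube)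
      have "real k * k * (w' + 2) \<le> real k * k * (2 * w')" using w1(2) by (intro mult_left_mono) auto
      moreover have "real k \<le> w'" using w1(2) by simp
      ultimately show ?thesis using k3 k32 unfolding w2_def by linarith
    qed
    finally show ?thesis using w2 by linarith
  qed
  have "V \<noteq> {}" using n0 by auto
  then have muh: "\<mu> \<le> 1/2" by (rule mu_le)
  have mu2: "\<mu>\<^sup>2 \<le> \<mu> / 2" using mult_left_mono[OF muh, of \<mu>] mu by (simp add: power2_eq_square)
  have cX2: "card X \<le> \<mu> / 2 * n" "card X \<le> n / 2"
  proof -
    have "\<mu>\<^sup>2 * n \<le> \<mu> / 2 * n" using mu2 by (intro mult_right_mono) auto
    moreover have "\<mu> / 2 * n \<le> 1 / 2 * n" using muh by (intro mult_right_mono) auto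
    moreover have "0 \<le> \<mu> / 2 * n" using mu by simp
    ultimately show "card X \<le> \<mu> / 2 * n" "card X \<le> n / 2" using cX by linarith+
  qed
  have V2n: "real (card V2) \<le> n" "n / 2 \<le> card V2"
  proof -
    show "real (card V2) \<le> n" unfolding V2X using fin by (auto intro: card_mono)
    show "n / 2 \<le> card V2" unfolding V2X using card_Diff_ge[OF fX, of V] cX2(2) by linarith
  qed
  interpret H: dense_graph V2 E r "\<mu> / 2" \<tau>
    unfolding V2X by (rule dense_graph_Diff[OF fX cX2(1)])
  interpret G2: classed_graph V2 E r "\<mu> / 2" \<tau> cl I "\<mu>\<^sup>2 / 2"
  proof unfold_locales
    show "finite I" "2 \<le> card I" "0 < \<mu>\<^sup>2 / 2" using mu fI I k by auto
    show "cl v \<in> I" if "v \<in> V2" for v using clx[of v] that unfolding V2_def by blast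
    show "\<mu>\<^sup>2 / 2 * card V2 \<le> card {v\<in>V2. cl v = a}" if a: "a \<in> I" for a
    proof -
      have "{y\<in>V. R c w a y} - X \<subseteq> {v\<in>V2. cl v = a}"
        using cl_unique[OF _ a] unfolding V2X V1_def X_def by auto
      moreover have "finite {v\<in>V2. cl v = a}" unfolding V2X using fin by simp
      ultimately have "card ({y\<in>V. R c w a y} - X) \<le> card {v\<in>V2. cl v = a}" by (rule card_mono[rotated])
      moreover have "\<mu>\<^sup>2 * n \<le> card {y\<in>V. R c w a y}" using H2 a I(1) by blast
      moreover have "\<mu>\<^sup>2 / 2 * card V2 \<le> \<mu>\<^sup>2 / 2 * n" using V2n(1) by (intro mult_left_mono) auto
      ultimately show ?thesis using card_Diff_ge[OF fX, of "{y\<in>V. R c w a y}"] cX by linarith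
    qed
    show "\<tau> * (card I * (card I + 1)) < (\<mu> / 2)\<^sup>2 * (\<mu>\<^sup>2 / 2) * card V2"
    proof -
      have "\<mu> ^ 4 / 8 * (n / 2) \<le> \<mu> ^ 4 / 8 * card V2" using V2n(2) by (intro mult_left_mono) auto
      then show ?thesis using t unfolding I(2) by (simp add: power4_eq_xxxx power2_eq_square algebra_simps)
    qed
  qed
  have V21: "x \<in> V1" if "x \<in> V2" for x using that unfolding V2_def by simp
  have C2: "x \<in> V2 \<and> cl x = e \<and> e \<in> I" if "x \<in> G2.C e" for x e
    using that clx[OF V21, of x] unfolding G2.C_def by auto
  have rob: "robust_type cl V1 w2 a b d" if T: "G2.T a b d" for a b d
  proof (rule ccontr)
    assume nr: "\<not> robust_type cl V1 w2 a b d"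
    obtain u v where uv: "u \<in> G2.C a" "v \<in> G2.C b" "E u v" "\<tau> < card (nb E V2 u \<inter> nb E V2 v \<inter> G2.C d)"
      using T unfolding G2.T_def by blast
    obtain Q where Q: "Q \<subseteq> nb E V2 u \<inter> nb E V2 v \<inter> G2.C d" "card Q = r - 2" "finite Q"
      "Kr E r (insert u (insert v Q))"
      by (rule H.edge_extend[OF uv(3,4)])
    have QC: "Q \<subseteq> G2.C d" "u \<notin> Q" "v \<notin> Q" using Q(1) irr unfolding nb_def by auto
    have "Q \<noteq> {}" using Q(2,3) r4 by auto
    then have "d \<in> I" using QC(1) C2 by blast
    moreover have "a \<in> I" "b \<in> I" using uv(1,2) C2 by blast+
    ultimately have nt: "(a, b, d) \<in> NT" using nr unfolding NT_def by blast
    have uv2: "u \<in> V2" "v \<in> V2" "Q \<subseteq> V2" "cl u = a" "cl v = b" "\<forall>q\<in>Q. cl q = d"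
      using uv(1,2) QC(1) C2 by blast+
    have "typed_Kr cl V1 a b d u v Q"
      unfolding typed_Kr_def
    proof (intro conjI)
      show "u \<in> V1" "v \<in> V1" "Q \<subseteq> V1" using uv2(1-3) V21 by blast+
      show "u \<noteq> v" using uv(3) irr by blast
    qed (use uv2 Q QC in auto)
    moreover have "insert u (insert v Q) \<inter> Wt (a, b, d) = {}"
      using uv2(1-3) nt unfolding V2_def Ws_def by blast
    ultimately show False using Wt(3)[OF nt] by auto
  qed
  obtain a b b' d where T: "G2.T a b d" "G2.T a b' d" "b \<noteq> b'" by (rule G2.two_types)
  have "b \<in> I" "b' \<in> I" using T(1,2) C2 unfolding G2.T_def by blast+
  moreover have "R ((r + 1) * c + 2 * r) w' b b'"
  proof (rule exchange_reach[OF V1(1) same _ rob[OF T(1)] rob[OF T(2)]])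
    show "w' + 2 + r \<le> w2" unfolding w2_def using w1(2) k by linarith
    show "w' + 4 * r + (r + 1) * c \<le> w" by (rule w1(1))
  qed (use clx in auto)
  ultimately show False using ind T(3) by blast
qed

end

section \<open>Iterating the merging step until every pair is reachable\<close>

lemma (in dense_graph) reach_count_mono:
  assumes "x \<in> V" "\<mu>\<^sup>2 * n \<le> card {y\<in>V. R c w x y}" "c \<le> c'" "w' \<le> w"
  shows "\<mu>\<^sup>2 * n \<le> card {y\<in>V. R c' w' x y}"
proof -
  have "card {y\<in>V. R c w x y} \<le> card {y\<in>V. R c' w' x y}"
    using fin reach_mono[OF _ assms(3,4)] by (intro card_mono) auto
  then show ?thesis using assms(2) by linarith
qed

text \<open>Downward induction on the size \<open>k\<close> of vertex sets that must contain a
  reachable pair: it starts at \<open>C\<close>, of order \<open>2 / \<mu>\<close>, from shared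
  triangles, and ends at k = 2. The number of steps depends on \<open>\<mu>\<close> only, so the
  constants stay independent of the graph. \<open>good\<close> carries the
  \<open>\<mu>\<^sup>2 * card V\<close> reachable partners along, since the step needs them for the
  class sizes.\<close>

lemma all_reach:
  fixes r :: nat and \<mu> :: real
  assumes r4: "4 \<le> r" and mu: "0 < \<mu>"
  shows "\<exists>(c :: nat) (\<omega> :: real) (\<alpha> :: real) (n0 :: real). 0 < \<omega> \<and> 0 < \<alpha> \<and> (\<forall>(V :: 'a set) E \<tau>. dense_graph V E r \<mu> \<tau> \<longrightarrow>
    \<tau> \<le> \<alpha> * card V \<longrightarrow> n0 \<le> real (card V) \<longrightarrow>
    (\<forall>x\<in>V. \<forall>y\<in>V. x \<noteq> y \<longrightarrow> reach E r V c (\<omega> * card V) x y))"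
proof -
  define good where "good k c \<omega> \<alpha> n0 \<longleftrightarrow> 0 < \<omega> \<and> 0 < \<alpha> \<and> (\<forall>(V :: 'a set) E \<tau>. dense_graph V E r \<mu> \<tau> \<longrightarrow>
    \<tau> \<le> \<alpha> * card V \<longrightarrow> n0 \<le> real (card V) \<longrightarrow>
    (\<forall>J\<subseteq>V. card J = k \<longrightarrow> (\<exists>x\<in>J. \<exists>y\<in>J. x \<noteq> y \<and> reach E r V c (\<omega> * card V) x y)) \<and>
    (\<forall>x\<in>V. \<mu>\<^sup>2 * card V \<le> card {y\<in>V. reach E r V c (\<omega> * card V) x y}))"
    for k :: nat and c :: nat and \<omega> \<alpha> n0 :: real
  define C where "C = nat \<lceil>2 / \<mu>\<rceil> + 2"
  have C: "2 \<le> C" "2 \<le> C * \<mu>"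
  proof -
    show "2 \<le> C" unfolding C_def by simp
    have "2 / \<mu> \<le> C" unfolding C_def using mu by (simp add: le_of_int_ceiling) linarith
    then show "2 \<le> C * \<mu>" using mu by (simp add: field_simps)
  qed
  define \<eta> where "\<eta> = min (\<mu>\<^sup>2) (1 / (2 * (real C)\<^sup>2))"
  have eta: "0 < \<eta>" "\<eta> \<le> \<mu>\<^sup>2" "\<eta> \<le> 1 / (2 * (real C)\<^sup>2)" unfolding \<eta>_def using mu C by auto
  have base: "good C (r - 1) (\<eta> / 4) (\<eta> / 4) 1"
    unfolding good_def
  proof (intro conjI allI impI ballI)
    show "0 < \<eta> / 4" "0 < \<eta> / 4" using eta by auto
    fix V :: "'a set" and E \<tau>
    assume G: "dense_graph V E r \<mu> \<tau>" and t: "\<tau> \<le> \<eta> / 4 * card V" and n1: "1 \<le> real (card V)"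
    interpret dense_graph V E r \<mu> \<tau> by (rule G)
    have n0: "0 < n" using n1 by simp
    have lt: "\<tau> + 2 * (\<eta> / 4 * n) < \<eta> * n" using t eta n0 mult_pos_pos[of \<eta> n] by linarith
    show "\<exists>x\<in>J. \<exists>y\<in>J. x \<noteq> y \<and> R (r - 1) (\<eta> / 4 * n) x y" if J: "J \<subseteq> V" "card J = C" for J
    proof -
      obtain x y where xy: "x \<in> J" "y \<in> J" "x \<noteq> y" "1 / (2 * (real (card J))\<^sup>2) * n\<^sup>2 \<le> card (Ed x \<inter> Ed y)"
        using exists_codense_pair[OF J(1) _ n0] C(2) J(2) by auto
      have "\<eta> * n\<^sup>2 \<le> 1 / (2 * (real (card J))\<^sup>2) * n\<^sup>2"
        unfolding J(2) using eta(3) by (intro mult_right_mono) auto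
      then have "\<eta> * n\<^sup>2 \<le> card (Ed x \<inter> Ed y)" using xy(4) by linarith
      then have "R (r - 1) (\<eta> / 4 * n) x y" by (rule reach_of_codense[OF _ lt n0])
      then show ?thesis using xy by blast
    qed
    fix x assume x: "x \<in> V"
    have "{y\<in>V. \<mu>\<^sup>2 * n\<^sup>2 \<le> card (Ed x \<inter> Ed y)} \<subseteq> {y\<in>V. R (r - 1) (\<eta> / 4 * n) x y}"
    proof safe
      fix y assume "\<mu>\<^sup>2 * n\<^sup>2 \<le> card (Ed x \<inter> Ed y)"
      moreover have "\<eta> * n\<^sup>2 \<le> \<mu>\<^sup>2 * n\<^sup>2" using eta(2) by (intro mult_right_mono) auto
      ultimately have "\<eta> * n\<^sup>2 \<le> card (Ed x \<inter> Ed y)" by linarith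
      then show "R (r - 1) (\<eta> / 4 * n) x y" by (rule reach_of_codense[OF _ lt n0])
    qed
    then have "card {y\<in>V. \<mu>\<^sup>2 * n\<^sup>2 \<le> card (Ed x \<inter> Ed y)} \<le> card {y\<in>V. R (r - 1) (\<eta> / 4 * n) x y}"
      using fin by (intro card_mono) auto
    then show "\<mu>\<^sup>2 * n \<le> card {y\<in>V. R (r - 1) (\<eta> / 4 * n) x y}"
      using many_codense[OF x n0] by linarith
  qed
  have step: "\<exists>c \<omega> \<alpha> n0. good k c \<omega> \<alpha> n0" if k2: "2 \<le> k" and IH: "\<exists>c \<omega> \<alpha> n0. good (Suc k) c \<omega> \<alpha> n0" for k
  proof -
    obtain c \<omega> \<alpha> n0 where g: "good (Suc k) c \<omega> \<alpha> n0" using IH by blast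
    have pos: "0 < \<omega>" "0 < \<alpha>" using g unfolding good_def by auto
    define \<omega>' where "\<omega>' = min (\<omega> / 2) (\<mu>\<^sup>2 / (10 * real k ^ 3))"
    define \<alpha>' where "\<alpha>' = min \<alpha> (\<mu> ^ 4 / (32 * (real k * (real k + 1))))"
    define n0' where "n0' = max (max n0 1) ((4 * real r + (real r + 1) * c + k + 2) / \<omega>')"
    have k0: "0 < real k" using k2 by simp
    have k30: "0 < real k ^ 3" "0 < real k * (real k + 1)" using k0 by simp_all
    have om: "0 < \<omega>'" "2 * \<omega>' \<le> \<omega>" "\<omega>' * (10 * real k ^ 3) \<le> \<mu>\<^sup>2"
    proof -
      show "0 < \<omega>'" "2 * \<omega>' \<le> \<omega>" unfolding \<omega>'_def using pos mu k30 by auto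
      have "\<omega>' \<le> \<mu>\<^sup>2 / (10 * real k ^ 3)" unfolding \<omega>'_def by simp
      then show "\<omega>' * (10 * real k ^ 3) \<le> \<mu>\<^sup>2" using k30(1) by (simp only: pos_le_divide_eq mult_pos_pos)
    qed
    have al: "0 < \<alpha>'" "\<alpha>' \<le> \<alpha>" "\<alpha>' * (32 * (real k * (real k + 1))) \<le> \<mu> ^ 4"
    proof -
      show "0 < \<alpha>'" "\<alpha>' \<le> \<alpha>" unfolding \<alpha>'_def using pos mu k30 by auto
      have "\<alpha>' \<le> \<mu> ^ 4 / (32 * (real k * (real k + 1)))" unfolding \<alpha>'_def by simp
      then show "\<alpha>' * (32 * (real k * (real k + 1))) \<le> \<mu> ^ 4" using k30(2) by (simp only: pos_le_divide_eq mult_pos_pos)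
    qed
    have "good k ((r + 1) * c + 2 * r) \<omega>' \<alpha>' n0'"
      unfolding good_def
    proof (intro conjI allI impI ballI)
      show "0 < \<omega>'" "0 < \<alpha>'" by (fact om al)+
      fix V :: "'a set" and E \<tau>
      assume G: "dense_graph V E r \<mu> \<tau>" and t: "\<tau> \<le> \<alpha>' * card V" and nn: "n0' \<le> real (card V)"
      interpret dense_graph V E r \<mu> \<tau> by (rule G)
      have n0: "0 < n" "1 \<le> n" "n0 \<le> n" using nn unfolding n0'_def by auto
      have "(4 * real r + (real r + 1) * c + k + 2) / \<omega>' \<le> n" using nn unfolding n0'_def by simp
      then have big: "4 * real r + (real r + 1) * c + k + 2 \<le> \<omega>' * n"
        using om(1) by (simp add: divide_le_eq mult.commute)
      have "\<alpha>' * n \<le> \<alpha> * n" using al(2) by (intro mult_right_mono) auto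
      then have t2: "\<tau> \<le> \<alpha> * card V" using t by linarith
      have H1: "\<And>J. J \<subseteq> V \<Longrightarrow> card J = Suc k \<Longrightarrow> \<exists>x\<in>J. \<exists>y\<in>J. x \<noteq> y \<and> R c (\<omega> * n) x y"
        and H2: "\<And>x. x \<in> V \<Longrightarrow> \<mu>\<^sup>2 * n \<le> card {y\<in>V. R c (\<omega> * n) x y}"
        using g G t2 n0(3) unfolding good_def by meson+
      have rc: "real ((r + 1) * c) = (real r + 1) * c" by (simp add: algebra_simps)
      have "2 * \<omega>' * n \<le> \<omega> * n" using om(2) by (intro mult_right_mono) auto
      then have w1: "\<omega>' * n + 4 * r + (r + 1) * c \<le> \<omega> * n" using big rc by simp
      have rc0: "0 \<le> (real r + 1) * c" by simp
      have w2: "real k + 2 + r \<le> \<omega>' * n" using big rc0 by linarith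
      have w3: "5 * (real k) ^ 3 * (\<omega>' * n) \<le> \<mu>\<^sup>2 * n / 2"
        using mult_right_mono[OF om(3), of n] by (simp add: algebra_simps)
      have t4: "\<tau> * (k * (k + 1)) < \<mu> ^ 4 * n / 16"
      proof -
        have "\<tau> * (real k * (real k + 1)) \<le> \<alpha>' * n * (real k * (real k + 1))"
          using t by (intro mult_right_mono) auto
        moreover have "\<alpha>' * (32 * (real k * (real k + 1))) * n \<le> \<mu> ^ 4 * n" using al(3) by (intro mult_right_mono) auto
        moreover have "0 < \<mu> ^ 4 * n" using mu n0 by simp
        ultimately show ?thesis by (simp add: algebra_simps)
      qed
      show "\<exists>x\<in>J. \<exists>y\<in>J. x \<noteq> y \<and> R ((r + 1) * c + 2 * r) (\<omega>' * n) x y" if "J \<subseteq> V" "card J = k" for J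
        by (rule reach_step[OF k2 H1 H2 w1 w2 w3 t4 n0(1) that])
      fix x assume x: "x \<in> V"
      show "\<mu>\<^sup>2 * n \<le> card {y\<in>V. R ((r + 1) * c + 2 * r) (\<omega>' * n) x y}"
      proof (rule reach_count_mono[OF x H2[OF x]])
        show "c \<le> (r + 1) * c + 2 * r" by simp
        have "0 \<le> real (4 * r) + real ((r + 1) * c)" by simp
        then show "\<omega>' * n \<le> \<omega> * n" using w1 by linarith
      qed
    qed
    then show ?thesis by blast
  qed
  have "\<exists>c \<omega> \<alpha> n0. good 2 c \<omega> \<alpha> n0"
  proof (rule inc_induct[OF C(1)])
    show "\<exists>c \<omega> \<alpha> n0. good C c \<omega> \<alpha> n0" using base by blast
  qed (rule step)
  then obtain c \<omega> \<alpha> n0 where g: "good 2 c \<omega> \<alpha> n0" by blast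
  show ?thesis
  proof (rule exI[of _ c], rule exI[of _ \<omega>], rule exI[of _ \<alpha>], rule exI[of _ n0], intro conjI allI impI ballI)
    show "0 < \<omega>" "0 < \<alpha>" using g unfolding good_def by auto
    fix V :: "'a set" and E \<tau> x y
    assume a: "dense_graph V E r \<mu> \<tau>" "\<tau> \<le> \<alpha> * card V" "n0 \<le> real (card V)" "x \<in> V" "y \<in> V" "x \<noteq> y"
    have "\<forall>J\<subseteq>V. card J = 2 \<longrightarrow> (\<exists>x\<in>J. \<exists>y\<in>J. x \<noteq> y \<and> reach E r V c (\<omega> * card V) x y)"
      using g a(1-3) unfolding good_def by meson
    moreover have "{x, y} \<subseteq> V" "card {x, y} = 2" using a by auto
    ultimately have "\<exists>u\<in>{x, y}. \<exists>v\<in>{x, y}. u \<noteq> v \<and> reach E r V c (\<omega> * card V) u v" by meson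
    then show "reach E r V c (\<omega> * card V) x y" using reach_sym[of E r V c "\<omega> * card V" y x] by auto
  qed
qed

section \<open>The absorbing structure\<close>

context dense_graph
begin

text \<open>Only degrees into \<open>X\<close> are used: a neighbour \<open>v\<close> of
  \<open>u\<close> in \<open>X - W\<close> shares at least \<open>2 * \<nu> * card X\<close>
  neighbours with \<open>u\<close> inside \<open>X\<close>, and more than \<open>\<tau>\<close> of
  them survive the removal of \<open>W\<close>.\<close>

lemma Kr_at:
  fixes \<nu> :: real
  assumes X: "X \<subseteq> V" and u: "u \<in> V" and W: "finite W" "card W + \<tau> < 2 * \<nu> * card X"
    and nu: "0 < \<nu>" "\<nu> \<le> 1 / 2"
    and d: "\<And>v. v \<in> insert u X \<Longrightarrow> (1 / 2 + \<nu>) * card X \<le> card (N v \<inter> X)"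
  obtains K where "K \<subseteq> X - W" "u \<notin> K" "finite K" "card K = r - 1" "Kr E r (insert u K)"
proof -
  have fX: "finite X" using X fin by (rule finite_subset)
  have "2 * \<nu> * card X \<le> (1 / 2 + \<nu>) * card X" using nu by (intro mult_right_mono) auto
  then have "real (card W) < card (N u \<inter> X)" using W(2) tau d[of u] by simp
  then have "\<not> N u \<inter> X \<subseteq> W" using card_mono[OF W(1), of "N u \<inter> X"] by linarith
  then obtain v where v: "v \<in> N u" "v \<in> X" "v \<notin> W" by blast
  have "2 * \<nu> * card X \<le> card (N u \<inter> N v \<inter> X)"
    using inter_card_ge[OF fX, of "N u \<inter> X" "N v \<inter> X"] d[of u] d[of v] v(2)
    by (simp add: algebra_simps Int_ac)
  then have "\<tau> < card (N u \<inter> N v \<inter> (X - W))"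
    using card_Int_Diff_ge[OF W(1), of "N u \<inter> N v" X] W(2) by linarith
  moreover have uv: "E u v" using v(1) in_N by blast
  ultimately obtain Q where Q: "Q \<subseteq> N u \<inter> N v \<inter> (X - W)" "card Q = r - 2" "finite Q"
    "Kr E r (insert u (insert v Q))" using edge_extend by metis
  have ne: "u \<noteq> v" "u \<notin> Q" "v \<notin> Q" using uv Q(1) irr unfolding nb_def by auto
  show thesis
  proof (rule that[of "insert v Q"])
    show "insert v Q \<subseteq> X - W" using Q(1) v by blast
    show "card (insert v Q) = r - 1" using Q(2,3) ne r4 by simp
  qed (use Q ne in auto)
qed

text \<open>A fresh clique \<open>T\<close> on r vertices is paired with \<open>S\<close>, and
  \<open>G\<close> connects the pairs. Without \<open>S\<close> the absorber is tiled as
  \<open>G \<union> T\<close>; with \<open>S\<close> it splits into \<open>G \<union> S\<close> and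
  the tile \<open>T\<close>.\<close>

lemma absorber:
  fixes w :: real
  assumes all: "\<And>x y. x \<in> V \<Longrightarrow> y \<in> V \<Longrightarrow> x \<noteq> y \<Longrightarrow> R c w x y"
    and S: "S \<subseteq> V" "card S = r" and W: "finite W"
    and w: "real (card W) + 3 * r + r * c \<le> w" and room: "card W + 2 * r + \<tau> < 2 * \<mu> * n"
  obtains A where "A \<subseteq> V" "finite A" "card A \<le> r * c + r" "A \<inter> (W \<union> S) = {}"
    "tileable E r A" "tileable E r (A \<union> S)"
proof -
  have fS: "finite S" using S(1) fin by (rule finite_subset)
  have "S \<noteq> {}" using S(2) r4 by auto
  then have Vne: "V \<noteq> {}" using S(1) by blast
  have cWS: "card (W \<union> S) \<le> card W + r" using card_Un_le[of W S] S(2) by simp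
  then have m1: "real (card (W \<union> S)) + \<tau> < 2 * \<mu> * n" using room by linarith
  have "\<not> V \<subseteq> W \<union> S"
  proof
    assume "V \<subseteq> W \<union> S"
    then have "card V \<le> card (W \<union> S)" using W fS by (intro card_mono) auto
    moreover have "2 * \<mu> * n \<le> 1 * n" using mu_le[OF Vne] by (intro mult_right_mono) auto
    ultimately show False using m1 tau by linarith
  qed
  then obtain u where u: "u \<in> V" "u \<notin> W" "u \<notin> S" by blast
  have NV: "N v \<inter> V = N v" for v using N_sub by blast
  obtain K where K: "K \<subseteq> V - (W \<union> S)" "u \<notin> K" "finite K" "card K = r - 1" "Kr E r (insert u K)"
  proof (rule Kr_at[of V u "W \<union> S" \<mu>])
    show "(1 / 2 + \<mu>) * n \<le> card (N v \<inter> V)" if "v \<in> insert u V" for v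
      using deg[of v] that u(1) NV by auto
  qed (use u W fS m1 mu_le[OF Vne] mu in auto)
  define T where "T = insert u K"
  have T: "T \<subseteq> V" "finite T" "card T = r" "T \<inter> W = {}" "T \<inter> S = {}"
    unfolding T_def using K u r4 by auto
  obtain f where f: "bij_betw f S T" using finite_same_card_bij[OF fS T(2)] S(2) T(3) by auto
  have Rf: "R c w (id s) (f s)" if "s \<in> S" for s
  proof -
    have "f s \<in> T" using f that by (meson bij_betwE)
    then have "s \<noteq> f s" "f s \<in> V" using that T(1,5) by (metis disjoint_iff, blast)
    moreover have "s \<in> V" using that S(1) by blast
    ultimately show ?thesis using all[of s "f s"] by simp
  qed
  have num: "real (card W) + 2 * card S + card S * c \<le> w" using w S(2) by simp
  obtain G where G: "G \<subseteq> V" "finite G" "card G \<le> card S * c" "G \<inter> (W \<union> id ` S \<union> f ` S) = {}"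
    "tileable E r (G \<union> id ` S)" "tileable E r (G \<union> f ` S)"
    by (rule reach_family[OF fS inj_on_id bij_betw_imp_inj_on[OF f] Rf W num])
  have fS': "f ` S = T" using f by (simp add: bij_betw_def)
  show thesis
  proof (rule that[of "G \<union> T"])
    show "card (G \<union> T) \<le> r * c + r" using card_Un_le[of G T] G(3) S(2) T(3) by simp
    show "tileable E r (G \<union> T)" using G(6) fS' by simp
    have "tileable E r ((G \<union> S) \<union> T)"
    proof (rule tileable_Un)
      show "tileable E r (G \<union> S)" using G(5) by simp
      show "tileable E r T" unfolding T_def by (rule tileable_Kr[OF K(5)])
      show "(G \<union> S) \<inter> T = {}" using G(4) fS' T(5) by auto
    qed
    then show "tileable E r (G \<union> T \<union> S)" by (simp add: Un_ac)
  qed (use G T fS' in auto)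
qed

text \<open>The left side of the template is realised by \<open>X\<close> (flexible) and
  \<open>Y\<close> (fixed), the right side by disjoint sets \<open>Zs z\<close> of r - 1 vertices. A
  template edge is thus an r-set, and each gets its own absorber. Given \<open>X'\<close>, a perfect
  matching of the template partitions \<open>X'\<close>, \<open>Y\<close> and all
  \<open>Zs z\<close> into such r-sets, whose absorbers swallow them; all other absorbers are tiled
  alone. \<open>M\<close> adds up the sizes: \<open>X\<close>, \<open>Y\<close>, the sets
  \<open>Zs z\<close>, and at most \<open>98 * m\<close> absorbers.\<close>

lemma absorbing_structure:
  fixes w :: real
  assumes all: "\<And>x y. x \<in> V \<Longrightarrow> y \<in> V \<Longrightarrow> x \<noteq> y \<Longrightarrow> R c w x y"
    and X: "X \<subseteq> V" "card X = m + j" and j: "j \<le> m"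
    and M: "M = m + j + 2 * m + 3 * m * (r - 1) + 98 * m * (r * c + r)"
    and w: "real M + 3 * r + r * c \<le> w" and room: "M + 2 * r + \<tau> < 2 * \<mu> * n"
  obtains D where "D \<subseteq> V" "D \<inter> X = {}" "card D + card X \<le> M"
    "\<And>X'. X' \<subseteq> X \<Longrightarrow> card X' = m \<Longrightarrow> tileable E r (D \<union> X')"
proof -
  have fX: "finite X" using X(1) fin by (rule finite_subset)
  have Mn: "M \<le> card V"
  proof (cases "V = {}")
    case True then show ?thesis using room tau r4 by simp
  next
    case False
    have "2 * \<mu> * n \<le> 1 * n" using mu_le[OF False] by (intro mult_right_mono) auto
    then show ?thesis using room tau by linarith
  qed
  have "card (V - X) = card V - card X" using X(1) fX by (simp add: card_Diff_subset)
  then have "2 * m \<le> card (V - X)" using Mn X(2) unfolding M by linarith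
  then obtain Y where Y: "Y \<subseteq> V - X" "card Y = 2 * m" "finite Y" by (rule subset_of_card)
  have cXY: "card (X \<union> Y) = 3 * m + j" "finite (X \<union> Y)"
    using card_Un_disjoint[OF fX Y(3)] Y(1,2) X(2) fX Y(3) by auto
  have "\<exists>Zs. (\<forall>z\<in>{..<3 * m}. (Zs z \<subseteq> V \<and> card (Zs z) = r - 1) \<and> finite (Zs z) \<and> card (Zs z) \<le> r - 1 \<and> Zs z \<inter> (X \<union> Y) = {}) \<and>
    (\<forall>z\<in>{..<3 * m}. \<forall>z'\<in>{..<3 * m}. z \<noteq> z' \<longrightarrow> Zs z \<inter> Zs z' = {})"
  proof (rule greedy_disjoint)
    fix z :: nat and W :: "'a set"
    assume z: "z \<in> {..<3 * m}" and W: "finite W" "card W \<le> card (X \<union> Y) + card {..<3 * m} * (r - 1)"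
    have m0: "1 \<le> m" using z by (cases m) auto
    have rr: "r - 1 \<le> 98 * m * (r * c + r)"
    proof -
      have "1 * r \<le> 98 * m * (r * c + r)" using m0 by (intro mult_mono) auto
      then show ?thesis by linarith
    qed
    have "card V - card W \<le> card (V - W)" using W(1) by (rule diff_card_le_card_Diff)
    moreover have "card W + (r - 1) \<le> card V" using W(2) cXY(1) rr Mn unfolding M by simp
    ultimately have "r - 1 \<le> card (V - W)" by linarith
    then obtain A where A: "A \<subseteq> V - W" "card A = r - 1" "finite A" by (rule subset_of_card)
    then show "\<exists>A. (A \<subseteq> V \<and> card A = r - 1) \<and> finite A \<and> card A \<le> r - 1 \<and> A \<inter> W = {}"
      by (intro exI[of _ A]) auto
  qed (use cXY in auto)
  then obtain Zs where Zs0: "\<forall>z\<in>{..<3 * m}. (Zs z \<subseteq> V \<and> card (Zs z) = r - 1) \<and> finite (Zs z) \<and> card (Zs z) \<le> r - 1 \<and> Zs z \<inter> (X \<union> Y) = {}"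
    "\<forall>z\<in>{..<3 * m}. \<forall>z'\<in>{..<3 * m}. z \<noteq> z' \<longrightarrow> Zs z \<inter> Zs z' = {}" by (elim exE conjE) (rule that)
  then have Zs: "\<And>z. z < 3 * m \<Longrightarrow> Zs z \<subseteq> V" "\<And>z. z < 3 * m \<Longrightarrow> card (Zs z) = r - 1"
    "\<And>z. z < 3 * m \<Longrightarrow> finite (Zs z)" "\<And>z. z < 3 * m \<Longrightarrow> Zs z \<inter> (X \<union> Y) = {}"
    "\<And>z z'. z < 3 * m \<Longrightarrow> z' < 3 * m \<Longrightarrow> z \<noteq> z' \<Longrightarrow> Zs z \<inter> Zs z' = {}" by auto
  define ZZ where "ZZ = (\<Union>z\<in>{..<3 * m}. Zs z)"
  have ZZ: "finite ZZ" "card ZZ \<le> 3 * m * (r - 1)" "ZZ \<subseteq> V" "ZZ \<inter> (X \<union> Y) = {}"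
  proof -
    show "finite ZZ" "ZZ \<subseteq> V" unfolding ZZ_def using Zs(1,3) by auto
    have "ZZ \<inter> (X \<union> Y) = (\<Union>z\<in>{..<3 * m}. Zs z \<inter> (X \<union> Y))" unfolding ZZ_def by blast
    then show "ZZ \<inter> (X \<union> Y) = {}" using Zs(4) by simp
    have "card ZZ \<le> (\<Sum>z\<in>{..<3 * m}. card (Zs z))" unfolding ZZ_def by (rule card_UN_le) simp
    then show "card ZZ \<le> 3 * m * (r - 1)" using Zs(2) by simp
  qed
  obtain bx where bx: "bij_betw bx {0..<m + j} X" using ex_bij_betw_nat_finite[OF fX] X(2) by auto
  obtain by' where by': "bij_betw by' {0..<2 * m} Y" using ex_bij_betw_nat_finite[OF Y(3)] Y(2) by auto
  define \<eta> where "\<eta> i = (if i < m + j then bx i else by' (i - (m + j)))" for i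
  have eY: "\<eta> ` {m + j..<3 * m + j} = Y"
  proof -
    have "\<eta> ` {m + j..<3 * m + j} = by' ` ((\<lambda>i. i - (m + j)) ` {m + j..<3 * m + j})"
      unfolding \<eta>_def image_image by (intro image_cong) auto
    also have "(\<lambda>i. i - (m + j)) ` {m + j..<3 * m + j} = {0..<2 * m}"
    proof -
      have "x \<in> (\<lambda>i. i - (m + j)) ` {m + j..<3 * m + j}" if "x < 2 * m" for x
        by (rule image_eqI[of _ _ "x + (m + j)"]) (use that in auto)
      then show ?thesis by auto
    qed
    finally show ?thesis using by' by (simp add: bij_betw_def)
  qed
  have eXs: "\<eta> ` {..<m + j} = X" using bx unfolding \<eta>_def bij_betw_def by (auto simp: lessThan_atLeast0)
  have split: "{..<3 * m + j} = {..<m + j} \<union> {m + j..<3 * m + j}" by auto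
  have eXY: "\<eta> ` {..<3 * m + j} = X \<union> Y" unfolding split image_Un eXs eY ..
  have einj: "inj_on \<eta> {..<3 * m + j}" by (rule eq_card_imp_inj_on) (use eXY cXY in auto)
  obtain Bt where Bt: "Bt \<subseteq> {..<3 * m + j} \<times> {..<3 * m}" "card Bt \<le> 98 * m"
    "\<And>X. X \<subseteq> {..<m + j} \<Longrightarrow> card X = m \<Longrightarrow>
      \<exists>\<phi>. bij_betw \<phi> {..<3 * m} (X \<union> {m + j..<3 * m + j}) \<and> (\<forall>z<3 * m. (\<phi> z, z) \<in> Bt)"
    by (rule template[OF j]) (rule that; blast)
  have fBt: "finite Bt" using Bt(1) by (rule finite_subset) auto
  define S where "S e = insert (\<eta> (fst e)) (Zs (snd e))" for e
  define W0 where "W0 = X \<union> Y \<union> ZZ"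
  have W0: "finite W0" "card W0 \<le> m + j + 2 * m + 3 * m * (r - 1)"
    unfolding W0_def using cXY ZZ card_Un_le[of "X \<union> Y" ZZ] by auto
  have Se: "S e \<subseteq> V" "card (S e) = r" "S e \<subseteq> W0" "\<eta> (fst e) \<in> X \<union> Y" "snd e < 3 * m" "fst e < 3 * m + j" if "e \<in> Bt" for e
  proof -
    show e: "snd e < 3 * m" "fst e < 3 * m + j" using that Bt(1) by auto
    then show eta: "\<eta> (fst e) \<in> X \<union> Y" using eXY by blast
    then have "\<eta> (fst e) \<notin> Zs (snd e)" using Zs(4)[OF e(1)] by blast
    then show "card (S e) = r" unfolding S_def using Zs(2,3)[OF e(1)] r4 by simp
    show "S e \<subseteq> V" unfolding S_def using eta Zs(1)[OF e(1)] X(1) Y(1) by blast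
    show "S e \<subseteq> W0" unfolding S_def W0_def ZZ_def using eta e(1) by blast
  qed
  have "\<exists>A. (\<forall>e\<in>Bt. (A e \<subseteq> V \<and> tileable E r (A e) \<and> tileable E r (A e \<union> S e)) \<and> finite (A e) \<and> card (A e) \<le> r * c + r \<and> A e \<inter> W0 = {}) \<and>
    (\<forall>e\<in>Bt. \<forall>e'\<in>Bt. e \<noteq> e' \<longrightarrow> A e \<inter> A e' = {})"
  proof (rule greedy_disjoint[OF fBt W0(1)])
    fix e and W assume e: "e \<in> Bt" and W: "finite W" "W0 \<subseteq> W" "card W \<le> card W0 + card Bt * (r * c + r)"
    have "card Bt * (r * c + r) \<le> 98 * m * (r * c + r)" using Bt(2) by (rule mult_le_mono1)
    then have "card W \<le> M" using W(3) W0(2) unfolding M by linarith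
    then have cW: "real (card W) \<le> real M" by simp
    obtain A where "A \<subseteq> V" "finite A" "card A \<le> r * c + r" "A \<inter> (W \<union> S e) = {}"
      "tileable E r A" "tileable E r (A \<union> S e)"
    proof (rule absorber[OF all Se(1,2)[OF e] W(1)])
      show "real (card W) + 3 * r + r * c \<le> w" using w cW by linarith
      show "card W + 2 * r + \<tau> < 2 * \<mu> * n" using room cW by simp
    qed
    then show "\<exists>A. (A \<subseteq> V \<and> tileable E r A \<and> tileable E r (A \<union> S e)) \<and> finite A \<and> card A \<le> r * c + r \<and> A \<inter> W = {}"
      by (intro exI[of _ A]) auto
  qed
  then obtain A where A0: "\<forall>e\<in>Bt. (A e \<subseteq> V \<and> tileable E r (A e) \<and> tileable E r (A e \<union> S e)) \<and> finite (A e) \<and> card (A e) \<le> r * c + r \<and> A e \<inter> W0 = {}"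
    "\<forall>e\<in>Bt. \<forall>e'\<in>Bt. e \<noteq> e' \<longrightarrow> A e \<inter> A e' = {}" by (elim exE conjE) (rule that)
  then have A: "\<And>e. e \<in> Bt \<Longrightarrow> A e \<subseteq> V" "\<And>e. e \<in> Bt \<Longrightarrow> tileable E r (A e)" "\<And>e. e \<in> Bt \<Longrightarrow> tileable E r (A e \<union> S e)"
    "\<And>e. e \<in> Bt \<Longrightarrow> finite (A e)" "\<And>e. e \<in> Bt \<Longrightarrow> card (A e) \<le> r * c + r" "\<And>e. e \<in> Bt \<Longrightarrow> A e \<inter> W0 = {}"
    "\<And>e e'. e \<in> Bt \<Longrightarrow> e' \<in> Bt \<Longrightarrow> e \<noteq> e' \<Longrightarrow> A e \<inter> A e' = {}" by auto
  define AA where "AA = (\<Union>e\<in>Bt. A e)"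
  have AA: "finite AA" "card AA \<le> 98 * m * (r * c + r)" "AA \<subseteq> V" "AA \<inter> W0 = {}"
  proof -
    show "finite AA" "AA \<subseteq> V" unfolding AA_def using A(1,4) fBt by auto
    have "AA \<inter> W0 = (\<Union>e\<in>Bt. A e \<inter> W0)" unfolding AA_def by blast
    then show "AA \<inter> W0 = {}" using A(6) by simp
    have "card AA \<le> (\<Sum>e\<in>Bt. card (A e))" unfolding AA_def using fBt by (rule card_UN_le)
    also have "\<dots> \<le> card Bt * (r * c + r)" using A(5) sum_bounded_above[of Bt "\<lambda>e. card (A e)"] by simp
    also have "\<dots> \<le> 98 * m * (r * c + r)" using Bt(2) by (rule mult_le_mono1)
    finally show "card AA \<le> 98 * m * (r * c + r)" .
  qed
  show thesis
  proof (rule that[of "Y \<union> ZZ \<union> AA"])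
    show "Y \<union> ZZ \<union> AA \<subseteq> V" using Y ZZ AA by blast
    show "(Y \<union> ZZ \<union> AA) \<inter> X = {}" using Y ZZ AA unfolding W0_def by blast
    have "card (Y \<union> ZZ \<union> AA) \<le> card Y + card ZZ + card AA"
      using card_Un_le[of "Y \<union> ZZ" AA] card_Un_le[of Y ZZ] by linarith
    then show "card (Y \<union> ZZ \<union> AA) + card X \<le> M" using Y(2) ZZ(2) AA(2) X(2) unfolding M by linarith
    fix X' assume X': "X' \<subseteq> X" "card X' = m"
    define Xi where "Xi = {i\<in>{..<m + j}. \<eta> i \<in> X'}"
    have Xi_img: "\<eta> ` Xi = X'" unfolding Xi_def using X'(1) eXs by blast
    have "inj_on \<eta> Xi" using einj by (rule inj_on_subset) (auto simp: Xi_def)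
    then have "card Xi = m" using card_image[of \<eta> Xi] Xi_img X'(2) by simp
    moreover have "Xi \<subseteq> {..<m + j}" unfolding Xi_def by blast
    ultimately have "\<exists>\<phi>. bij_betw \<phi> {..<3 * m} (Xi \<union> {m + j..<3 * m + j}) \<and> (\<forall>z<3 * m. (\<phi> z, z) \<in> Bt)"
      by (rule Bt(3)[rotated])
    then obtain \<phi> where phi: "bij_betw \<phi> {..<3 * m} (Xi \<union> {m + j..<3 * m + j})" "\<forall>z<3 * m. (\<phi> z, z) \<in> Bt"
      by (elim exE conjE) (rule that)
    define piece where "piece e = (if \<phi> (snd e) = fst e then A e \<union> S e else A e)" for e
    have Sdis: "S e \<inter> S e' = {}" if e: "e \<in> Bt" "e' \<in> Bt" "e \<noteq> e'" "\<phi> (snd e) = fst e" "\<phi> (snd e') = fst e'" for e e'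
    proof -
      have ne: "snd e \<noteq> snd e'" using e by (metis prod_eqI)
      note s = Se(5)[OF e(1)] Se(5)[OF e(2)]
      have "fst e \<noteq> fst e'" using phi(1) e(4,5) ne s unfolding bij_betw_def inj_on_def by auto
      then have "\<eta> (fst e) \<noteq> \<eta> (fst e')" using einj Se(6)[OF e(1)] Se(6)[OF e(2)] unfolding inj_on_def by auto
      moreover have "\<eta> (fst e) \<notin> Zs (snd e')" using Zs(4)[OF s(2)] Se(4)[OF e(1)] by blast
      moreover have "\<eta> (fst e') \<notin> Zs (snd e)" using Zs(4)[OF s(1)] Se(4)[OF e(2)] by blast
      ultimately show ?thesis using Zs(5)[OF s ne] unfolding S_def by auto
    qed
    have "tileable E r (\<Union>e\<in>Bt. piece e)"
    proof (rule tileable_UN[OF fBt])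
      show "tileable E r (piece e)" if "e \<in> Bt" for e using A(2,3)[OF that] unfolding piece_def by simp
      fix e e' assume e: "e \<in> Bt" "e' \<in> Bt" "e \<noteq> e'"
      have "A e \<inter> A e' = {}" "A e \<inter> S e' = {}" "S e \<inter> A e' = {}"
        using A(7)[OF e] A(6)[OF e(1)] A(6)[OF e(2)] Se(3)[OF e(1)] Se(3)[OF e(2)] by blast+
      then show "piece e \<inter> piece e' = {}"
        using Sdis[OF e] unfolding piece_def by (simp add: Int_Un_distrib Int_Un_distrib2)
    qed
    moreover have "(\<Union>e\<in>Bt. piece e) = Y \<union> ZZ \<union> AA \<union> X'"
    proof -
      have "(\<Union>e\<in>Bt. piece e) = AA \<union> (\<Union>z\<in>{..<3 * m}. S (\<phi> z, z))"
      proof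
        show "(\<Union>e\<in>Bt. piece e) \<subseteq> AA \<union> (\<Union>z\<in>{..<3 * m}. S (\<phi> z, z))"
        proof
          fix x assume "x \<in> (\<Union>e\<in>Bt. piece e)"
          then obtain p z where e: "(p, z) \<in> Bt" "x \<in> piece (p, z)" by auto
          show "x \<in> AA \<union> (\<Union>z\<in>{..<3 * m}. S (\<phi> z, z))"
          proof (cases "x \<in> A (p, z)")
            case True then show ?thesis using e(1) unfolding AA_def by blast
          next
            case False
            then have "\<phi> z = p" "x \<in> S (p, z)" using e(2) unfolding piece_def by (auto split: if_splits)
            then show ?thesis using Se(5)[OF e(1)] by auto
          qed
        qed
        have "A e \<subseteq> piece e" for e unfolding piece_def by simp
        moreover have "S (\<phi> z, z) \<subseteq> piece (\<phi> z, z)" for z unfolding piece_def by simp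
        ultimately show "AA \<union> (\<Union>z\<in>{..<3 * m}. S (\<phi> z, z)) \<subseteq> (\<Union>e\<in>Bt. piece e)"
          unfolding AA_def using phi(2) by blast
      qed
      also have "(\<Union>z\<in>{..<3 * m}. S (\<phi> z, z)) = \<eta> ` (\<phi> ` {..<3 * m}) \<union> ZZ"
        unfolding S_def ZZ_def by auto
      also have "\<phi> ` {..<3 * m} = Xi \<union> {m + j..<3 * m + j}" using phi(1) by (simp add: bij_betw_def)
      also have "\<eta> ` (Xi \<union> {m + j..<3 * m + j}) = X' \<union> Y" unfolding image_Un Xi_img eY ..
      finally show ?thesis by blast
    qed
    ultimately show "tileable E r (Y \<union> ZZ \<union> AA \<union> X')" by simp
  qed
qed


text \<open>The order matters: reservoir and absorbing structure are set aside before the rest is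
  almost tiled. The leftover \<open>U\<close> is covered with the help of \<open>X\<close>, further
  cliques inside \<open>X\<close> bring the consumption to exactly \<open>j\<close>, and
  \<open>D\<close> absorbs the remaining \<open>m\<close> vertices.\<close>

lemma tileable_of_reservoir:
  fixes w \<epsilon> :: real
  assumes all: "\<And>x y. x \<in> V \<Longrightarrow> y \<in> V \<Longrightarrow> x \<noteq> y \<Longrightarrow> R c w x y"
    and X: "X \<subseteq> V" "card X = m + j" "j \<le> m"
      "\<And>u. u \<in> V \<Longrightarrow> (1 / 2 + \<mu> / 2) * card X \<le> card (N u \<inter> X)"
    and M: "M = m + j + 2 * m + 3 * m * (r - 1) + 98 * m * (r * c + r)"
    and w: "real M + 3 * r + r * c \<le> w" and room: "M + 2 * r + \<tau> < 2 * \<mu> * n" "M \<le> \<mu> / 2 * n"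
    and eps: "0 < \<epsilon>" "(\<tau> + 1) * r * (r + 3) \<le> \<mu> / 2 * \<epsilon> * (n / 2)" "\<epsilon> * n * r \<le> j"
    and j: "j + \<tau> < \<mu> * (m + j)"
    and dvd: "r dvd card V"
  shows "tileable E r V"
proof -
  have "V \<noteq> {}"
  proof
    assume "V = {}"
    then show False using room(1) tau r4 by simp
  qed
  then have muh: "\<mu> \<le> 1 / 2" by (rule mu_le)
  have fX: "finite X" using X(1) fin by (rule finite_subset)
  obtain D where D: "D \<subseteq> V" "D \<inter> X = {}" "card D + card X \<le> M"
    "\<forall>X'. X' \<subseteq> X \<longrightarrow> card X' = m \<longrightarrow> tileable E r (D \<union> X')"
  proof (rule absorbing_structure[OF _ X(1,2,3) M w room(1)])
    show "R c w x y" if "x \<in> V" "y \<in> V" "x \<noteq> y" for x y using all[OF that] .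
    fix D assume "D \<subseteq> V" "D \<inter> X = {}" "card D + card X \<le> M"
      "\<And>X'. X' \<subseteq> X \<Longrightarrow> card X' = m \<Longrightarrow> tileable E r (D \<union> X')"
    then show thesis by (intro that) auto
  qed
  have fD: "finite D" using D(1) fin by (rule finite_subset)
  define V0 where "V0 = V - (D \<union> X)"
  have fDX: "finite (D \<union> X)" using fD fX by simp
  have "card (D \<union> X) \<le> M" using card_Un_le[of D X] D(3) by linarith
  then have cDX: "real (card (D \<union> X)) \<le> \<mu> / 2 * n" using room(2) by linarith
  have V0: "n / 2 \<le> card V0" "real (card V0) \<le> n"
  proof -
    have "\<mu> / 2 * n \<le> 1 / 2 * n" using muh mu by (intro mult_right_mono) auto
    then show "n / 2 \<le> card V0" using card_Diff_ge[OF fDX, of V] cDX unfolding V0_def by linarith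
    show "real (card V0) \<le> n" unfolding V0_def using fin by (auto intro: card_mono)
  qed
  interpret G0: dense_graph V0 E r "\<mu> / 2" \<tau>
    unfolding V0_def by (rule dense_graph_Diff[OF fDX cDX])
  have "\<mu> / 2 * \<epsilon> * (n / 2) \<le> \<mu> / 2 * \<epsilon> * card V0" using V0(1) mu eps(1) by (intro mult_left_mono) auto
  then have eps': "(\<tau> + 1) * r * (r + 3) \<le> \<mu> / 2 * \<epsilon> * card V0" using eps(2) by linarith
  obtain T where T: "T \<subseteq> V0" "tileable E r T" "card (V0 - T) \<le> \<epsilon> * card V0"
    by (rule G0.almost_tiling[OF eps(1) eps'])
  define U where "U = V0 - T"
  have U: "finite U" "U \<subseteq> V" "U \<inter> X = {}" "U \<inter> D = {}" "U \<inter> T = {}"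
    unfolding U_def V0_def using fin by auto
  have cU: "card U * r \<le> j"
  proof -
    have "\<epsilon> * card V0 \<le> \<epsilon> * n" using V0(2) eps(1) by (intro mult_left_mono) auto
    then have "real (card U) \<le> \<epsilon> * n" using T(3) unfolding U_def by linarith
    then have "real (card U) * r \<le> \<epsilon> * n * r" by (intro mult_right_mono) auto
    then have "real (card U * r) \<le> real j" using eps(3) by simp
    then show ?thesis by linarith
  qed
  \<comment> \<open>While at most \<open>j\<close> vertices of \<open>X\<close> are in use,
    \<open>j + \<tau> < \<mu> * card X\<close> leaves room for another clique through any
    vertex.\<close>
  have pick: "\<exists>K. K \<subseteq> X - W \<and> u \<notin> K \<and> finite K \<and> card K = r - 1 \<and> Kr E r (insert u K)"
    if u: "u \<in> V" and W: "finite W" "card W \<le> j" for u W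
  proof -
    have r1: "real (card W) + \<tau> < 2 * (\<mu> / 2) * card X" using W(2) j X(2) by simp
    have d: "(1 / 2 + \<mu> / 2) * card X \<le> card (N v \<inter> X)" if "v \<in> insert u X" for v
      using X(4)[of v] that u X(1) by blast
    have h: "0 < \<mu> / 2" "\<mu> / 2 \<le> 1 / 2" using mu muh by auto
    obtain K where "K \<subseteq> X - W" "u \<notin> K" "finite K" "card K = r - 1" "Kr E r (insert u K)"
      by (rule Kr_at[OF X(1) u W(1) r1 h d])
    then show ?thesis by blast
  qed
  have "\<exists>K. (\<forall>u\<in>U. (K u \<subseteq> X \<and> card (K u) = r - 1 \<and> Kr E r (insert u (K u))) \<and> finite (K u) \<and> card (K u) \<le> r - 1 \<and> K u \<inter> {} = {}) \<and>
    (\<forall>u\<in>U. \<forall>u'\<in>U. u \<noteq> u' \<longrightarrow> K u \<inter> K u' = {})"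
  proof (rule greedy_disjoint[OF U(1)])
    fix u and W :: "'a set" assume u: "u \<in> U" and W: "finite W" "card W \<le> card ({} :: 'a set) + card U * (r - 1)"
    have "card U * (r - 1) \<le> card U * r" by simp
    moreover have "card W \<le> card U * (r - 1)" using W(2) by simp
    ultimately have "card W \<le> j" using cU by linarith
    moreover have "u \<in> V" using u U(2) by blast
    ultimately obtain K where "K \<subseteq> X - W" "u \<notin> K" "finite K" "card K = r - 1" "Kr E r (insert u K)"
      using pick W(1) by metis
    then show "\<exists>K. (K \<subseteq> X \<and> card K = r - 1 \<and> Kr E r (insert u K)) \<and> finite K \<and> card K \<le> r - 1 \<and> K \<inter> W = {}"
      by (intro exI[of _ K]) auto
  qed simp
  then obtain K where K0: "\<forall>u\<in>U. (K u \<subseteq> X \<and> card (K u) = r - 1 \<and> Kr E r (insert u (K u))) \<and> finite (K u) \<and> card (K u) \<le> r - 1 \<and> K u \<inter> {} = {}"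
    "\<forall>u\<in>U. \<forall>u'\<in>U. u \<noteq> u' \<longrightarrow> K u \<inter> K u' = {}" by (elim exE conjE) (rule that)
  then have K: "\<And>u. u \<in> U \<Longrightarrow> K u \<subseteq> X" "\<And>u. u \<in> U \<Longrightarrow> card (K u) = r - 1" "\<And>u. u \<in> U \<Longrightarrow> Kr E r (insert u (K u))"
    "\<And>u. u \<in> U \<Longrightarrow> finite (K u)" "\<And>u u'. u \<in> U \<Longrightarrow> u' \<in> U \<Longrightarrow> u \<noteq> u' \<Longrightarrow> K u \<inter> K u' = {}" by auto
  define X1 where "X1 = (\<Union>u\<in>U. K u)"
  have X1: "X1 \<subseteq> X" "finite X1" unfolding X1_def using K(1,4) U(1) by auto
  have cX1: "card X1 = card U * (r - 1)"
    unfolding X1_def by (subst card_UN_disjoint) (use K U in auto)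
  have tU: "tileable E r (U \<union> X1)"
  proof -
    have "tileable E r (\<Union>u\<in>U. insert u (K u))"
    proof (rule tileable_UN[OF U(1)])
      show "tileable E r (insert u (K u))" if "u \<in> U" for u using K(3)[OF that] by (rule tileable_Kr)
      fix u u' assume u: "u \<in> U" "u' \<in> U" "u \<noteq> u'"
      have "u \<notin> K u'" "u' \<notin> K u" using K(1)[OF u(1)] K(1)[OF u(2)] U(3) u by blast+
      then show "insert u (K u) \<inter> insert u' (K u') = {}" using K(5)[OF u] u(3) by auto
    qed
    moreover have "(\<Union>u\<in>U. insert u (K u)) = U \<union> X1" unfolding X1_def by blast
    ultimately show ?thesis by simp
  qed
  have "r dvd card D + m"
  proof -
    obtain X' where X': "X' \<subseteq> X" "card X' = m" "finite X'"
      using subset_of_card[of m X] X(2) by auto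
    have "tileable E r (D \<union> X')" using D(4) X' by blast
    then have "r dvd card (D \<union> X')" using fD X'(3) by (intro tileable_dvd) auto
    moreover have "card (D \<union> X') = card D + m"
      using card_Un_disjoint[OF fD X'(3)] D(2) X'(1,2) by auto
    ultimately show ?thesis by simp
  qed
  moreover have "r dvd card T"
    using tileable_dvd[OF T(2)] T(1) fin unfolding V0_def by (meson finite_Diff finite_subset)
  moreover have "card V = card D + (m + j) + card T + card U"
  proof -
    have fT: "finite T" using T(1) fin unfolding V0_def by (meson finite_Diff finite_subset)
    have "V = (D \<union> X) \<union> (T \<union> U)" using D(1) X(1) T(1) unfolding U_def V0_def by blast
    moreover have "(D \<union> X) \<inter> (T \<union> U) = {}" using T(1) unfolding U_def V0_def by blast
    ultimately have "card V = card (D \<union> X) + card (T \<union> U)"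
      using card_Un_disjoint[OF fDX, of "T \<union> U"] fT U(1) by simp
    moreover have "card (D \<union> X) = card D + (m + j)" using card_Un_disjoint[OF fD fX D(2)] X(2) by simp
    moreover have "card (T \<union> U) = card T + card U" using card_Un_disjoint[OF fT U(1)] U(5) by (simp add: Int_commute)
    ultimately show ?thesis by simp
  qed
  \<comment> \<open>Divisibility of \<open>j - card U * (r - 1)\<close>, the number of vertices of
    \<open>X\<close> still to be used up, is not arranged but inherited: \<open>V\<close>, the tiled
    part \<open>T\<close> and every completed absorbing structure have size divisible by r.\<close>
  ultimately have "r dvd j + card U"
  proof -
    assume a: "r dvd card D + m" "r dvd card T" "card V = card D + (m + j) + card T + card U"
    have "r dvd (card D + m + card T) + (j + card U)" using dvd a(3) by (simp add: add.commute add.left_commute)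
    moreover have "r dvd card D + m + card T" using a(1,2) by (rule dvd_add)
    ultimately show ?thesis by (simp only: dvd_add_right_iff)
  qed
  moreover have jU: "j + card U = (j - card U * (r - 1)) + card U * r"
  proof -
    have "card U * r = card U * (r - 1) + card U" using r4 by (cases r) auto
    then show ?thesis using cU by linarith
  qed
  ultimately have "r dvd (j - card U * (r - 1)) + card U * r" by simp
  then have "r dvd j - card U * (r - 1)" by (simp only: dvd_add_left_iff[OF dvd_triv_right])
  then obtain t where t: "j - card U * (r - 1) = r * t" by (elim dvdE)
  have jt: "j = card U * (r - 1) + t * r"
  proof -
    have "card U * (r - 1) \<le> card U * r" by simp
    then show ?thesis using t cU mult.commute[of t r] by linarith
  qed
  have "\<exists>L. (\<forall>i\<in>{..<t}. (Kr E r (L i) \<and> L i \<subseteq> X) \<and> finite (L i) \<and> card (L i) \<le> r \<and> L i \<inter> X1 = {}) \<and>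
    (\<forall>i\<in>{..<t}. \<forall>i'\<in>{..<t}. i \<noteq> i' \<longrightarrow> L i \<inter> L i' = {})"
  proof (rule greedy_disjoint[OF _ X1(2)])
    fix i and W :: "'a set" assume W: "finite W" "X1 \<subseteq> W" "card W \<le> card X1 + card {..<t} * r"
    have Wj: "card W \<le> j" using W(3) cX1 jt by simp
    have "card W < card X"
    proof -
      have "\<mu> * (real m + real j) \<le> 1 * (real m + real j)" using muh by (intro mult_right_mono) auto
      then have "real j < real (m + j)" using j tau by simp
      then show ?thesis using Wj X(2) by linarith
    qed
    then have "\<not> X \<subseteq> W" using card_mono[OF W(1), of X] by linarith
    then obtain u where u: "u \<in> X" "u \<notin> W" by blast
    then have "u \<in> V" using X(1) by blast
    then obtain K where "K \<subseteq> X - W" "u \<notin> K" "finite K" "card K = r - 1" "Kr E r (insert u K)"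
      using pick W(1) Wj by metis
    then show "\<exists>L. (Kr E r L \<and> L \<subseteq> X) \<and> finite L \<and> card L \<le> r \<and> L \<inter> W = {}"
      using u r4 by (intro exI[of _ "insert u K"]) auto
  qed simp
  then obtain L where L0: "\<forall>i\<in>{..<t}. (Kr E r (L i) \<and> L i \<subseteq> X) \<and> finite (L i) \<and> card (L i) \<le> r \<and> L i \<inter> X1 = {}"
    "\<forall>i\<in>{..<t}. \<forall>i'\<in>{..<t}. i \<noteq> i' \<longrightarrow> L i \<inter> L i' = {}" by (elim exE conjE) (rule that)
  define X2 where "X2 = (\<Union>i\<in>{..<t}. L i)"
  have X2: "X2 \<subseteq> X" "X1 \<inter> X2 = {}" "finite X2" unfolding X2_def using L0(1) by auto
  have tX2: "tileable E r X2"
    unfolding X2_def by (rule tileable_UN) (use L0 in \<open>auto intro: tileable_Kr\<close>)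
  have cX2: "card X2 = t * r"
  proof -
    have "card X2 = (\<Sum>i<t. card (L i))" unfolding X2_def by (rule card_UN_disjoint) (use L0 in auto)
    also have "\<dots> = (\<Sum>i<t. r)" using L0(1) by (intro sum.cong) (auto simp: Kr_def)
    finally show ?thesis by simp
  qed
  define X' where "X' = X - (X1 \<union> X2)"
  have "card (X1 \<union> X2) = j" using card_Un_disjoint[OF X1(2) X2(3,2)] cX1 cX2 jt by simp
  then have "card X' = m" unfolding X'_def using X1 X2 X(2) by (simp add: card_Diff_subset)
  then have tX': "tileable E r (D \<union> X')" using D(4) unfolding X'_def by blast
  have "tileable E r (T \<union> (U \<union> X1) \<union> X2 \<union> (D \<union> X'))"
  proof (rule tileable_Un[OF tileable_Un[OF tileable_Un[OF T(2) tU] tX2] tX'])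
    have TX: "T \<inter> X = {}" "T \<inter> D = {}" using T(1) unfolding V0_def by auto
    show "T \<inter> (U \<union> X1) = {}" using U(5) TX(1) X1(1) by blast
    show "(T \<union> (U \<union> X1)) \<inter> X2 = {}" using TX(1) U(3) X2(1,2) by blast
    have "X' \<subseteq> X" "X' \<inter> X1 = {}" "X' \<inter> X2 = {}" unfolding X'_def by auto
    then show "(T \<union> (U \<union> X1) \<union> X2) \<inter> (D \<union> X') = {}"
      using TX U(3,4) D(2) X1(1) X2(1) by blast
  qed
  moreover have "T \<union> (U \<union> X1) \<union> X2 \<union> (D \<union> X') = V"
    using T(1) D(1) X(1) X1(1) X2(1) unfolding U_def V0_def X'_def by blast
  ultimately show ?thesis by simp
qed

end

section \<open>The tiling theorem\<close>

lemma eventually_linear_gt: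
  fixes a b :: real
  assumes "0 < b" shows "\<forall>\<^sub>F n in sequentially. a < b * real n"
proof -
  obtain N :: nat where N: "a / b < N" using reals_Archimedean2 by blast
  have "a < b * real n" if "N \<le> n" for n
  proof -
    have "a < b * N" using N assms by (simp add: divide_less_eq mult.commute)
    also have "\<dots> \<le> b * n" using that assms by (intro mult_left_mono) auto
    finally show ?thesis .
  qed
  then show ?thesis unfolding eventually_sequentially by blast
qed

lemma dense_graph_tileable:
  fixes r :: nat and \<mu> :: real
  assumes r4: "4 \<le> r" and mu: "0 < \<mu>"
  shows "\<exists>\<alpha>>0. \<forall>\<^sub>F n in sequentially. r dvd n \<longrightarrow>
    (\<forall>(V :: 'a set) E. dense_graph V E r \<mu> (\<alpha> * real n) \<longrightarrow> card V = n \<longrightarrow> tileable E r V)"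
proof -
  obtain c :: nat and \<omega> \<alpha>1 n1 :: real where om: "0 < \<omega>" and al1: "0 < \<alpha>1" and
    reach: "\<forall>(V :: 'a set) E \<tau>. dense_graph V E r \<mu> \<tau> \<longrightarrow> \<tau> \<le> \<alpha>1 * card V \<longrightarrow> n1 \<le> real (card V) \<longrightarrow>
      (\<forall>x\<in>V. \<forall>y\<in>V. x \<noteq> y \<longrightarrow> reach E r V c (\<omega> * card V) x y)"
    using all_reach[OF r4 mu] by (elim exE conjE) (rule that)
  \<comment> \<open>Reservoir and absorbing structure together have at most \<open>m * B\<close>
    vertices; the 4 collects \<open>m + j + 2 * m\<close> with \<open>j \<le> m\<close>.\<close>
  define B where "B = 4 + 3 * (r - 1) + 98 * (r * c + r)"
  \<comment> \<open>A reservoir of about \<open>n / K\<close> vertices keeps the whole structure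
    below \<open>\<mu> * n / 4\<close> and below \<open>\<omega> * n / 2\<close>.\<close>
  define K where "K = nat \<lceil>4 * B / \<mu>\<rceil> + nat \<lceil>2 * B / \<omega>\<rceil> + 1"
  have K1: "1 \<le> K" unfolding K_def by simp
  then have K0: "0 < real K" by simp
  have KB: "4 * real B \<le> \<mu> * K" "2 * real B \<le> \<omega> * K"
  proof -
    have "4 * B / \<mu> \<le> K" "2 * B / \<omega> \<le> K" unfolding K_def by linarith+
    then show "4 * real B \<le> \<mu> * K" "2 * real B \<le> \<omega> * K" using mu om by (simp_all add: divide_le_eq mult.commute)
  qed
  \<comment> \<open>The almost perfect tiling must leave so little that r reservoir vertices for
    each leftover vertex fit into \<open>j\<close>: since \<open>n \<le> 2 * x * K\<close> for a
    reservoir of size \<open>x\<close>, this \<open>\<epsilon>\<close> gives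
    \<open>\<epsilon> * n * r \<le> \<mu> / 8 * x\<close>.\<close>
  define \<epsilon> where "\<epsilon> = \<mu> / (16 * K * r)"
  have r0: "0 < real r" using r4 by simp
  have eps0: "0 < \<epsilon>" unfolding \<epsilon>_def using mu K0 r0 by simp
  define \<alpha> where "\<alpha> = min \<alpha>1 (min (\<mu> / (8 * K)) (\<mu> * \<epsilon> / (8 * (r * (r + 3)))))"
  have al0: "0 < \<alpha>" unfolding \<alpha>_def using al1 mu K0 eps0 r0 by simp
  have al: "\<alpha> \<le> \<alpha>1" "\<alpha> * (8 * K) \<le> \<mu>" "\<alpha> * (8 * (real r * (real r + 3))) \<le> \<mu> * \<epsilon>"
  proof -
    show "\<alpha> \<le> \<alpha>1" unfolding \<alpha>_def by simp
    have "\<alpha> \<le> \<mu> / (8 * K)" unfolding \<alpha>_def by simp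
    then show "\<alpha> * (8 * K) \<le> \<mu>" using K0 by (simp add: le_divide_eq)
    have "\<alpha> \<le> \<mu> * \<epsilon> / (8 * (r * (r + 3)))" unfolding \<alpha>_def by simp
    moreover have "0 < 8 * (real r * (real r + 3))" using r0 by simp
    ultimately show "\<alpha> * (8 * (real r * (real r + 3))) \<le> \<mu> * \<epsilon>" by (simp add: le_divide_eq)
  qed
  have "\<forall>\<^sub>F n in sequentially. 0 < 1 * real n \<and> n1 < 1 * real n \<and> 40000 * (real K)\<^sup>2 < \<mu> ^ 4 * real n
      \<and> 2 * real K < 1 * real n \<and> 16 * real K < \<mu> * real n \<and> 3 * real r + r * c < \<omega> / 2 * real n
      \<and> 2 * real r < \<mu> / 4 * real n \<and> real r * (real r + 3) < \<mu> * \<epsilon> / 8 * real n"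
    using mu om eps0 by (intro eventually_conj eventually_linear_gt) simp_all
  then have "\<forall>\<^sub>F n in sequentially. r dvd n \<longrightarrow>
    (\<forall>(V :: 'a set) E. dense_graph V E r \<mu> (\<alpha> * real n) \<longrightarrow> card V = n \<longrightarrow> tileable E r V)"
  proof (rule eventually_mono, intro impI allI)
    fix p and V :: "'a set" and E
    assume N: "0 < 1 * real p \<and> n1 < 1 * real p \<and> 40000 * (real K)\<^sup>2 < \<mu> ^ 4 * real p
      \<and> 2 * real K < 1 * real p \<and> 16 * real K < \<mu> * real p \<and> 3 * real r + r * c < \<omega> / 2 * real p
      \<and> 2 * real r < \<mu> / 4 * real p \<and> real r * (real r + 3) < \<mu> * \<epsilon> / 8 * real p"
      and dvd: "r dvd p" and G: "dense_graph V E r \<mu> (\<alpha> * real p)" and cV: "card V = p"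
    interpret dense_graph V E r \<mu> "\<alpha> * real p" by (rule G)
    have N0: "0 < real p" using N by simp
    have "V \<noteq> {}" using N0 cV by auto
    then have muh: "\<mu> \<le> 1 / 2" by (rule mu_le)
    have "\<alpha> * real p \<le> \<alpha>1 * card V" using al(1) cV by (auto intro: mult_right_mono)
    then have all: "R c (\<omega> * p) x y" if "x \<in> V" "y \<in> V" "x \<noteq> y" for x y
      using reach G N cV that by auto
    have DN: "N x \<subseteq> V \<and> (1 / 2 + \<mu>) * card V \<le> card (N x)" if "x \<in> V" for x
      using N_sub deg[OF that] by blast
    have large: "40000 * (real K)\<^sup>2 < \<mu> ^ 4 * card V" using N cV by simp
    obtain X where X: "X \<subseteq> V" "card X = card V div K"
      "\<forall>u\<in>V. (1 / 2 + \<mu> / 2) * card X \<le> card (N u \<inter> X)"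
    proof (rule reservoir[OF fin mu muh K1 DN large])
      fix X assume "X \<subseteq> V" "card X = card V div K"
        "\<And>u. u \<in> V \<Longrightarrow> (1 / 2 + \<mu> / 2) * card X \<le> card (N u \<inter> X)"
      then show thesis by (intro that) auto
    qed
    define x where "x = p div K"
    have cX: "card X = x" using X(2) cV unfolding x_def by simp
    have x_le: "real x * K \<le> p" unfolding x_def by (metis div_times_less_eq_dividend of_nat_le_iff of_nat_mult)
    have x_ge: "real p \<le> 2 * (real x * K)"
    proof -
      have "p < x * K + K" unfolding x_def using K1 by (simp add: dividend_less_div_times add.commute)
      then have "real p < real (x * K + K)" by (simp only: of_nat_less_iff)
      then show ?thesis using N by simp
    qed
    have mux: "8 < \<mu> * x"
    proof -
      have "16 * real K < \<mu> * p" using N by simp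
      also have "\<dots> \<le> \<mu> * (2 * (real x * K))" using x_ge mu by (intro mult_left_mono) auto
      finally have "8 * real K < (\<mu> * x) * K" by (simp add: algebra_simps)
      then show ?thesis using K0 by simp
    qed
    \<comment> \<open>A quarter of \<open>\<mu>\<close> times the reservoir may be consumed; another
      quarter bounds \<open>\<tau>\<close>, so both stay below the codegree \<open>\<mu> * x\<close>
      inside the reservoir. Rounding down costs at most half, since
      \<open>8 < \<mu> * x\<close>.\<close>
    define j where "j = nat \<lfloor>\<mu> / 4 * x\<rfloor>"
    have j: "j \<le> \<mu> / 4 * x" "\<mu> / 8 * x \<le> j"
    proof -
      have "0 \<le> \<mu> / 4 * x" using mu by simp
      then have "real j \<le> \<mu> / 4 * x" "\<mu> / 4 * x < real j + 1" unfolding j_def by linarith+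
      then show "j \<le> \<mu> / 4 * x" "\<mu> / 8 * x \<le> j" using mux by linarith+
    qed
    define m where "m = x - j"
    have "\<mu> / 4 * x \<le> 1 / 8 * x" using muh by (intro mult_right_mono) auto
    then have jx: "8 * j \<le> x" using j(1) by linarith
    then have mj: "m + j = x" "j \<le> m" "m \<le> x" unfolding m_def by auto
    define M where "M = m + j + 2 * m + 3 * m * (r - 1) + 98 * m * (r * c + r)"
    have "M \<le> m * B" unfolding M_def B_def using mj(2) by (simp add: algebra_simps)
    also have "\<dots> \<le> x * B" using mj(3) by simp
    finally have MB: "real M \<le> real x * B" by (simp only: of_nat_le_iff flip: of_nat_mult)
    have M_bd: "4 * real M \<le> \<mu> * p" "2 * real M \<le> \<omega> * p"
    proof -
      have "4 * real M \<le> x * (\<mu> * K)" using mult_left_mono[OF KB(1), of "real x"] MB by simp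
      also have "\<dots> \<le> \<mu> * p" using mult_left_mono[OF x_le, of \<mu>] mu by (simp add: algebra_simps)
      finally show "4 * real M \<le> \<mu> * p" .
      have "2 * real M \<le> x * (\<omega> * K)" using mult_left_mono[OF KB(2), of "real x"] MB by simp
      also have "\<dots> \<le> \<omega> * p" using mult_left_mono[OF x_le, of \<omega>] om by (simp add: algebra_simps)
      finally show "2 * real M \<le> \<omega> * p" .
    qed
    have tx: "\<alpha> * p \<le> \<mu> / 4 * x"
    proof -
      have "\<alpha> * p \<le> \<alpha> * (2 * (real x * K))" using x_ge al0 by (intro mult_left_mono) auto
      also have "\<dots> = \<alpha> * (8 * K) * x / 4" by simp
      also have "\<dots> \<le> \<mu> * x / 4" using al(2) by (intro divide_right_mono mult_right_mono) auto
      finally show ?thesis by simp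
    qed
    have tN: "\<alpha> * p \<le> \<mu> / 8 * p"
    proof -
      have "\<alpha> * 8 * 1 \<le> \<alpha> * 8 * K" using K1 al0 by (intro mult_left_mono) auto
      then have "\<alpha> \<le> \<mu> / 8" using al(2) by simp
      then show ?thesis by (intro mult_right_mono) auto
    qed
    show "tileable E r V"
    proof (rule tileable_of_reservoir[where X = X and m = m and j = j and M = M and c = c and w = "\<omega> * p" and \<epsilon> = \<epsilon>])
      show "R c (\<omega> * real p) x y" if "x \<in> V" "y \<in> V" "x \<noteq> y" for x y using all[OF that] .
      show "X \<subseteq> V" "card X = m + j" "j \<le> m" using X cX mj by auto
      show "(1 / 2 + \<mu> / 2) * card X \<le> card (N u \<inter> X)" if "u \<in> V" for u using X(3) that by blast
      show "M = m + j + 2 * m + 3 * m * (r - 1) + 98 * m * (r * c + r)" by (rule M_def)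
      show "real M + 3 * r + r * c \<le> \<omega> * p" using M_bd(2) N by simp
      show "M + 2 * r + \<alpha> * p < 2 * \<mu> * card V"
      proof -
        have "0 < \<mu> * p" using mu N0 by simp
        moreover have "2 * real r < \<mu> * p / 4" using N by simp
        ultimately show ?thesis using M_bd(1) tN unfolding cV by simp
      qed
      show "M \<le> \<mu> / 2 * card V" using M_bd(1) unfolding cV by simp
      show "0 < \<epsilon>" by (rule eps0)
      show "(\<alpha> * p + 1) * r * (r + 3) \<le> \<mu> / 2 * \<epsilon> * (card V / 2)"
      proof -
        have "\<alpha> * (8 * (real r * (real r + 3))) * p \<le> \<mu> * \<epsilon> * p" using al(3) by (intro mult_right_mono) auto
        moreover have "real r * (real r + 3) < \<mu> * \<epsilon> / 8 * p" using N by simp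
        ultimately show ?thesis unfolding cV by (simp add: algebra_simps)
      qed
      show "\<epsilon> * card V * r \<le> j"
      proof -
        have "\<epsilon> * p * r = \<mu> * p / (16 * K)" unfolding \<epsilon>_def using r0 by simp
        also have "\<dots> \<le> \<mu> * (2 * (real x * K)) / (16 * K)"
          using x_ge mu K0 by (intro divide_right_mono mult_left_mono) auto
        also have "\<dots> = \<mu> / 8 * x" using K0 by simp
        finally show ?thesis using j(2) unfolding cV by simp
      qed
      show "real j + \<alpha> * real p < \<mu> * (real m + real j)"
      proof -
        have "real m + real j = x" using mj(1) by linarith
        moreover have "j + \<alpha> * p < \<mu> * x" using j(1) tx mux by simp
        ultimately show ?thesis by simp
      qed
      show "r dvd card V" using dvd cV by simp
    qed
  qed
  then show ?thesis using al0 by blast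
qed

section \<open>From adjacency relations back to graphs as pairs\<close>

definition adj :: "'a graph \<Rightarrow> 'a \<Rightarrow> 'a \<Rightarrow> bool" where
  "adj G x y \<longleftrightarrow> {x, y} \<in> edges G"

lemma contains_clique:
  assumes "contains_copy (induced_subgraph G A) (complete_graph l)"
  shows "\<exists>Q\<subseteq>A. card Q = l \<and> clique (adj G) Q"
proof -
  obtain H f where H: "subgraph H (induced_subgraph G A)"
    and f: "bij_betw f (verts H) {..<l}"
    and e: "\<And>u v. u \<in> verts H \<Longrightarrow> v \<in> verts H \<Longrightarrow> {u, v} \<in> edges H \<longleftrightarrow> {f u, f v} \<subseteq> {..<l} \<and> card {f u, f v} = 2"
    using assms unfolding contains_copy_def isomorphic_def complete_graph_def by auto
  have "verts H \<subseteq> A" "edges H \<subseteq> edges G" using H unfolding subgraph_def induced_subgraph_def by auto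
  moreover have "card (verts H) = l" using bij_betw_same_card[OF f] by simp
  moreover have "{u, v} \<in> edges H" if "u \<in> verts H" "v \<in> verts H" "u \<noteq> v" for u v
  proof -
    have "f u \<noteq> f v" "f u < l" "f v < l" using that f unfolding bij_betw_def inj_on_def by auto
    then show ?thesis using e[OF that(1,2)] by simp
  qed
  ultimately show ?thesis unfolding clique_def adj_def by blast
qed

text \<open>A set larger than the independence number cannot belong to the family whose maximum
  defines that number, so it contains a copy of the complete graph. Nonnegativity of
  \<open>\<tau>\<close> comes from its lying above a natural number.\<close>

lemma dense_graph_of_simple_graph:
  fixes \<mu> \<tau> :: real
  assumes r: "4 \<le> r" and mu: "0 < \<mu>" and G: "simple_graph G"
    and deg: "(1 / 2 + \<mu>) * card (verts G) \<le> min_degree G"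
    and ind: "K_indep_number (r - 2) G \<le> \<tau>"
  shows "dense_graph (verts G) (adj G) r \<mu> \<tau>"
proof
  have fV: "finite (verts G)" and ed: "\<And>e. e \<in> edges G \<Longrightarrow> e \<subseteq> verts G \<and> card e = 2"
    using G unfolding simple_graph_def by auto
  show "finite (verts G)" by (rule fV)
  show "adj G y x" if "adj G x y" for x y using that unfolding adj_def by (simp add: insert_commute)
  show "\<not> adj G x x" for x using ed[of "{x, x}"] unfolding adj_def by auto
  show "4 \<le> r" "0 < \<mu>" using r mu by auto
  show "0 \<le> \<tau>" using ind by linarith
  show "(1 / 2 + \<mu>) * card (verts G) \<le> card (nb (adj G) (verts G) x)" if "x \<in> verts G" for x
  proof -
    have "nb (adj G) (verts G) x = neighbours G x"
      unfolding nb_def adj_def neighbours_def using ed by blast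
    moreover have "min_degree G \<le> card (neighbours G x)"
      unfolding min_degree_def using fV that by (intro Min_le) auto
    ultimately show ?thesis using deg by simp
  qed
  show "\<exists>Q\<subseteq>A. card Q = r - 2 \<and> clique (adj G) Q" if A: "A \<subseteq> verts G" "\<tau> < card A" for A
  proof (rule contains_clique, rule ccontr)
    let ?S = "{card S | S. S \<subseteq> verts G \<and> \<not> contains_copy (induced_subgraph G S) (complete_graph (r - 2))}"
    assume "\<not> contains_copy (induced_subgraph G A) (complete_graph (r - 2))"
    then have "card A \<in> ?S" using A(1) by blast
    moreover have "finite ?S" using fV by (intro finite_subset[of ?S "card ` Pow (verts G)"]) auto
    ultimately have "card A \<le> K_indep_number (r - 2) G" unfolding K_indep_number_def by (rule Max_ge[rotated])
    then show False using ind A(2) by linarith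
  qed
qed

lemma K_factor_of_tileable:
  assumes G: "simple_graph G" and t: "tileable (adj G) r (verts G)"
  shows "\<exists>T. K_factor r G T"
proof -
  obtain P where P: "\<forall>K\<in>P. Kr (adj G) r K" "pairwise disjnt P" "\<Union>P = verts G"
    using t unfolding tileable_def by blast
  define g where "g K = (K, {e. e \<subseteq> K \<and> card e = 2})" for K :: "'a set"
  have "subgraph (g K) G \<and> isomorphic (g K) (complete_graph r)" if "K \<in> P" for K
  proof
    have K: "finite K" "card K = r" "clique (adj G) K" "K \<subseteq> verts G" using P that unfolding Kr_def by auto
    have "e \<in> edges G" if e: "e \<subseteq> K" "card e = 2" for e
    proof -
      obtain u v where "e = {u, v}" "u \<noteq> v" using e(2) by (auto simp: card_2_iff)
      then show ?thesis using K(3) e(1) unfolding clique_def adj_def by auto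
    qed
    then show "subgraph (g K) G" unfolding subgraph_def simple_graph_def g_def using K(1,4) by auto
    obtain f where f: "bij_betw f K {..<r}" using finite_same_card_bij[OF K(1), of "{..<r}"] K(2) by auto
    \<comment> \<open>The definition of isomorphism also tests \<open>u = v\<close>; there both
      sides fail, as a singleton does not have two elements.\<close>
    have "{u, v} \<subseteq> K \<and> card {u, v} = 2 \<longleftrightarrow> {f u, f v} \<subseteq> {..<r} \<and> card {f u, f v} = 2" if "u \<in> K" "v \<in> K" for u v
    proof (cases "u = v")
      case False
      then have "f u \<noteq> f v" "f u < r" "f v < r" using that f unfolding bij_betw_def inj_on_def by auto
      then show ?thesis using False that by simp
    qed simp
    then show "isomorphic (g K) (complete_graph r)"
      unfolding isomorphic_def complete_graph_def g_def using f by (intro exI[of _ f]) simp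
  qed
  moreover have "pairwise (\<lambda>H H'. disjnt (verts H) (verts H')) (g ` P)"
    using P(2) unfolding pairwise_def g_def by auto
  moreover have "(\<Union>H\<in>g ` P. verts H) = verts G" using P(3) unfolding g_def by auto
  ultimately have "K_factor r G (g ` P)" unfolding K_factor_def K_tiling_def by blast
  then show ?thesis by blast
qed

theorem theorem1p5:
  fixes r :: nat and \<mu> :: real
  assumes "r \<ge> 4" and "\<mu> > 0"
  shows "\<exists>\<alpha>>0. \<forall>\<^sub>F n in sequentially. r dvd n \<longrightarrow>
    (\<forall>G :: 'a graph. simple_graph G \<longrightarrow> card (verts G) = n \<longrightarrow>
       real (min_degree G) \<ge> (1 / 2 + \<mu>) * real n \<longrightarrow>
       real (K_indep_number (r - 2) G) \<le> \<alpha> * real n \<longrightarrow>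
       (\<exists>T. K_factor r G T))"
proof -
  obtain \<alpha> :: real where al: "0 < \<alpha>" and ev: "\<forall>\<^sub>F n in sequentially. r dvd n \<longrightarrow>
    (\<forall>(V :: 'a set) E. dense_graph V E r \<mu> (\<alpha> * real n) \<longrightarrow> card V = n \<longrightarrow> tileable E r V)"
    using dense_graph_tileable[OF assms] by blast
  have "\<forall>\<^sub>F n in sequentially. r dvd n \<longrightarrow>
    (\<forall>G :: 'a graph. simple_graph G \<longrightarrow> card (verts G) = n \<longrightarrow>
       real (min_degree G) \<ge> (1 / 2 + \<mu>) * real n \<longrightarrow>
       real (K_indep_number (r - 2) G) \<le> \<alpha> * real n \<longrightarrow>
       (\<exists>T. K_factor r G T))"
    using ev
  proof (rule eventually_mono, intro impI allI)
    fix n and G :: "'a graph"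
    assume t: "r dvd n \<longrightarrow> (\<forall>(V :: 'a set) E. dense_graph V E r \<mu> (\<alpha> * real n) \<longrightarrow> card V = n \<longrightarrow> tileable E r V)"
      and n: "r dvd n" and G: "simple_graph G" "card (verts G) = n"
      and d: "real (min_degree G) \<ge> (1 / 2 + \<mu>) * real n" "real (K_indep_number (r - 2) G) \<le> \<alpha> * real n"
    have "dense_graph (verts G) (adj G) r \<mu> (\<alpha> * real n)"
      using dense_graph_of_simple_graph[OF assms G(1)] d G(2) by simp
    then have "tileable (adj G) r (verts G)" using t n G(2) by blast
    then show "\<exists>T. K_factor r G T" by (rule K_factor_of_tileable[OF G(1)])
  qed
  then show ?thesis using al by blast
qed

end
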